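(* Let $A\subset B(H)$ be a von Neumann subalgebra with predual $A_*$, and let $q\colon B(H)_*\to A_*$ be the corresponding quotient mapping (the preadjoint of the embedding $A\hookrightarrow B(H)$). Let $n,k\ge1$ and consider $\{x_J\mid J\in[n]^k\}$ in $A_*$ such that $$\Big\|\sum_{J\in[n]^k}\varepsilon_Jx_J\Big\|_{L_1(\Omega^k,A_* )}<1 .$$ Then $(x_J)$ admits a decomposition $$x_J=\sum_{\alpha\in\{0,1\}^k}x_J^\alpha,\qquad x_J^\alpha=q\Big(\sum_m\lambda_m^\alpha\,h^{\alpha,m}_{\pi_\alpha(J)}\otimes k^{\alpha,m}_{\pi_{\alpha^c}(J)}\Big)\qquad(J\in[n]^k),$$ where for each $\alpha$ and each $m$, $\{h_i^{\alpha,m}\mid i\in[n]^\alpha\}$ and $\{k_j^{\alpha,m}\mid j\in[n]^{\alpha^c}\}$ are elements of $H$ such that $\sum_i\|h_i^{\alpha,m}\|^2\le1$ and $\sum_j\|k_j^{\alpha,m}\|^2\le1$, and where $\lambda_m^\alpha$ are scalars such that $$\sum_\alpha\sum_m|\lambda_m^\alpha|<2^{2k}.$$ Conversely, if $(x_J)$ admits such a decomposition, then $\big\|\sum_J\varepsilon_Jx_J\big\|_{L_1(\Omega^k,A_* )}<2^{2k}$.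
   Context: $[n]=\{1,\dots,n\}$. $\Omega=\mathbb T^{\mathbb N}$ with normalized Haar measure $\mu$; $\varepsilon_j\colon\Omega\to\mathbb T$ are the coordinate functions; $\Omega^k$ carries the product measure $\mu^k$; for $J=(j_1,\dots,j_k)$, $\varepsilon_J(t_1,\dots,t_k)=\varepsilon_{j_1}(t_1)\cdots\varepsilon_{j_k}(t_k)$; $\|\sum_J\varepsilon_Jx_J\|_{L_1(\Omega^k,A_* )}=\int_{\Omega^k}\|\sum_J\varepsilon_J(t)x_J\|_{A_*}d\mu^k(t)$. An element $\alpha\in\{0,1\}^k$ is identified with the subset $\{i\mid\alpha(i)=1\}$ of $\{1,\dots,k\}$; $\alpha^c$ is the complement; $\pi_\alpha\colon[n]^k\to[n]^\alpha$ is the canonical projection $(j_1,\dots,j_k)\mapsto(j_i)_{i\in\alpha}$ ($[n]^\emptyset$ is a one-point set). The predual $B(H)_*$ is identified with the projective tensor product of $H$ with (the conjugate of) $H$: for $h,k\in H$, $h\otimes k$ denotes the normal functional $T\mapsto\langle Th,k\rangle$ on $B(H)$, and $q(h\otimes k)$ is its restriction to $A$. The index $m$ runs over a countable set. *)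

theory Defs
  imports "HOL-Probability.Probability"
begin

text \<open>
  Complex Hilbert spaces. The real inner product of the superclass is the real part of the complex
  one, so that norm, topology and completeness are the usual ones. The complex inner product is
  linear in its first and conjugate linear in its second argument.
\<close>

class complex_hilbert_space = real_inner + complete_space +
  fixes scaleC :: "complex \<Rightarrow> 'a \<Rightarrow> 'a" (infixr "*\<^sub>C" 75)
    and cinner :: "'a \<Rightarrow> 'a \<Rightarrow> complex"
  assumes scaleC_add_right: "a *\<^sub>C (x + y) = a *\<^sub>C x + a *\<^sub>C y"
    and scaleC_add_left: "(a + b) *\<^sub>C x = a *\<^sub>C x + b *\<^sub>C x"
    and scaleC_scaleC: "a *\<^sub>C (b *\<^sub>C x) = (a * b) *\<^sub>C x"
    and scaleR_scaleC: "scaleR r x = complex_of_real r *\<^sub>C x"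
    and cinner_add_left: "cinner (x + y) z = cinner x z + cinner y z"
    and cinner_scaleC_left: "cinner (a *\<^sub>C x) y = a * cinner x y"
    and cinner_commute: "cinner x y = cnj (cinner y x)"
    and inner_eq_Re_cinner: "inner x y = Re (cinner x y)"

text \<open>
  \<open>B(H)\<close>, as the complex linear elements of the library's space of bounded real linear
  operators; the norm of that space is the operator norm.
\<close>

definition bounded_operators :: "('h::complex_hilbert_space \<Rightarrow>\<^sub>L 'h) set" where
  "bounded_operators = {T. \<forall>c v. blinfun_apply T (c *\<^sub>C v) = c *\<^sub>C blinfun_apply T v}"

definition is_adjoint ::
    "('h::complex_hilbert_space \<Rightarrow>\<^sub>L 'h) \<Rightarrow> ('h \<Rightarrow>\<^sub>L 'h) \<Rightarrow> bool" where
  "is_adjoint S T \<longleftrightarrow> (\<forall>u v. cinner (blinfun_apply T u) v = cinner u (blinfun_apply S v))"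

definition commutant ::
    "('h::complex_hilbert_space \<Rightarrow>\<^sub>L 'h) set \<Rightarrow> ('h \<Rightarrow>\<^sub>L 'h) set" where
  "commutant A = {T \<in> bounded_operators. \<forall>U \<in> A. T o\<^sub>L U = U o\<^sub>L T}"

text \<open>
  Self-adjoint sets of operators equal to their bicommutant. The latter condition makes the set a
  weakly closed subalgebra that contains the identity of \<open>B(H)\<close>.
\<close>

definition von_neumann_algebra :: "('h::complex_hilbert_space \<Rightarrow>\<^sub>L 'h) set \<Rightarrow> bool" where
  "von_neumann_algebra A \<longleftrightarrow>
     A \<subseteq> bounded_operators \<and>
     (\<forall>T \<in> A. \<exists>S \<in> A. is_adjoint S T) \<and>
     commutant (commutant A) = A"

text \<open>
  Functionals on a set of operators are represented by functions that vanish outside of that set,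
  so that equality of functions is equality of functionals.
\<close>

definition tensor_functional ::
    "'h::complex_hilbert_space \<Rightarrow> 'h \<Rightarrow> ('h \<Rightarrow>\<^sub>L 'h) \<Rightarrow> complex" where
  "tensor_functional h k = (\<lambda>T. if T \<in> bounded_operators then cinner (blinfun_apply T h) k else 0)"

text \<open>
  \<open>B(H)\<^sub>*\<close>: the elements of the projective tensor product of \<open>H\<close> with its conjugate are the
  sums of the series of elementary tensors with absolutely summable norms. Such a series converges
  in the norm of \<open>B(H)\<^sub>*\<close>, and its sum is the pointwise one.
\<close>

definition predual_BH :: "(('h::complex_hilbert_space \<Rightarrow>\<^sub>L 'h) \<Rightarrow> complex) set" where
  "predual_BH = {\<phi>. \<exists>h k :: nat \<Rightarrow> 'h. summable (\<lambda>m. norm (h m) * norm (k m)) \<and>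
     \<phi> = (\<lambda>T. \<Sum>m. tensor_functional (h m) (k m) T)}"

definition predual_quotient_map ::
    "('h::complex_hilbert_space \<Rightarrow>\<^sub>L 'h) set \<Rightarrow>
      (('h \<Rightarrow>\<^sub>L 'h) \<Rightarrow> complex) \<Rightarrow> ('h \<Rightarrow>\<^sub>L 'h) \<Rightarrow> complex" where
  "predual_quotient_map A \<phi> = (\<lambda>T. if T \<in> A then \<phi> T else 0)"

text \<open>
  \<open>A\<^sub>*\<close>, the quotient of \<open>B(H)\<^sub>*\<close> by the preannihilator of \<open>A\<close>: two elements of \<open>B(H)\<^sub>*\<close> are in
  the same class iff they have the same restriction to \<open>A\<close>.
\<close>

definition predual ::
    "('h::complex_hilbert_space \<Rightarrow>\<^sub>L 'h) set \<Rightarrow> (('h \<Rightarrow>\<^sub>L 'h) \<Rightarrow> complex) set" where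
  "predual A = predual_quotient_map A ` predual_BH"

definition predual_norm ::
    "('h::complex_hilbert_space \<Rightarrow>\<^sub>L 'h) set \<Rightarrow> (('h \<Rightarrow>\<^sub>L 'h) \<Rightarrow> complex) \<Rightarrow> real" where
  "predual_norm A \<phi> = (SUP T \<in> {T \<in> A. norm T \<le> 1}. cmod (\<phi> T))"

definition circle_measure :: "complex measure" where
  "circle_measure =
     distr (uniform_measure lborel {0..2 * pi}) (restrict_space borel (sphere 0 1)) cis"

definition Omega_measure :: "(nat \<Rightarrow> complex) measure" where
  "Omega_measure = PiM UNIV (\<lambda>_. circle_measure)"

definition Omega_power_measure :: "nat \<Rightarrow> (nat \<Rightarrow> nat \<Rightarrow> complex) measure" where
  "Omega_power_measure k = PiM {1..k} (\<lambda>_. Omega_measure)"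

text \<open>\<open>[n]\<^sup>\<alpha>\<close> for a set of positions \<open>\<alpha>\<close>; the projection of \<open>J\<close> to \<open>[n]\<^sup>\<alpha>\<close> is \<open>restrict J \<alpha>\<close>.\<close>

definition multi_indices :: "nat \<Rightarrow> nat set \<Rightarrow> (nat \<Rightarrow> nat) set" where
  "multi_indices n \<alpha> = \<alpha> \<rightarrow>\<^sub>E {1..n}"

definition eps :: "nat \<Rightarrow> (nat \<Rightarrow> nat) \<Rightarrow> (nat \<Rightarrow> nat \<Rightarrow> complex) \<Rightarrow> complex" where
  "eps k J t = (\<Prod>i \<in> {1..k}. t i (J i))"

definition L1_norm ::
    "('h::complex_hilbert_space \<Rightarrow>\<^sub>L 'h) set \<Rightarrow> nat \<Rightarrow> nat \<Rightarrow>
      ((nat \<Rightarrow> nat) \<Rightarrow> ('h \<Rightarrow>\<^sub>L 'h) \<Rightarrow> complex) \<Rightarrow> real" where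
  "L1_norm A n k x =
     (LINT t | Omega_power_measure k.
        predual_norm A (\<lambda>T. \<Sum>J \<in> multi_indices n {1..k}. eps k J t * x J T))"

text \<open>
  The countable index set is the set of natural numbers; smaller ones are covered by setting the
  remaining scalars to zero. Since the scalars are absolutely summable and the vectors have norm at
  most one, the series over \<open>m\<close> converges absolutely in the norm of \<open>B(H)\<^sub>*\<close>, and its sum is the
  pointwise one.
\<close>

definition admits_decomposition ::
    "('h::complex_hilbert_space \<Rightarrow>\<^sub>L 'h) set \<Rightarrow> nat \<Rightarrow> nat \<Rightarrow>
      ((nat \<Rightarrow> nat) \<Rightarrow> ('h \<Rightarrow>\<^sub>L 'h) \<Rightarrow> complex) \<Rightarrow> bool" where
  "admits_decomposition A n k x \<longleftrightarrow>
     (\<exists>(y :: nat set \<Rightarrow> (nat \<Rightarrow> nat) \<Rightarrow> ('h \<Rightarrow>\<^sub>L 'h) \<Rightarrow> complex)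
       (lam :: nat set \<Rightarrow> nat \<Rightarrow> complex)
       (h :: nat set \<Rightarrow> nat \<Rightarrow> (nat \<Rightarrow> nat) \<Rightarrow> 'h)
       (g :: nat set \<Rightarrow> nat \<Rightarrow> (nat \<Rightarrow> nat) \<Rightarrow> 'h).
        (\<forall>J \<in> multi_indices n {1..k}. x J = (\<lambda>T. \<Sum>\<alpha> \<in> Pow {1..k}. y \<alpha> J T)) \<and>
        (\<forall>\<alpha> \<in> Pow {1..k}. \<forall>J \<in> multi_indices n {1..k}.
           y \<alpha> J = predual_quotient_map A
             (\<lambda>T. \<Sum>m. lam \<alpha> m *
                tensor_functional (h \<alpha> m (restrict J \<alpha>)) (g \<alpha> m (restrict J ({1..k} - \<alpha>))) T)) \<and>
        (\<forall>\<alpha> \<in> Pow {1..k}. \<forall>m.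
           (\<Sum>i \<in> multi_indices n \<alpha>. (norm (h \<alpha> m i))\<^sup>2) \<le> 1 \<and>
           (\<Sum>j \<in> multi_indices n ({1..k} - \<alpha>). (norm (g \<alpha> m j))\<^sup>2) \<le> 1) \<and>
        (\<forall>\<alpha> \<in> Pow {1..k}. summable (\<lambda>m. cmod (lam \<alpha> m))) \<and>
        (\<Sum>\<alpha> \<in> Pow {1..k}. \<Sum>m. cmod (lam \<alpha> m)) < 2 ^ (2 * k))"

end

(* The dual norm of the decomposition norm is attained by families (a_J) in A that are contractions
   when read as operator matrices from [n]^alpha to [n]^(alpha^c), for every alpha. If (x_J) had no
   decomposition of size < 4^k, Hahn-Banach would give such a family with |sum_J x_J(a_J)| >= 4^k:
   the functional is represented by operators (Riesz), and these commute with the commutant of A,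
   because a normal functional on A does not change when an element of the commutant is moved across
   the tensor sign.

   On the other hand |sum_J x_J(a_J)| <= 2^k ||sum_J eps_J x_J||_1 for such families. Put
   S = sum_J cnj(eps_J) a_J and G = S (1 + e^2 S* S)^-1 with e = 2^-k, so that ||G|| <= 2^k / 2
   pointwise. The remainder satisfies |<(S - G) u, v>| <= (e/2) ||S u|| ||S* v||. For u in the span of
   the eps_r, r in [n]^alpha, the mean of ||S u||^2 is at most 4^|alpha| times that of ||u||^2:
   coordinates in which the indices of cnj(eps_J) eps_r coincide cancel, the other products are
   orthogonal. Hence the eps_J-coefficients of 2 (S - G) form a contractive family again. Pairing the
   coefficients of G with x and taking the supremum over all contractive families yields the bound.

   Orthogonality involves only products cnj(eps_i) eps_j, so the averages can be taken over arrays of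
   cube roots of unity, a finite group; rotation invariance of Haar measure then brings in the L1 norm.
   This keeps all operator-valued integrals finite sums. *)

theory Submission
  imports Defs "HOL-Library.Function_Algebras"
begin

section \<open>Complex Hilbert spaces\<close>

text \<open>The choice e = 2^-k is optimal. If M is the supremum of |sum_J x_J(a_J)| over the
  contractive families in A and L is the mean norm of the modulated x, the cut-off gives M <= L / (2
  e) + (e 2^k / 2) M. Here e (1 - e 2^k / 2) is largest at e = 2^-k, where the estimate becomes M <=
  2^k L. Absorbing the last term requires M to be finite, and it is, because the members of a
  contractive family have norm at most 1. What is known of S independently of n is a mean square
  bound, whereas the L1 norm pairs with uniformly bounded operators; this is why S is cut off. A
  resolvent serves for that because it stays in A and comes from a coercive quadratic form, without
  spectral theory. Signs cannot replace cube roots: for signs cnj(eps_a) eps_b equals cnj(eps_b)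
  eps_a, so that the entries (a, b) and (b, a) are not orthogonal. The converse is the easy half:
  for one elementary family the integrand is at most a product of two norms, each of mean square at
  most 1, and the triangle inequality bounds the L1 norm by the sum of the |lam|.\<close>

lemma scaleC_one [simp]: "1 *\<^sub>C (v::'h::complex_hilbert_space) = v"
  using scaleR_scaleC[of 1 v] by simp

lemma scaleC_zero_left [simp]: "0 *\<^sub>C (v::'h::complex_hilbert_space) = 0"
  using scaleR_scaleC[of 0 v] by simp

lemma scaleC_zero_right [simp]: "c *\<^sub>C (0::'h::complex_hilbert_space) = 0"
  using scaleC_add_right[of c 0 "0::'h"] by simp

lemma scaleC_sum_right: "c *\<^sub>C (\<Sum>i\<in>I. f i) = (\<Sum>i\<in>I. c *\<^sub>C (f i :: 'h::complex_hilbert_space))"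
  by (induction I rule: infinite_finite_induct) (auto simp: scaleC_add_right)

lemma scaleC_sum_left: "(\<Sum>i\<in>I. c i) *\<^sub>C (x :: 'h::complex_hilbert_space) = (\<Sum>i\<in>I. c i *\<^sub>C x)"
  by (induction I rule: infinite_finite_induct) (auto simp: scaleC_add_left)

lemma scaleC_diff_right: "c *\<^sub>C (x - y) = c *\<^sub>C x - c *\<^sub>C (y :: 'h::complex_hilbert_space)"
  by (metis add_diff_cancel_right' diff_add_cancel scaleC_add_right)

lemma scaleC_scaleR: "c *\<^sub>C (r *\<^sub>R x) = r *\<^sub>R (c *\<^sub>C (x :: 'h::complex_hilbert_space))"
  by (simp add: scaleR_scaleC scaleC_scaleC mult.commute)

lemma cinner_zero_left [simp]: "cinner 0 (v::'h::complex_hilbert_space) = 0"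
  using cinner_add_left[of 0 0 v] by simp

lemma cinner_zero_right [simp]: "cinner (v::'h::complex_hilbert_space) 0 = 0"
  using cinner_commute[of v 0] by simp

lemma cinner_add_right:
  "cinner x (y + z) = cinner x y + cinner x (z :: 'h::complex_hilbert_space)"
  by (metis cinner_add_left cinner_commute complex_cnj_add)

lemma cinner_scaleC_right:
  "cinner x (a *\<^sub>C y) = cnj a * cinner x (y :: 'h::complex_hilbert_space)"
  by (metis cinner_commute cinner_scaleC_left complex_cnj_mult)

lemma cinner_scaleR_left: "cinner (r *\<^sub>R x) (y :: 'h::complex_hilbert_space) = of_real r * cinner x y"
  by (simp add: scaleR_scaleC cinner_scaleC_left)

lemma cinner_scaleR_right: "cinner x (r *\<^sub>R (y :: 'h::complex_hilbert_space)) = of_real r * cinner x y"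
  by (simp add: scaleR_scaleC cinner_scaleC_right)

lemma cinner_diff_left:
  "cinner (x - y) z = cinner x z - cinner y (z :: 'h::complex_hilbert_space)"
  by (metis add_diff_cancel_right' cinner_add_left diff_add_cancel)

lemma cinner_sum_left:
  "cinner (\<Sum>i\<in>I. f i) (y :: 'h::complex_hilbert_space) = (\<Sum>i\<in>I. cinner (f i) y)"
  by (induction I rule: infinite_finite_induct) (auto simp: cinner_add_left)

lemma cinner_sum_right:
  "cinner (y :: 'h::complex_hilbert_space) (\<Sum>i\<in>I. f i) = (\<Sum>i\<in>I. cinner y (f i))"
  by (induction I rule: infinite_finite_induct) (auto simp: cinner_add_right)

lemma cinner_self: "cinner x (x :: 'h::complex_hilbert_space) = of_real ((norm x)\<^sup>2)"
proof -
  have "Im (cinner x x) = 0"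
    using cinner_commute[of x x] by (metis Reals_cnj_iff complex_is_Real_iff)
  then show ?thesis
    by (simp add: complex_eq_iff power2_norm_eq_inner inner_eq_Re_cinner)
qed

lemma norm_scaleC [simp]: "norm (c *\<^sub>C (x :: 'h::complex_hilbert_space)) = cmod c * norm x"
proof -
  have "of_real ((norm (c *\<^sub>C x))\<^sup>2) = c * cnj c * cinner x x"
    by (simp only: cinner_self[symmetric] cinner_scaleC_left cinner_scaleC_right mult_ac)
  also have "\<dots> = of_real ((cmod c * norm x)\<^sup>2)"
    by (simp add: cinner_self power_mult_distrib complex_norm_square del: of_real_power)
  finally show ?thesis
    by (simp only: of_real_eq_iff) (simp add: power2_eq_iff_nonneg)
qed

lemma ex_phase: "\<exists>c. cmod c = 1 \<and> c * z = complex_of_real (cmod z)"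
proof (cases "z = 0")
  case False
  have "cnj (sgn z) * z = of_real (cmod z)"
    using False by (simp add: sgn_div_norm complex_norm_square[symmetric] power2_eq_square
        mult.commute[of "cnj _"] scaleR_conv_of_real field_simps)
  moreover have "cmod (cnj (sgn z)) = 1"
    using False by (simp add: norm_sgn)
  ultimately show ?thesis
    by blast
qed (auto intro: exI[of _ 1])

lemma cinner_cauchy_schwarz:
  "cmod (cinner x (y :: 'h::complex_hilbert_space)) \<le> norm x * norm y"
proof -
  obtain c where c: "cmod c = 1" "c * cinner x y = complex_of_real (cmod (cinner x y))"
    using ex_phase by blast
  then have "cmod (cinner x y) = inner (c *\<^sub>C x) y"
    by (simp add: inner_eq_Re_cinner cinner_scaleC_left)
  also have "\<dots> \<le> norm (c *\<^sub>C x) * norm y"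
    by (rule norm_cauchy_schwarz)
  finally show ?thesis
    by (simp add: c)
qed

lemma bounded_linear_scaleC: "bounded_linear (\<lambda>v::'h::complex_hilbert_space. c *\<^sub>C v)"
  by (rule bounded_linear_intro[of _ "cmod c"])
    (auto simp: scaleC_add_right scaleC_scaleR mult.commute)

lemma cinner_eq_zero_iff_all: "(\<forall>v. cinner x v = 0) \<longleftrightarrow> x = (0::'h::complex_hilbert_space)"
proof
  assume "\<forall>v. cinner x v = 0"
  then have "cinner x x = 0"
    by blast
  then show "x = 0"
    by (simp add: cinner_self)
qed auto

lemma cinner_left_eqI: "(\<And>v. cinner x v = cinner y v) \<Longrightarrow> x = (y::'h::complex_hilbert_space)"
  using cinner_eq_zero_iff_all[of "x - y"] by (simp add: cinner_diff_left)

text \<open>The functional \<open>Q x = B x x / 2 - f x\<close> is minimised: coercivity bounds it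
  below, the parallelogram identity makes a minimising sequence Cauchy, and the vanishing first
  variation at its limit is the claim. The inner product as \<open>B\<close> gives the Riesz
  theorem, the form of 1 + d S'S gives resolvents.\<close>

lemma lax_milgram_symmetric:
  fixes B :: "'a::{real_inner,complete_space} \<Rightarrow> 'a \<Rightarrow> real"
  assumes B: "bounded_bilinear B" and sym: "\<And>x y. B x y = B y x"
    and coercive: "\<And>x. (norm x)\<^sup>2 \<le> B x x"
    and f: "bounded_linear f"
  shows "\<exists>z. \<forall>v. B z v = f v"
proof -
  interpret B: bounded_bilinear B by fact
  interpret f: bounded_linear f by fact
  define Q where "Q x = B x x / 2 - f x" for x
  obtain C where C: "\<And>x. \<bar>f x\<bar> \<le> norm x * C"
    using f.bounded by (auto simp: real_norm_def)
  have Q_ge: "- (C\<^sup>2 / 2) \<le> Q x" for x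
  proof -
    have "f x \<le> norm x * C"
      using C[of x] by linarith
    moreover have "0 \<le> (norm x - C)\<^sup>2"
      by simp
    ultimately show ?thesis
      using coercive[of x] by (simp add: Q_def power2_eq_square algebra_simps)
  qed
  define m where "m = (INF x. Q x)"
  have bdd: "bdd_below (range Q)"
    using Q_ge by (intro bdd_belowI2)
  have m_le: "m \<le> Q x" for x
    unfolding m_def by (rule cINF_lower[OF bdd]) auto
  have "\<exists>x. Q x < m + inverse (real (Suc n))" for n
  proof -
    have "(INF x. Q x) < m + inverse (real (Suc n))"
      unfolding m_def by simp
    then show ?thesis
      using cINF_less_iff[of UNIV Q] bdd by auto
  qed
  then obtain X where X: "\<And>n. Q (X n) < m + inverse (real (Suc n))"
    by metis
  have par: "(norm (x - y))\<^sup>2 \<le> 4 * Q x + 4 * Q y - 8 * m" for x y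
  proof -
    have "m \<le> Q ((1/2) *\<^sub>R (x + y))"
      by (rule m_le)
    also have "\<dots> = (Q x + Q y) / 2 - B (x - y) (x - y) / 8"
      by (simp add: Q_def B.add_left B.add_right B.diff_left B.diff_right B.scaleR_left
          B.scaleR_right f.add f.scaleR sym[of y x] field_simps)
    finally have "B (x - y) (x - y) \<le> 4 * Q x + 4 * Q y - 8 * m"
      by (simp add: field_simps)
    then show ?thesis
      using coercive[of "x - y"] by (rule order_trans[rotated])
  qed
  have "Cauchy X"
  proof (rule metric_CauchyI)
    fix e :: real assume e: "e > 0"
    obtain N where N: "inverse (real (Suc N)) < e\<^sup>2 / 8"
      using reals_Archimedean[of "e\<^sup>2 / 8"] e by auto
    have "dist (X i) (X j) < e" if "i \<ge> N" "j \<ge> N" for i j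
    proof -
      have "inverse (real (Suc i)) \<le> inverse (real (Suc N))" 
        "inverse (real (Suc j)) \<le> inverse (real (Suc N))"
        using that by (auto intro!: le_imp_inverse_le)
      then have "4 * Q (X i) + 4 * Q (X j) - 8 * m < e\<^sup>2"
        using X[of i] X[of j] N by linarith
      with par have "(norm (X i - X j))\<^sup>2 < e\<^sup>2"
        by (rule le_less_trans)
      then show ?thesis
        using e by (simp add: dist_norm power2_less_imp_less)
    qed
    then show "\<exists>M. \<forall>i\<ge>M. \<forall>j\<ge>M. dist (X i) (X j) < e"
      by blast
  qed
  then obtain z where z: "X \<longlonglongrightarrow> z"
    using Cauchy_convergent convergent_def by blast
  have "(\<lambda>n. Q (X n)) \<longlonglongrightarrow> Q z"
    unfolding Q_def by (intro tendsto_diff tendsto_divide B.tendsto f.tendsto z tendsto_const) simp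
  moreover have "(\<lambda>n. m + inverse (real (Suc n))) \<longlonglongrightarrow> m"
    using tendsto_add[OF tendsto_const[of m] LIMSEQ_inverse_real_of_nat] by simp
  ultimately have Qz: "Q z \<le> m"
    using X by (intro LIMSEQ_le[of "\<lambda>n. Q (X n)"]) (auto intro: less_imp_le)
  have "B z v = f v" for v
  proof -
    define b where "b = B z v - f v"
    have ineq: "0 \<le> t * b + t\<^sup>2 * (B v v / 2)" for t
    proof -
      have "Q z \<le> Q (z + t *\<^sub>R v)"
        using Qz m_le order_trans by blast
      also have "\<dots> = Q z + (t * b + t\<^sup>2 * (B v v / 2))"
        by (simp add: Q_def b_def B.add_left B.add_right B.scaleR_left B.scaleR_right f.add
            f.scaleR sym[of v z] power2_eq_square field_simps)
      finally show ?thesis by simp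
    qed
    have Bv: "0 \<le> B v v"
      using coercive[of v] by (meson order_trans zero_le_power2)
    \<comment> \<open>The quadratic in t is tested at its minimiser \<open>- b / B v v\<close>; if
      \<open>B v v = 0\<close> it is linear, and \<open>t = - b\<close> suffices.\<close>
    show ?thesis
    proof (cases "B v v = 0")
      case True
      then have "b\<^sup>2 \<le> 0"
        using ineq[of "- b"] by (simp add: power2_eq_square)
      then show ?thesis
        by (simp add: b_def)
    next
      case False
      have "0 \<le> - (b\<^sup>2 / (2 * B v v))"
        using ineq[of "- b / B v v"] False by (simp add: power2_eq_square field_simps)
      then have "b\<^sup>2 \<le> 0"
        using Bv False by (simp add: field_simps)
      then show ?thesis
        by (simp add: b_def)
    qed
  qed
  then show ?thesis by blast
qed

text \<open>Only the real part of \<open>f\<close> is represented; complex linearity recovers the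
  imaginary part from the real part at \<open>\<i> *\<^sub>C x\<close>.\<close>

lemma riesz_representation:
  fixes f :: "'h::complex_hilbert_space \<Rightarrow> complex"
  assumes add: "\<And>x y. f (x + y) = f x + f y" and scale: "\<And>c x. f (c *\<^sub>C x) = c * f x"
    and bound: "\<And>x. cmod (f x) \<le> C * norm x"
  shows "\<exists>z. \<forall>x. f x = cinner x z"
proof -
  have "bounded_linear (\<lambda>x. Re (f x))"
    by (rule bounded_linear_intro[of _ C])
      (auto simp: add scaleR_scaleC scale mult.commute intro: order_trans[OF abs_Re_le_cmod bound])
  from lax_milgram_symmetric[OF bounded_bilinear_inner inner_commute _ this]
  obtain z where z: "inner z v = Re (f v)" for v
    by (auto simp: power2_norm_eq_inner)
  have Re: "Re (f x) = Re (cinner x z)" for x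
    using z[of x] by (simp add: inner_commute inner_eq_Re_cinner[symmetric])
  have "f x = cinner x z" for x
    using Re[of x] Re[of "\<i> *\<^sub>C x"] by (simp add: complex_eq_iff scale cinner_scaleC_left)
  then show ?thesis by blast
qed

text \<open>For fixed h the conjugate of \<open>B h g\<close> is linear in g, so the Riesz theorem
  yields the vector \<open>T h\<close>. Adjoints, and later the operators that represent a dual
  functional, arise in this way.\<close>

lemma bounded_operator_of_form:
  fixes B :: "'h::complex_hilbert_space \<Rightarrow> 'h \<Rightarrow> complex"
  assumes "\<And>h h' g. B (h + h') g = B h g + B h' g" and "\<And>c h g. B (c *\<^sub>C h) g = c * B h g"
    and "\<And>h g g'. B h (g + g') = B h g + B h g'" and "\<And>c h g. B h (c *\<^sub>C g) = cnj c * B h g"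
    and bound: "\<And>h g. cmod (B h g) \<le> C * norm h * norm g"
  shows "\<exists>T \<in> bounded_operators. \<forall>h g. cinner (blinfun_apply T h) g = B h g"
proof -
  have "\<exists>z. \<forall>g. cnj (B h g) = cinner g z" for h
    using assms by (intro riesz_representation[of _ "C * norm h"]) (auto simp: mult.assoc)
  then obtain t where "\<And>h g. cnj (B h g) = cinner g (t h)"
    by metis
  then have t: "cinner (t h) g = B h g" for h g
    by (metis cinner_commute complex_cnj_cnj)
  have t_add: "t (h + h') = t h + t h'" for h h'
    by (rule cinner_left_eqI) (simp add: t cinner_add_left assms)
  have t_scale: "t (c *\<^sub>C h) = c *\<^sub>C t h" for c h
    by (rule cinner_left_eqI) (simp add: t cinner_scaleC_left assms)
  have "norm (t h) \<le> norm h * C" for h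
  proof (cases "t h = 0")
    case True
    \<comment> \<open>The sign of \<open>C\<close> has to be extracted from the bound on the pair
      (h, h).\<close>
    have "0 \<le> C * norm h * norm h"
      by (rule order_trans[OF norm_ge_zero bound])
    then have "0 \<le> C * norm h \<or> norm h = 0"
      by (metis mult_less_0_iff norm_ge_zero not_le order_le_less)
    then show ?thesis
      using True by (auto simp: mult.commute)
  next
    case False
    have "norm (t h) * norm (t h) = cmod (cinner (t h) (t h))"
      by (simp add: cinner_self power2_eq_square norm_mult)
    also have "\<dots> \<le> (C * norm h) * norm (t h)"
      unfolding t by (rule bound)
    finally show ?thesis
      using False by (simp add: mult.commute)
  qed
  then have "bounded_linear t"
    by (intro bounded_linear_intro[of _ C]) (auto simp: t_add t_scale scaleR_scaleC)
  then show ?thesis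
    using t t_scale by (intro bexI[of _ "Blinfun t"])
      (auto simp: bounded_operators_def bounded_linear_Blinfun_apply)
qed

section \<open>Von Neumann algebras\<close>

lemma bounded_operatorsD: "T \<in> bounded_operators \<Longrightarrow> blinfun_apply T (c *\<^sub>C v) = c *\<^sub>C blinfun_apply T v"
  by (simp add: bounded_operators_def)

lemma ex_adjoint:
  fixes U :: "'h::complex_hilbert_space \<Rightarrow>\<^sub>L 'h"
  assumes "U \<in> bounded_operators"
  shows "\<exists>S \<in> bounded_operators. is_adjoint S U"
proof -
  have "\<exists>S \<in> bounded_operators. \<forall>h g. cinner (S h) g = cinner h (U g)"
  proof (rule bounded_operator_of_form[where C = "norm U"])
    fix h g
    have "cmod (cinner h (U g)) \<le> norm h * norm (U g)"
      by (rule cinner_cauchy_schwarz)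
    also have "\<dots> \<le> norm h * (norm U * norm g)"
      by (intro mult_left_mono norm_blinfun) auto
    finally show "cmod (cinner h (U g)) \<le> norm U * norm h * norm g"
      by (simp add: mult_ac)
  qed (auto simp: cinner_add_left cinner_add_right cinner_scaleC_left cinner_scaleC_right
      blinfun.add_right bounded_operatorsD[OF assms])
  then show ?thesis
    unfolding is_adjoint_def by (metis cinner_commute)
qed

lemma is_adjoint_sym: "is_adjoint S T \<Longrightarrow> is_adjoint T S"
  unfolding is_adjoint_def by (metis cinner_commute)

definition scalar_operator :: "complex \<Rightarrow> 'h::complex_hilbert_space \<Rightarrow>\<^sub>L 'h" where
  "scalar_operator c = Blinfun (\<lambda>v. c *\<^sub>C v)"

lemma scalar_operator_apply [simp]: "blinfun_apply (scalar_operator c) v = c *\<^sub>C v"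
  by (simp add: scalar_operator_def bounded_linear_Blinfun_apply bounded_linear_scaleC)

lemma commutant_apply:
  "T \<in> commutant A \<Longrightarrow> U \<in> A \<Longrightarrow> blinfun_apply T (blinfun_apply U v) = blinfun_apply U (blinfun_apply T v)"
  by (auto simp: commutant_def dest!: arg_cong[where f = "\<lambda>S. blinfun_apply S v"])

text \<open>The bicommutant condition as an introduction rule. The closure properties of
  \<open>A\<close>, the membership of resolvents and that of the operators representing a dual
  functional are all obtained by checking commutation with \<open>commutant A\<close>.\<close>

lemma von_neumann_algebra_memI:
  assumes "von_neumann_algebra A" and "T \<in> bounded_operators"
    and "\<And>U v. U \<in> commutant A \<Longrightarrow> blinfun_apply T (blinfun_apply U v) = blinfun_apply U (blinfun_apply T v)"
  shows "T \<in> A"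
proof -
  have "T \<in> commutant (commutant A)"
    using assms by (auto simp: commutant_def[of "commutant A"] intro!: blinfun_eqI)
  then show ?thesis
    using assms(1) by (simp add: von_neumann_algebra_def)
qed

context
  fixes A :: "('h::complex_hilbert_space \<Rightarrow>\<^sub>L 'h) set"
  assumes vN: "von_neumann_algebra A"
begin

lemma vN_bounded_operators: "T \<in> A \<Longrightarrow> T \<in> bounded_operators"
  using vN by (auto simp: von_neumann_algebra_def)

lemma vN_adjoint: "T \<in> A \<Longrightarrow> \<exists>S \<in> A. is_adjoint S T"
  using vN by (auto simp: von_neumann_algebra_def)

lemma vN_commute:
  "T \<in> A \<Longrightarrow> U \<in> commutant A \<Longrightarrow> blinfun_apply T (blinfun_apply U v) = blinfun_apply U (blinfun_apply T v)"
  using commutant_apply by metis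

lemma commutant_bounded_operators: "U \<in> commutant A \<Longrightarrow> U \<in> bounded_operators"
  by (simp add: commutant_def)

lemma vN_compose: "S \<in> A \<Longrightarrow> T \<in> A \<Longrightarrow> S o\<^sub>L T \<in> A"
  by (rule von_neumann_algebra_memI[OF vN])
    (auto simp: vN_commute bounded_operators_def bounded_operatorsD[OF vN_bounded_operators])

lemma vN_scalar_operator: "scalar_operator c \<in> A"
  by (rule von_neumann_algebra_memI[OF vN])
    (auto simp: bounded_operators_def scaleC_scaleC mult.commute
      bounded_operatorsD[OF commutant_bounded_operators])

lemma vN_zero: "0 \<in> A"
  by (rule von_neumann_algebra_memI[OF vN]) (auto simp: bounded_operators_def blinfun.zero_right)

lemma vN_add: "S \<in> A \<Longrightarrow> T \<in> A \<Longrightarrow> S + T \<in> A"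
  by (rule von_neumann_algebra_memI[OF vN])
    (auto simp: vN_commute bounded_operators_def blinfun.add_left blinfun.add_right scaleC_add_right
      bounded_operatorsD[OF vN_bounded_operators])

lemma vN_diff: "S \<in> A \<Longrightarrow> T \<in> A \<Longrightarrow> S - T \<in> A"
  by (rule von_neumann_algebra_memI[OF vN])
    (auto simp: vN_commute bounded_operators_def blinfun.diff_left blinfun.diff_right scaleC_diff_right
      bounded_operatorsD[OF vN_bounded_operators])

lemma vN_scaleR: "S \<in> A \<Longrightarrow> r *\<^sub>R S \<in> A"
  by (rule von_neumann_algebra_memI[OF vN])
    (auto simp: vN_commute bounded_operators_def blinfun.scaleR_left blinfun.scaleR_right scaleC_scaleR
      bounded_operatorsD[OF vN_bounded_operators])

lemma vN_sum: "(\<And>i. i \<in> I \<Longrightarrow> S i \<in> A) \<Longrightarrow> (\<Sum>i\<in>I. S i) \<in> A"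
  by (induction I rule: infinite_finite_induct) (auto simp: vN_zero vN_add)

text \<open>The form of T = 1 + d S'S is coercive with constant 1, so T is onto by Lax-Milgram;
  \<open>norm y \<le> norm (T y)\<close> makes it injective with a contractive inverse. An operator
  of the commutant commutes with \<open>S\<close> and \<open>S'\<close>, hence with T and with its
  inverse.\<close>

lemma vN_resolvent:
  assumes S: "S \<in> A" "S' \<in> A" and adj: "is_adjoint S' S" and d: "d \<ge> 0"
  shows "\<exists>Y \<in> A. \<forall>u. Y u + d *\<^sub>R S' (S (Y u)) = u"
proof -
  define T where "T y = y + d *\<^sub>R S' (S y)" for y
  have inner_adj: "inner (S y) (S v) = inner (S' (S y)) v"
    for y v
    using is_adjoint_sym[OF adj] by (simp add: inner_eq_Re_cinner is_adjoint_def)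
  have T_inner: "inner (T y) v = inner y v + d * inner (S y) (S v)" for y v
    by (simp add: T_def inner_adj inner_add_left)
  have ex: "\<exists>y. T y = u" for u
  proof -
    have "bounded_bilinear (\<lambda>y v. inner (T y) v)"
      unfolding T_def
      by (intro bounded_bilinear.comp1[OF bounded_bilinear_inner] bounded_linear_intros)
    moreover have "bounded_linear (inner u)"
      by (rule bounded_linear_inner_right)
    ultimately have "\<exists>y. \<forall>v. inner (T y) v = inner u v"
      using d by (intro lax_milgram_symmetric)
        (simp_all add: T_inner power2_norm_eq_inner, simp add: inner_commute)
    then show ?thesis
      using vector_eq_rdot by blast
  qed
  have norm_le: "norm y \<le> norm (T y)" for y
  proof -
    have "norm y * norm y \<le> inner (T y) y"
      using d by (simp add: T_inner power2_norm_eq_inner[symmetric] power2_eq_square)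
    also have "\<dots> \<le> norm (T y) * norm y"
      by (rule norm_cauchy_schwarz)
    finally show ?thesis
      by (cases "y = 0") auto
  qed
  have T_add: "T (x + y) = T x + T y" for x y
    by (simp add: T_def blinfun.add_right scaleR_add_right)
  have T_diff: "T (x - y) = T x - T y" for x y
    by (simp add: T_def blinfun.diff_right scaleR_diff_right)
  have T_scale: "T (c *\<^sub>C x) = c *\<^sub>C T x" for c x
    using S by (simp add: T_def bounded_operatorsD[OF vN_bounded_operators] scaleC_add_right scaleC_scaleR)
  have inj: "x = y" if "T x = T y" for x y
    using norm_le[of "x - y"] that by (simp add: T_diff)
  obtain Y where Y: "T (Y u) = u" for u
    using ex by metis
  have Y_add: "Y (u + v) = Y u + Y v" for u v
    by (rule inj) (simp add: T_add Y)
  have Y_scale: "Y (c *\<^sub>C u) = c *\<^sub>C Y u" for c u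
    by (rule inj) (simp add: T_scale Y)
  have "bounded_linear Y"
    by (rule bounded_linear_intro[of _ 1])
      (use norm_le[of "Y _"] in \<open>auto simp: Y_add scaleR_scaleC Y_scale Y\<close>)
  then have apply_Y: "blinfun_apply (Blinfun Y) = Y"
    by (rule bounded_linear_Blinfun_apply)
  have "Blinfun Y \<in> A"
  proof (rule von_neumann_algebra_memI[OF vN])
    show "Blinfun Y \<in> bounded_operators"
      by (simp add: bounded_operators_def apply_Y Y_scale)
    fix U v assume U: "U \<in> commutant A"
    have "T (U (Y v)) = U (T (Y v))"
      by (simp add: T_def vN_commute[OF S(1) U] vN_commute[OF S(2) U] blinfun.add_right blinfun.scaleR_right)
    then show "blinfun_apply (Blinfun Y) (blinfun_apply U v) = blinfun_apply U (blinfun_apply (Blinfun Y) v)"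
      unfolding apply_Y by (auto intro: inj simp: Y)
  qed
  then show ?thesis
    using Y by (intro bexI[of _ "Blinfun Y"]) (auto simp: apply_Y T_def)
qed

end

text \<open>The scalar inequality behind this is \<open>s / (1 + d s\<^sup>2) \<le> 1 / (2 \<surd>d)\<close>.\<close>

lemma resolvent_norm_bound:
  assumes adj: "is_adjoint S' S" and e: "e > 0"
  shows "2 * e * norm (blinfun_apply S y) \<le> norm (y + (e\<^sup>2) *\<^sub>R blinfun_apply S' (blinfun_apply S y))"
proof (rule power2_le_imp_le)
  let ?s = "blinfun_apply S y" and ?w = "blinfun_apply S' (blinfun_apply S y)"
  have s: "(norm ?s)\<^sup>2 = inner y ?w"
    using adj by (simp add: power2_norm_eq_inner inner_eq_Re_cinner is_adjoint_def)
  have "inner y ?w \<le> norm y * norm ?w"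
    by (rule norm_cauchy_schwarz)
  \<comment> \<open>Arithmetic-geometric mean: it yields \<open>2 * e\<^sup>2 * inner y ?w \<le>
    (norm y)\<^sup>2 + (e\<^sup>2 * norm ?w)\<^sup>2\<close>, and adding
    \<open>2 * e\<^sup>2 * inner y ?w\<close> to both sides is the claim.\<close>
  moreover have "0 \<le> (norm y - e\<^sup>2 * norm ?w)\<^sup>2"
    by simp
  moreover have "(norm (y + (e\<^sup>2) *\<^sub>R ?w))\<^sup>2 = (norm y)\<^sup>2 + 2 * e\<^sup>2 * inner y ?w + (e\<^sup>2 * norm ?w)\<^sup>2"
    unfolding power_mult_distrib unfolding power2_norm_eq_inner
    by (simp add: inner_add_left inner_add_right inner_commute[of ?w y]
        algebra_simps power2_eq_square)
  moreover have "2 * e\<^sup>2 * inner y ?w \<le> 2 * e\<^sup>2 * (norm y * norm ?w)"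
    using calculation(1) by (intro mult_left_mono) auto
  ultimately show "(2 * e * norm ?s)\<^sup>2 \<le> (norm (y + (e\<^sup>2) *\<^sub>R ?w))\<^sup>2"
    unfolding power_mult_distrib s by (simp add: power2_diff algebra_simps)
qed auto

section \<open>The Hahn-Banach theorem\<close>

text \<open>Relative to a subspace, because an atomic norm is meaningful only for those functions
  that have some series representation.\<close>

definition sublinear_on :: "'a::real_vector set \<Rightarrow> ('a \<Rightarrow> real) \<Rightarrow> bool" where
  "sublinear_on V q \<longleftrightarrow> (\<forall>x\<in>V. \<forall>y\<in>V. q (x + y) \<le> q x + q y) \<and>
     (\<forall>r\<ge>0. \<forall>x\<in>V. q (r *\<^sub>R x) = r * q x)"

lemma sublinear_onD:
  assumes "sublinear_on V q"
  shows "x \<in> V \<Longrightarrow> y \<in> V \<Longrightarrow> q (x + y) \<le> q x + q y"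
    and "0 \<le> r \<Longrightarrow> x \<in> V \<Longrightarrow> q (r *\<^sub>R x) = r * q x"
  using assms by (auto simp: sublinear_on_def)

lemma sublinear_on_ge:
  assumes V: "subspace V" and q: "sublinear_on V q" and x: "x \<in> V" 
  shows "- q (- x) \<le> q x"
proof -
  have "q 0 = 0"
    using sublinear_onD(2)[OF q, of 0 x] x by simp
  then show ?thesis
    using sublinear_onD(1)[OF q x, of "- x"] x subspace_neg[OF V] by simp
qed

lemma sublinear_on_le_imp_ge:
  assumes V: "subspace V" and q: "sublinear_on V q" and x: "x \<in> V" 
    and le: "\<And>x. x \<in> V \<Longrightarrow> q x \<le> p x"
  shows "- p (- x) \<le> q x"
  using sublinear_on_ge[OF V q x] le[of "- x"] subspace_neg[OF V x] by linarith

text \<open>Minimal sublinear functionals are linear: comparing \<open>q\<close> with this functional gives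
  \<open>q x + q y \<le> q (x + y)\<close>.\<close>

definition sublinear_shift :: "'a::real_vector set \<Rightarrow> ('a \<Rightarrow> real) \<Rightarrow> 'a \<Rightarrow> 'a \<Rightarrow> real" where
  "sublinear_shift V q y x = (if x \<in> V then INF t\<in>{0..}. q (x + t *\<^sub>R y) - t * q y else 0)"

lemma
  assumes V: "subspace V" and q: "sublinear_on V q" and y: "y \<in> V"
  shows sublinear_shift_le: "x \<in> V \<Longrightarrow> 0 \<le> t \<Longrightarrow> sublinear_shift V q y x \<le> q (x + t *\<^sub>R y) - t * q y"
    and sublinear_on_sublinear_shift: "sublinear_on V (sublinear_shift V q y)"
proof -
  note q_add = sublinear_onD(1)[OF q] and q_scale = sublinear_onD(2)[OF q]
  note V_intros = subspace_add[OF V] subspace_scale[OF V] y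
  let ?f = "\<lambda>x t. q (x + t *\<^sub>R y) - t * q y"
  \<comment> \<open>Subadditivity gives a lower bound that does not depend on t, so the infimum is
    finite.\<close>
  have ge: "- q (- x) \<le> ?f x t" if "x \<in> V" "0 \<le> t" for x t
    using q_add[of "x + t *\<^sub>R y" "- x"] q_scale[of t y] that y subspace_neg[OF V, of x]
    by (auto simp: V_intros)
  have bdd: "bdd_below (?f x ` {0..})" if "x \<in> V" for x
    using ge[OF that] by (intro bdd_belowI2) auto
  show le: "sublinear_shift V q y x \<le> ?f x t" if "x \<in> V" "0 \<le> t" for x t
    unfolding sublinear_shift_def using that by (auto intro: cINF_lower[OF bdd])
  have greatest: "c \<le> sublinear_shift V q y x" if "x \<in> V" "\<And>t. 0 \<le> t \<Longrightarrow> c \<le> ?f x t" for x c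
    unfolding sublinear_shift_def using that by (auto intro: cINF_greatest)
  have add: "sublinear_shift V q y (x + z) \<le> sublinear_shift V q y x + sublinear_shift V q y z"
    if x: "x \<in> V" and z: "z \<in> V" for x z
  proof -
    have "sublinear_shift V q y (x + z) \<le> ?f x s + ?f z t" if "0 \<le> s" "0 \<le> t" for s t
    proof -
      have "sublinear_shift V q y (x + z) \<le> ?f (x + z) (s + t)"
        using x z that by (intro le) (auto simp: V_intros)
      also have "x + z + (s + t) *\<^sub>R y = (x + s *\<^sub>R y) + (z + t *\<^sub>R y)"
        by (simp add: scaleR_add_left)
      also have "q \<dots> \<le> q (x + s *\<^sub>R y) + q (z + t *\<^sub>R y)"
        using x z by (intro q_add) (auto simp: V_intros)
      finally show ?thesis
        by (simp add: algebra_simps)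
    qed
    then have "sublinear_shift V q y (x + z) - ?f z t \<le> sublinear_shift V q y x" if "0 \<le> t" for t
      using that by (intro greatest x) (simp add: algebra_simps)
    then have "sublinear_shift V q y (x + z) - sublinear_shift V q y x \<le> sublinear_shift V q y z"
      by (intro greatest z) (simp add: algebra_simps)
    then show ?thesis
      by simp
  qed
  have scale: "sublinear_shift V q y (r *\<^sub>R x) \<le> r * sublinear_shift V q y x"
    if x: "x \<in> V" and r: "0 < r" for x r
  proof -
    have "sublinear_shift V q y (r *\<^sub>R x) / r \<le> ?f x t" if "0 \<le> t" for t
    proof -
      have "sublinear_shift V q y (r *\<^sub>R x) \<le> ?f (r *\<^sub>R x) (r * t)"
        using x r that by (intro le) (auto simp: V_intros)
      also have "\<dots> = r * ?f x t"
        using q_scale[of r "x + t *\<^sub>R y"] x r by (simp add: V_intros scaleR_add_right algebra_simps)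
      finally show ?thesis
        using r by (simp add: field_simps)
    qed
    then have "sublinear_shift V q y (r *\<^sub>R x) / r \<le> sublinear_shift V q y x"
      by (intro greatest x)
    then show ?thesis
      using r by (simp add: field_simps)
  qed
  have scale_eq: "sublinear_shift V q y (r *\<^sub>R x) = r * sublinear_shift V q y x"
    if x: "x \<in> V" and r: "0 < r" for x r
  proof (rule antisym[OF scale[OF x r]])
    have "sublinear_shift V q y (inverse r *\<^sub>R (r *\<^sub>R x)) \<le> inverse r * sublinear_shift V q y (r *\<^sub>R x)"
      using x r by (intro scale) (auto simp: V_intros)
    then show "r * sublinear_shift V q y x \<le> sublinear_shift V q y (r *\<^sub>R x)"
      using r by (simp add: field_simps)
  qed
  have zero: "sublinear_shift V q y 0 = 0"
  proof (rule antisym)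
    show "sublinear_shift V q y 0 \<le> 0"
      using le[of 0 0] q_scale[of 0 y] y subspace_0[OF V] by simp
    show "0 \<le> sublinear_shift V q y 0"
      using q_scale y by (intro greatest subspace_0[OF V]) simp
  qed
  show "sublinear_on V (sublinear_shift V q y)"
    unfolding sublinear_on_def
  proof (intro conjI ballI allI impI add)
    fix r :: real and x assume "0 \<le> r" "x \<in> V"
    then show "sublinear_shift V q y (r *\<^sub>R x) = r * sublinear_shift V q y x"
      using zero scale_eq by (cases "r = 0") auto
  qed
qed

lemma sublinear_shift_le_self:
  assumes "subspace V" and "sublinear_on V q" and "y \<in> V" and "x \<in> V"
  shows "sublinear_shift V q y x \<le> q x"
  using sublinear_shift_le[OF assms, of 0] by simp

text \<open>In a chain, two members can be replaced by the smaller one, so near-minimisers at x and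
  at y can be taken from a single sublinear functional. The common majorant \<open>p\<close> gives
  the lower bound \<open>- p (- x)\<close>, which keeps the infimum finite.\<close>

lemma sublinear_on_Inf_chain:
  assumes V: "subspace V" and ne: "C \<noteq> {}"
    and C: "\<And>q. q \<in> C \<Longrightarrow> sublinear_on V q" "\<And>q x. q \<in> C \<Longrightarrow> x \<in> V \<Longrightarrow> q x \<le> p x"
    and chain: "\<And>q r. q \<in> C \<Longrightarrow> r \<in> C \<Longrightarrow> (\<forall>x\<in>V. q x \<le> r x) \<or> (\<forall>x\<in>V. r x \<le> q x)"
  shows "sublinear_on V (\<lambda>x. INF q\<in>C. q x)" 
    and "q \<in> C \<Longrightarrow> x \<in> V \<Longrightarrow> (INF q\<in>C. q x) \<le> q x"
proof -
  have bdd: "bdd_below ((\<lambda>q. q x) ` C)" if "x \<in> V" for x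
    by (rule bdd_belowI2[where m = "- p (- x)"]) (rule sublinear_on_le_imp_ge[OF V C(1) that C(2)])
  show le: "(INF q\<in>C. q x) \<le> q x" if "q \<in> C" "x \<in> V" for q x
    using that by (intro cINF_lower bdd)
  show "sublinear_on V (\<lambda>x. INF q\<in>C. q x)"
    unfolding sublinear_on_def
  proof (intro conjI ballI allI impI)
    fix x y assume x: "x \<in> V" and y: "y \<in> V"
    have "(INF q\<in>C. q (x + y)) \<le> q x + r y" if qr: "q \<in> C" "r \<in> C" for q r
    proof -
      obtain s where "s \<in> C" "s x \<le> q x" "s y \<le> r y"
        using chain[OF qr] qr x y by blast
      then show ?thesis
        using le[of s "x + y"] sublinear_onD(1)[OF C(1), of s x y] x y subspace_add[OF V] by force
    qed
    then have "(INF q\<in>C. q (x + y)) - r y \<le> (INF q\<in>C. q x)" if "r \<in> C" for r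
      using that by (intro cINF_greatest ne) (simp add: algebra_simps)
    then have "(INF q\<in>C. q (x + y)) - (INF q\<in>C. q x) \<le> (INF q\<in>C. q y)"
      by (intro cINF_greatest ne) (simp add: algebra_simps)
    then show "(INF q\<in>C. q (x + y)) \<le> (INF q\<in>C. q x) + (INF q\<in>C. q y)"
      by simp
  next
    fix r :: real and x assume r: "0 \<le> r" and x: "x \<in> V"
    have "(INF q\<in>C. q (r *\<^sub>R x)) = (INF q\<in>C. r * q x)"
      using sublinear_onD(2)[OF C(1)] r x by (intro INF_cong) auto
    also have "\<dots> = r * (INF q\<in>C. q x)"
    proof -
      have "r * Inf ((\<lambda>q. q x) ` C) = Inf ((*) r ` ((\<lambda>q. q x) ` C))"
        using r ne by (intro continuous_at_Inf_mono bdd x) 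
          (auto intro!: monoI mult_left_mono continuous_intros)
      then show ?thesis
        by (simp add: image_image)
    qed
    finally show "(INF q\<in>C. q (r *\<^sub>R x)) = r * (INF q\<in>C. q x)" .
  qed
qed

text \<open>Zorn's lemma is applied to sublinear functionals instead of partial linear extensions: a
  minimal one coincides with all its shifts, hence is additive. Starting from the shift of
  \<open>p\<close> at \<open>x0\<close> instead of \<open>p\<close> forces
  \<open>f (- x0) \<le> - p x0\<close>, and thereby equality at \<open>x0\<close>.\<close>

theorem hahn_banach_sublinear:
  assumes V: "subspace V" and p: "sublinear_on V p" and x0: "x0 \<in> V"
  obtains f where "\<And>x y. x \<in> V \<Longrightarrow> y \<in> V \<Longrightarrow> f (x + y) = f x + f y"
    and "\<And>r x. x \<in> V \<Longrightarrow> f (r *\<^sub>R x) = r * f x"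
    and "\<And>x. x \<in> V \<Longrightarrow> f x \<le> p x" and "f x0 = p x0"
proof -
  define p0 where "p0 = sublinear_shift V p x0"
  have p0: "sublinear_on V p0"
    unfolding p0_def by (rule sublinear_on_sublinear_shift[OF V p x0])
  \<comment> \<open>All members vanish off \<open>V\<close>, so comparing them on \<open>V\<close>
    is comparing them everywhere, and minimality yields equality of functions.\<close>
  define S where "S = {q. sublinear_on V q \<and> (\<forall>x\<in>V. q x \<le> p0 x) \<and> (\<forall>x. x \<notin> V \<longrightarrow> q x = 0)}"
  \<comment> \<open>The order is reversed: Zorn's lemma provides a maximal element, and a minimal
    functional is wanted.\<close>
  define P where "P q r \<longleftrightarrow> (\<forall>x. r x \<le> q x)" for q r :: "'a \<Rightarrow> real"
  have "\<exists>f\<in>S. \<forall>q\<in>S. P f q \<longrightarrow> q = f"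
  proof (rule predicate_Zorn)
    show "partial_order_on S (relation_of P S)"
      by (auto simp: partial_order_on_def preorder_on_def refl_on_def trans_def antisym_def
          relation_of_def P_def intro!: ext intro: order_trans order_antisym)
    fix C assume C: "C \<in> Chains (relation_of P S)"
    have CS: "q \<in> S" if "q \<in> C" for q
      using C that by (auto simp: Chains_def relation_of_def)
    have chain: "P q r \<or> P r q" if "q \<in> C" "r \<in> C" for q r
      using C that by (auto simp: Chains_def relation_of_def)
    show "\<exists>u\<in>S. \<forall>q\<in>C. P q u"
    proof (cases "C = {}")
      case True
      have "p0 \<in> S"
        using p0 by (simp add: S_def p0_def sublinear_shift_def)
      then show ?thesis
        using True by blast
    next
      case False
      have 1: "(\<forall>x\<in>V. q x \<le> r x) \<or> (\<forall>x\<in>V. r x \<le> q x)" if "q \<in> C" "r \<in> C" for q r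
        using chain[OF that] by (auto simp: P_def)
      have 2: "sublinear_on V q" "x \<in> V \<Longrightarrow> q x \<le> p0 x" "x \<notin> V \<Longrightarrow> q x = 0" if "q \<in> C" for q x
        using CS[OF that] by (auto simp: S_def)
      have Inf: "sublinear_on V (\<lambda>x. INF q\<in>C. q x)" "q \<in> C \<Longrightarrow> x \<in> V \<Longrightarrow> (INF q\<in>C. q x) \<le> q x" for q x
        by (rule sublinear_on_Inf_chain[where C = C and p = p0]; use V False 1 2 in blast)+
      let ?u = "\<lambda>x. if x \<in> V then INF q\<in>C. q x else 0"
      have "sublinear_on V ?u"
        using Inf(1) subspace_add[OF V] subspace_scale[OF V] by (auto simp: sublinear_on_def)
      moreover have "(INF q\<in>C. q x) \<le> p0 x" if "x \<in> V" for x
        using False Inf(2) 2(2) that by (meson ex_in_conv order_trans)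
      ultimately have "?u \<in> S"
        by (simp add: S_def)
      moreover have "P q ?u" if "q \<in> C" for q
        using Inf(2)[OF that] 2(3)[OF that] by (simp add: P_def)
      ultimately show ?thesis
        by blast
    qed
  qed
  then obtain f where f: "f \<in> S" and min: "\<And>q. q \<in> S \<Longrightarrow> P f q \<Longrightarrow> q = f"
    by blast
  have sub: "sublinear_on V f" and f_le: "\<And>x. x \<in> V \<Longrightarrow> f x \<le> p0 x" and f0: "\<And>x. x \<notin> V \<Longrightarrow> f x = 0"
    using f by (auto simp: S_def)
  have shift: "sublinear_shift V f y = f" if y: "y \<in> V" for y
  proof (rule min)
    have le: "sublinear_shift V f y x \<le> f x" if "x \<in> V" for x
      by (rule sublinear_shift_le_self[OF V sub y that])
    then show "P f (sublinear_shift V f y)"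
      using f0 by (auto simp: P_def sublinear_shift_def[of V f y])
    show "sublinear_shift V f y \<in> S"
      using sublinear_on_sublinear_shift[OF V sub y] le f_le
      by (auto simp: S_def intro: order_trans) (simp add: sublinear_shift_def)
  qed
  have add: "f (x + y) = f x + f y" if "x \<in> V" "y \<in> V" for x y
    using sublinear_shift_le[OF V sub that(2,1), of 1] shift[OF that(2)] sublinear_onD(1)[OF sub that]
    by simp
  have zero: "f 0 = 0"
    using add[of 0 0] subspace_0[OF V] by simp
  have scale: "f (r *\<^sub>R x) = r * f x" if x: "x \<in> V" for r x
  proof (cases "0 \<le> r")
    case False
    have "f (r *\<^sub>R x) + f ((- r) *\<^sub>R x) = 0"
      using add[of "r *\<^sub>R x" "(- r) *\<^sub>R x"] x zero subspace_scale[OF V x] subspace_neg[OF V] by simp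
    then show ?thesis
      using sublinear_onD(2)[OF sub _ x, of "- r"] False by simp
  qed (use sublinear_onD(2)[OF sub _ x] in auto)
  have le: "f x \<le> p x" if "x \<in> V" for x
    using f_le[OF that] sublinear_shift_le_self[OF V p x0 that] by (simp add: p0_def)
  have "f (- x0) \<le> - p x0"
    using f_le[of "- x0"] sublinear_shift_le[OF V p x0, of "- x0" 1] x0 subspace_neg[OF V x0]
      sublinear_onD(2)[OF p order_refl x0]
    by (simp add: p0_def)
  then have "f x0 = p x0"
    using scale[OF x0, of "-1"] le[OF x0] by simp
  then show thesis
    using that add scale le by blast
qed

section \<open>Atomic norms\<close>

instantiation "fun" :: (type, real_vector) real_vector
begin

definition scaleR_fun :: "real \<Rightarrow> ('a \<Rightarrow> 'b) \<Rightarrow> 'a \<Rightarrow> 'b" where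
  "scaleR_fun r f = (\<lambda>i. r *\<^sub>R f i)"

instance
  by standard (auto simp: scaleR_fun_def fun_eq_iff scaleR_add_right scaleR_add_left)

end

definition atomic_series ::
    "('i \<Rightarrow> complex) set \<Rightarrow> (nat \<Rightarrow> complex) \<Rightarrow> (nat \<Rightarrow> 'i \<Rightarrow> complex) \<Rightarrow> ('i \<Rightarrow> complex) \<Rightarrow> bool" where
  "atomic_series S c a x \<longleftrightarrow>
     range a \<subseteq> S \<and> summable (\<lambda>m. cmod (c m)) \<and> x = (\<lambda>i. \<Sum>m. c m * a m i)"

definition atomic_space :: "('i \<Rightarrow> complex) set \<Rightarrow> ('i \<Rightarrow> complex) set" where
  "atomic_space S = {x. \<exists>c a. atomic_series S c a x}"

text \<open>The gauge of the absolutely convex hull of \<open>S\<close>, with countable combinations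
  in place of finite ones. For the set of elementary families it is the infimum of the sums of the
  |lam| over all decompositions.\<close>

definition atomic_norm :: "('i \<Rightarrow> complex) set \<Rightarrow> ('i \<Rightarrow> complex) \<Rightarrow> real" where
  "atomic_norm S x = Inf {\<Sum>m. cmod (c m) | c a. atomic_series S c a x}"

text \<open>Two countable decompositions are merged into one by alternating their terms. The first M
  terms contain \<open>Suc M div 2\<close> terms of \<open>f\<close>, which occupies the even
  positions, and \<open>M div 2\<close> terms of \<open>g\<close>.\<close>

lemma interleave_sums:
  fixes f g :: "nat \<Rightarrow> 'a::real_normed_vector"
  assumes "f sums x" and "g sums y"
  shows "(\<lambda>m. if even m then f (m div 2) else g (m div 2)) sums (x + y)"
proof -
  have partial: "(\<Sum>m<M. if even m then f (m div 2) else g (m div 2))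
      = (\<Sum>m<Suc M div 2. f m) + (\<Sum>m<M div 2. g m)" for M
    by (induction M) (auto elim!: evenE oddE)
  have "filterlim (\<lambda>M::nat. M div 2) at_top sequentially"
    unfolding filterlim_at_top eventually_sequentially
    by (metis div_le_mono nonzero_mult_div_cancel_left zero_neq_numeral)
  moreover from this have "filterlim (\<lambda>M::nat. Suc M div 2) at_top sequentially"
    by (rule filterlim_compose) (rule filterlim_Suc)
  ultimately show ?thesis
    using assms unfolding sums_def partial by (intro tendsto_add) (auto elim: filterlim_compose)
qed

context
  fixes S :: "('i \<Rightarrow> complex) set"
  assumes bound: "\<And>i. bounded ((\<lambda>a. a i) ` S)"
    and ne: "S \<noteq> {}"
begin

lemma atomic_series_summable:
  assumes "atomic_series S c a x"
  shows "summable (\<lambda>m. c m * a m i)"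
proof -
  obtain b where b: "\<And>a. a \<in> S \<Longrightarrow> cmod (a i) \<le> b"
    using bound[of i] by (auto simp: bounded_iff)
  show ?thesis
  proof (rule summable_comparison_test')
    show "summable (\<lambda>m. cmod (c m) * b)"
      using assms by (intro summable_mult2) (simp add: atomic_series_def)
    show "norm (c m * a m i) \<le> cmod (c m) * b" for m
      using assms b[of "a m"] by (auto simp: atomic_series_def norm_mult intro!: mult_left_mono)
  qed
qed

lemma atomic_series_sums:
  assumes "atomic_series S c a x"
  shows "(\<lambda>m. c m * a m i) sums x i"
  using atomic_series_summable[OF assms] assms by (simp add: atomic_series_def summable_sums)

lemma atomic_seriesI:
  assumes "range a \<subseteq> S" and "summable (\<lambda>m. cmod (c m))" and "\<And>i. (\<lambda>m. c m * a m i) sums x i"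
  shows "atomic_series S c a x"
  using assms by (auto simp: atomic_series_def sums_iff fun_eq_iff)

lemma atomic_norm_le: "atomic_series S c a x \<Longrightarrow> atomic_norm S x \<le> (\<Sum>m. cmod (c m))"
  unfolding atomic_norm_def
  by (rule cInf_lower) (auto intro!: bdd_belowI[of _ 0] suminf_nonneg simp: atomic_series_def)

lemma atomic_norm_greatest:
  assumes "x \<in> atomic_space S" and "\<And>c a. atomic_series S c a x \<Longrightarrow> r \<le> (\<Sum>m. cmod (c m))"
  shows "r \<le> atomic_norm S x"
  unfolding atomic_norm_def by (rule cInf_greatest) (use assms in \<open>auto simp: atomic_space_def\<close>)

lemma atomic_series_add:
  assumes x: "atomic_series S c a x" and y: "atomic_series S d e y"
  shows "\<exists>c' a'. atomic_series S c' a' (x + y) \<and>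
    (\<Sum>m. cmod (c' m)) = (\<Sum>m. cmod (c m)) + (\<Sum>m. cmod (d m))"
proof (intro exI conjI)
  let ?c = "\<lambda>m. if even m then c (m div 2) else d (m div 2)"
  let ?a = "\<lambda>m. if even m then a (m div 2) else e (m div 2)"
  have "(\<lambda>m. if even m then cmod (c (m div 2)) else cmod (d (m div 2))) sums
      ((\<Sum>m. cmod (c m)) + (\<Sum>m. cmod (d m)))"
    using x y by (intro interleave_sums) (auto simp: atomic_series_def summable_sums)
  then have sums: "(\<lambda>m. cmod (?c m)) sums ((\<Sum>m. cmod (c m)) + (\<Sum>m. cmod (d m)))"
    by (simp add: if_distrib[of cmod])
  then show "(\<Sum>m. cmod (?c m)) = (\<Sum>m. cmod (c m)) + (\<Sum>m. cmod (d m))"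
    by (rule sums_unique[symmetric])
  show "atomic_series S ?c ?a (x + y)"
  proof (rule atomic_seriesI)
    show "range ?a \<subseteq> S"
      using x y by (auto simp: atomic_series_def)
    show "summable (\<lambda>m. cmod (?c m))"
      using sums by (rule sums_summable)
    fix i
    have "(\<lambda>m. if even m then c (m div 2) * a (m div 2) i else d (m div 2) * e (m div 2) i)
        sums (x i + y i)"
      by (intro interleave_sums atomic_series_sums x y)
    then show "(\<lambda>m. ?c m * ?a m i) sums (x + y) i"
      by (simp add: if_distrib if_distribR cong: if_cong)
  qed
qed

lemma atomic_series_scale:
  assumes "atomic_series S c a x"
  shows "atomic_series S (\<lambda>m. z * c m) a (\<lambda>i. z * x i)"
    and "(\<Sum>m. cmod (z * c m)) = cmod z * (\<Sum>m. cmod (c m))"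
proof -
  show "atomic_series S (\<lambda>m. z * c m) a (\<lambda>i. z * x i)"
    using assms sums_mult[OF atomic_series_sums[OF assms], of z]
    by (intro atomic_seriesI) (auto simp: atomic_series_def norm_mult summable_mult mult.assoc)
qed (use assms in \<open>simp add: atomic_series_def norm_mult suminf_mult\<close>)

lemma atomic_series_single:
  assumes "a \<in> S"
  shows "atomic_series S (\<lambda>m. if m = 0 then z else 0) (\<lambda>_. a) (\<lambda>i. z * a i)"
    and "(\<Sum>m. cmod (if m = 0 then z else 0)) = cmod z"
proof -
  have "(\<lambda>m. if m = 0 then cmod z else 0) sums cmod z"
    by (rule sums_single)
  then have sums: "(\<lambda>m. cmod (if m = 0 then z else 0)) sums cmod z"
    by (simp add: if_distrib[of cmod] cong: if_cong)
  then show "(\<Sum>m. cmod (if m = 0 then z else 0)) = cmod z"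
    by (rule sums_unique[symmetric])
  show "atomic_series S (\<lambda>m. if m = 0 then z else 0) (\<lambda>_. a) (\<lambda>i. z * a i)"
  proof (rule atomic_seriesI)
    fix i
    have "(\<lambda>m. if m = 0 then z * a i else 0) sums (z * a i)"
      by (rule sums_single)
    then show "(\<lambda>m. (if m = 0 then z else 0) * a i) sums (z * a i)"
      by (simp add: if_distribR if_distrib cong: if_cong)
  qed (use assms sums in \<open>auto simp: sums_iff\<close>)
qed

lemma atomic_series_tail:
  assumes "atomic_series S c a x"
  shows "atomic_series S (\<lambda>m. c (m + M)) (\<lambda>m. a (m + M)) (x - (\<lambda>i. \<Sum>m<M. c m * a m i))"
proof (rule atomic_seriesI)
  show "summable (\<lambda>m. cmod (c (m + M)))"
    using assms by (simp add: atomic_series_def summable_iff_shift[of "\<lambda>m. cmod (c m)"])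
qed (use assms sums_split_initial_segment[OF atomic_series_sums[OF assms]] in
    \<open>auto simp: atomic_series_def fun_diff_def\<close>)

lemma atomic_space_scale: "x \<in> atomic_space S \<Longrightarrow> (\<lambda>i. z * x i) \<in> atomic_space S"
  using atomic_series_scale(1) by (fastforce simp: atomic_space_def)

lemma atomic_space_add: "x \<in> atomic_space S \<Longrightarrow> y \<in> atomic_space S \<Longrightarrow> x + y \<in> atomic_space S"
  using atomic_series_add by (fastforce simp: atomic_space_def)

lemma atomic_space_atom: "a \<in> S \<Longrightarrow> a \<in> atomic_space S"
  using atomic_series_single(1)[of a 1] by (auto simp: atomic_space_def)

lemma atomic_space_zero: "(\<lambda>i. 0) \<in> atomic_space S"
  using ne atomic_space_scale[OF atomic_space_atom, of _ 0] by auto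

lemma scaleR_fun_eq_mult: "r *\<^sub>R f = (\<lambda>i. complex_of_real r * f i)"
  by (simp add: scaleR_fun_def fun_eq_iff scaleR_conv_of_real)

lemma subspace_atomic_space: "subspace (atomic_space S)"
  using atomic_space_zero atomic_space_scale atomic_space_add
  by (auto simp: subspace_def scaleR_fun_eq_mult zero_fun_def)

lemma atomic_norm_add:
  assumes "x \<in> atomic_space S" "y \<in> atomic_space S"
  shows "atomic_norm S (x + y) \<le> atomic_norm S x + atomic_norm S y"
proof -
  have "atomic_norm S (x + y) \<le> (\<Sum>m. cmod (c m)) + (\<Sum>m. cmod (d m))"
    if "atomic_series S c a x" "atomic_series S d e y" for c a d e
    using atomic_series_add[OF that] atomic_norm_le by metis
  then have "atomic_norm S (x + y) - (\<Sum>m. cmod (d m)) \<le> atomic_norm S x"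
    if "atomic_series S d e y" for d e
    using that by (intro atomic_norm_greatest assms) (simp add: algebra_simps)
  then have "atomic_norm S (x + y) - atomic_norm S x \<le> atomic_norm S y"
    by (intro atomic_norm_greatest assms) (simp add: algebra_simps)
  then show ?thesis
    by simp
qed

lemma atomic_norm_scale_le:
  assumes x: "x \<in> atomic_space S"
  shows "atomic_norm S (\<lambda>i. z * x i) \<le> cmod z * atomic_norm S x"
proof (cases "z = 0")
  case True
  obtain a where "a \<in> S"
    using ne by blast
  then show ?thesis
    using atomic_norm_le[OF atomic_series_single(1)[of a 0]] True by simp
next
  case False
  have "atomic_norm S (\<lambda>i. z * x i) / cmod z \<le> (\<Sum>m. cmod (c m))" if "atomic_series S c a x" for c a
    using atomic_norm_le[OF atomic_series_scale(1)[OF that, of z]] atomic_series_scale(2)[OF that, of z] False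
    by (simp add: field_simps)
  then have "atomic_norm S (\<lambda>i. z * x i) / cmod z \<le> atomic_norm S x"
    by (intro atomic_norm_greatest x)
  then show ?thesis
    using False by (simp add: field_simps)
qed

lemma atomic_norm_scale:
  assumes x: "x \<in> atomic_space S"
  shows "atomic_norm S (\<lambda>i. z * x i) = cmod z * atomic_norm S x"
proof (rule antisym[OF atomic_norm_scale_le[OF x]])
  show "cmod z * atomic_norm S x \<le> atomic_norm S (\<lambda>i. z * x i)"
  proof (cases "z = 0")
    case True
    then show ?thesis
      using atomic_norm_greatest[OF atomic_space_scale[OF x, of z], of 0]
      by (simp add: atomic_series_def suminf_nonneg)
  next
    case False
    have "atomic_norm S (\<lambda>i. inverse z * (z * x i)) \<le> cmod (inverse z) * atomic_norm S (\<lambda>i. z * x i)"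
      by (intro atomic_norm_scale_le atomic_space_scale x)
    then show ?thesis
      using False by (simp add: mult.assoc[symmetric] norm_inverse) (simp add: field_simps)
  qed
qed

lemma sublinear_atomic_norm: "sublinear_on (atomic_space S) (atomic_norm S)"
  by (auto simp: sublinear_on_def scaleR_fun_eq_mult atomic_norm_scale intro: atomic_norm_add)

text \<open>A real functional \<open>g\<close> below the atomic norm, and equal to it at
  \<open>x\<close>, is complexified to g y - i g(i y); rotating the value onto the real axis bounds
  its modulus by the atomic norm. It can be applied term by term to atomic series, because a tail of
  the series has atomic norm at most the tail of \<open>\<Sum>m. cmod (c m)\<close>.\<close>

theorem atomic_norm_dual:
  assumes x: "x \<in> atomic_space S" and C: "\<And>c a. atomic_series S c a x \<Longrightarrow> C \<le> (\<Sum>m. cmod (c m))"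
  obtains f where "\<And>y z. y \<in> atomic_space S \<Longrightarrow> z \<in> atomic_space S \<Longrightarrow> f (y + z) = f y + f z"
    and "\<And>c y. y \<in> atomic_space S \<Longrightarrow> f (\<lambda>i. c * y i) = c * f y"
    and "\<And>a. a \<in> S \<Longrightarrow> cmod (f a) \<le> 1"
    and "\<And>c a y. atomic_series S c a y \<Longrightarrow> (\<lambda>m. c m * f (a m)) sums f y"
    and "C \<le> cmod (f x)"
proof -
  let ?V = "atomic_space S"
  obtain g where g_add: "\<And>y z. y \<in> ?V \<Longrightarrow> z \<in> ?V \<Longrightarrow> g (y + z) = g y + g z"
    and g_scale: "\<And>r y. y \<in> ?V \<Longrightarrow> g (r *\<^sub>R y) = r * g y"
    and g_le: "\<And>y. y \<in> ?V \<Longrightarrow> g y \<le> atomic_norm S y" and g_x: "g x = atomic_norm S x"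
    using hahn_banach_sublinear[OF subspace_atomic_space sublinear_atomic_norm x] by metis
  define f where "f y = Complex (g y) (- g (\<lambda>i. \<i> * y i))" for y
  have f_add: "f (y + z) = f y + f z" if "y \<in> ?V" "z \<in> ?V" for y z
  proof -
    have "(\<lambda>i. \<i> * (y + z) i) = (\<lambda>i. \<i> * y i) + (\<lambda>i. \<i> * z i)"
      by (auto simp: algebra_simps)
    then show ?thesis
      using that by (simp add: f_def g_add atomic_space_scale complex_eq_iff)
  qed
  have f_scale: "f (\<lambda>i. c * y i) = c * f y" if y: "y \<in> ?V" for c y
  proof -
    have eq: "(\<lambda>i. c * y i) = Re c *\<^sub>R y + Im c *\<^sub>R (\<lambda>i. \<i> * y i)"
      "(\<lambda>i. \<i> * (c * y i)) = Re c *\<^sub>R (\<lambda>i. \<i> * y i) + (- Im c) *\<^sub>R y"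
      by (auto simp: fun_eq_iff scaleR_fun_def complex_eq_iff)
    note V = subspace_scale[OF subspace_atomic_space] y atomic_space_scale[OF y]
    show ?thesis
      unfolding f_def
      by (subst eq(1), subst eq(2), subst (1 2) g_add)
        (simp_all add: V g_scale complex_eq_iff del: scaleR_minus_left)
  qed
  have f_le: "cmod (f y) \<le> atomic_norm S y" if y: "y \<in> ?V" for y
  proof -
    obtain c where c: "cmod c = 1" "c * f y = complex_of_real (cmod (f y))"
      using ex_phase by blast
    then have "cmod (f y) = Re (f (\<lambda>i. c * y i))"
      by (simp add: f_scale[OF y])
    also have "\<dots> = g (\<lambda>i. c * y i)"
      by (simp add: f_def)
    also have "\<dots> \<le> atomic_norm S (\<lambda>i. c * y i)"
      by (intro g_le atomic_space_scale y)
    finally show ?thesis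
      using y c by (simp add: atomic_norm_scale)
  qed
  have atom: "cmod (f a) \<le> 1" if "a \<in> S" for a
    using f_le[OF atomic_space_atom[OF that]] atomic_norm_le[OF atomic_series_single(1)[OF that, of 1]]
      atomic_series_single(2)[OF that, of 1] by simp
  have series: "(\<lambda>m. c m * f (a m)) sums f y" if ser: "atomic_series S c a y" for c a y
  proof -
    have a: "a m \<in> S" for m
      using ser by (auto simp: atomic_series_def)
    have y: "y \<in> ?V"
      using ser by (auto simp: atomic_space_def)
    have partial: "(\<lambda>i. \<Sum>m<M. c m * a m i) \<in> ?V \<and> f (\<lambda>i. \<Sum>m<M. c m * a m i) = (\<Sum>m<M. c m * f (a m))" for M
    proof (induction M)
      case 0
      show ?case
        using atomic_space_zero f_scale[OF atomic_space_zero, of 0] by simp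
    next
      case (Suc M)
      have "(\<lambda>i. \<Sum>m<Suc M. c m * a m i) = (\<lambda>i. \<Sum>m<M. c m * a m i) + (\<lambda>i. c M * a M i)"
        by (simp add: fun_eq_iff)
      then show ?case
        using Suc atomic_space_scale[OF atomic_space_atom[OF a]] atomic_space_atom[OF a]
        by (simp add: f_add f_scale atomic_space_add)
    qed
    have tail: "cmod (f y - (\<Sum>m<M. c m * f (a m))) \<le> (\<Sum>m. cmod (c (m + M)))" for M
    proof -
      let ?s = "\<lambda>i. \<Sum>m<M. c m * a m i"
      have ser': "atomic_series S (\<lambda>m. c (m + M)) (\<lambda>m. a (m + M)) (y - ?s)"
        by (rule atomic_series_tail[OF ser])
      then have in_V: "y - ?s \<in> ?V"
        by (auto simp: atomic_space_def)
      have "f y = f (y - ?s) + f ?s"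
        using f_add[OF in_V, of ?s] partial by (simp add: fun_eq_iff)
      then have "cmod (f y - (\<Sum>m<M. c m * f (a m))) = cmod (f (y - ?s))"
        using partial[of M] by simp
      also have "\<dots> \<le> (\<Sum>m. cmod (c (m + M)))"
        using f_le[OF in_V] atomic_norm_le[OF ser'] by simp
      finally show ?thesis .
    qed
    have "(\<lambda>M. \<Sum>m. cmod (c (m + M))) \<longlonglongrightarrow> 0"
      using ser by (intro suminf_exist_split2) (simp add: atomic_series_def)
    then have "(\<lambda>M. f y - (\<Sum>m<M. c m * f (a m))) \<longlonglongrightarrow> 0"
      by (rule Lim_null_comparison[rotated]) (simp add: tail)
    then have "(\<lambda>M. f y - (f y - (\<Sum>m<M. c m * f (a m)))) \<longlonglongrightarrow> f y - 0"
      by (intro tendsto_intros)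
    then show ?thesis
      by (simp add: sums_def)
  qed
  have "C \<le> g x"
    unfolding g_x using C by (intro atomic_norm_greatest x)
  also have "\<dots> \<le> cmod (f x)"
    using complex_Re_le_cmod[of "f x"] by (simp add: f_def)
  finally show thesis
    using that f_add f_scale atom series by blast
qed

end

section \<open>Averages over cube roots of unity\<close>

lemma sum_PiE_insert:
  assumes "i \<notin> S" and "finite S" and "\<And>j. j \<in> insert i S \<Longrightarrow> finite (T j)"
  shows "(\<Sum>f\<in>PiE (insert i S) T. F f) = (\<Sum>a\<in>T i. \<Sum>f\<in>PiE S T. F (f(i := a)))"
proof -
  have "inj_on (\<lambda>(y, g). g(i := y)) (T i \<times> PiE S T)"
    using assms(1) by (rule inj_combinator)
  then show ?thesis
    by (simp add: PiE_insert_eq sum.reindex sum.cartesian_product case_prod_unfold)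
qed

text \<open>Parseval's identity with vector coefficients: orthogonality is asked of the scalar
  functions \<open>c x\<close> only, and the vectors are arbitrary.\<close>

lemma sum_norm_orthogonal:
  fixes v :: "'x \<Rightarrow> 'h::complex_hilbert_space" and c :: "'x \<Rightarrow> 'w \<Rightarrow> complex"
  assumes "\<And>x y. x \<in> X \<Longrightarrow> y \<in> X \<Longrightarrow> (\<Sum>w\<in>U. c x w * cnj (c y w)) = (if x = y then of_real N else 0)"
    and "finite X"
  shows "(\<Sum>w\<in>U. (norm (\<Sum>x\<in>X. c x w *\<^sub>C v x))\<^sup>2) = N * (\<Sum>x\<in>X. (norm (v x))\<^sup>2)"
proof -
  have "complex_of_real (\<Sum>w\<in>U. (norm (\<Sum>x\<in>X. c x w *\<^sub>C v x))\<^sup>2)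
      = (\<Sum>w\<in>U. \<Sum>x\<in>X. \<Sum>y\<in>X. c x w * cnj (c y w) * cinner (v x) (v y))"
    unfolding of_real_sum cinner_self[symmetric] cinner_sum_left unfolding cinner_sum_right
      cinner_scaleC_left cinner_scaleC_right
    by (simp add: mult_ac)
  also have "\<dots> = (\<Sum>x\<in>X. \<Sum>w\<in>U. \<Sum>y\<in>X. c x w * cnj (c y w) * cinner (v x) (v y))"
    by (rule sum.swap)
  also have "\<dots> = (\<Sum>x\<in>X. \<Sum>y\<in>X. \<Sum>w\<in>U. c x w * cnj (c y w) * cinner (v x) (v y))"
    by (intro sum.cong refl sum.swap)
  also have "\<dots> = (\<Sum>x\<in>X. \<Sum>y\<in>X. if x = y then of_real N * cinner (v x) (v y) else 0)"
    by (intro sum.cong refl) (simp add: sum_distrib_right[symmetric] assms(1))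
  also have "\<dots> = complex_of_real (N * (\<Sum>x\<in>X. (norm (v x))\<^sup>2))"
    using assms(2) by (simp add: sum.delta cinner_self sum_distrib_left)
  finally show ?thesis
    by (simp only: of_real_eq_iff)
qed

section \<open>The finite group of arrays of cube roots of unity\<close>

definition cube_roots :: "complex set" where
  "cube_roots = {z. z ^ 3 = 1}"

definition phases :: "nat \<Rightarrow> (nat \<Rightarrow> complex) set" where
  "phases n = {1..n} \<rightarrow>\<^sub>E cube_roots"

definition phase_arrays :: "nat \<Rightarrow> nat set \<Rightarrow> (nat \<Rightarrow> nat \<Rightarrow> complex) set" where
  "phase_arrays n K = K \<rightarrow>\<^sub>E phases n"

definition monomial :: "nat set \<Rightarrow> (nat \<Rightarrow> nat) \<Rightarrow> (nat \<Rightarrow> nat \<Rightarrow> complex) \<Rightarrow> complex" where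
  "monomial C J u = (\<Prod>i\<in>C. u i (J i))"

lemma finite_cube_roots [simp]: "finite cube_roots"
  using finite_roots_unity[of 3, where 'a = complex] by (simp add: cube_roots_def)

lemma finite_phases [simp]: "finite (phases n)"
  by (simp add: phases_def finite_PiE)

lemma finite_phase_arrays [simp]: "finite K \<Longrightarrow> finite (phase_arrays n K)"
  by (simp add: phase_arrays_def finite_PiE)

lemma finite_multi_indices [simp]: "finite C \<Longrightarrow> finite (multi_indices n C)"
  by (simp add: multi_indices_def finite_PiE)

lemma multi_indices_empty [simp]: "multi_indices n {} = {\<lambda>_. undefined}"
  by (simp add: multi_indices_def)

lemma cmod_cube_root: "z \<in> cube_roots \<Longrightarrow> cmod z = 1"
  using power_eq_imp_eq_norm[of z 3 1] by (simp add: cube_roots_def)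

lemma cube_root_mult_cnj [simp]: "z \<in> cube_roots \<Longrightarrow> z * cnj z = 1" "z \<in> cube_roots \<Longrightarrow> cnj z * z = 1"
  using cmod_cube_root[of z] complex_norm_square[of z] by (auto simp: mult.commute)

lemma phases_nth: "w \<in> phases n \<Longrightarrow> a \<in> {1..n} \<Longrightarrow> w a \<in> cube_roots"
  by (auto simp: phases_def)

lemma phases_nonempty: "phases n \<noteq> {}"
  by (auto simp: phases_def PiE_eq_empty_iff cube_roots_def intro!: exI[of _ 1])

lemma card_phase_arrays_pos: "finite K \<Longrightarrow> 0 < card (phase_arrays n K)"
  using phases_nonempty finite_phase_arrays by (auto simp: card_gt_0_iff phase_arrays_def PiE_eq_empty_iff)

text \<open>Multiplying the coordinate j by z permutes the phases and multiplies the sum by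
  \<open>c\<close>, which differs from 1.\<close>

lemma sum_phases_eq_0:
  assumes j: "j \<in> {1..n}" and z: "z \<in> cube_roots" and c: "c \<noteq> 1"
    and f: "\<And>w. w \<in> phases n \<Longrightarrow> f (w(j := z * w j)) = c * f w"
  shows "(\<Sum>w\<in>phases n. f w) = (0::complex)"
proof -
  have bij: "bij_betw (\<lambda>w. w(j := z * w j)) (phases n) (phases n)"
  proof (rule bij_betw_byWitness[where f' = "\<lambda>w. w(j := cnj z * w j)"])
    have mem: "w(j := c * w j) \<in> phases n" if "w \<in> phases n" "c \<in> cube_roots" for c w
      using that j by (auto simp: phases_def cube_roots_def power_mult_distrib PiE_iff extensional_def)
    have "cnj z \<in> cube_roots"
      using z by (simp add: cube_roots_def complex_cnj_power[symmetric])
    then show "(\<lambda>w. w(j := z * w j)) ` phases n \<subseteq> phases n" "(\<lambda>w. w(j := cnj z * w j)) ` phases n \<subseteq> phases n"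
      using mem z by blast+
  qed (use z in \<open>auto simp: mult.assoc[symmetric]\<close>)
  have "(\<Sum>w\<in>phases n. f w) = (\<Sum>w\<in>phases n. f (w(j := z * w j)))"
    by (rule sum.reindex_bij_betw[OF bij, symmetric])
  also have "\<dots> = c * (\<Sum>w\<in>phases n. f w)"
    by (simp add: f sum_distrib_left)
  finally show ?thesis
    using c by simp
qed

definition zeta3 :: complex where "zeta3 = cis (2 * pi / 3)"

text \<open>The last inequality fails for signs and is the reason for taking cube roots: a product
  of four coordinates may contain the conjugate of the same coordinate twice.\<close>

lemma zeta3: "zeta3 \<in> cube_roots" "zeta3 \<noteq> 1" "cnj zeta3 \<noteq> 1" "cnj zeta3 * cnj zeta3 \<noteq> 1"
proof -
  have "Re zeta3 = - 1 / 2"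
    using cos_120 by (simp add: zeta3_def)
  then have Re: "Re (cnj zeta3) = - 1 / 2"
    by simp
  show root: "zeta3 \<in> cube_roots"
    by (simp add: cube_roots_def zeta3_def Complex.DeMoivre)
  show "zeta3 \<noteq> 1" "cnj zeta3 \<noteq> 1"
    using Re by auto
  show "cnj zeta3 * cnj zeta3 \<noteq> 1"
  proof
    assume "cnj zeta3 * cnj zeta3 = 1"
    then have "cnj zeta3 = 1 \<or> cnj zeta3 = - 1"
      by (simp add: square_eq_1_iff)
    then show False
      using arg_cong[of "cnj zeta3" _ Re] Re by fastforce
  qed
qed

lemma sum_phases_cnj_mult:
  assumes "a \<in> {1..n}" and "b \<in> {1..n}"
  shows "(\<Sum>w\<in>phases n. cnj (w a) * w b) = (if a = b then of_real (card (phases n)) else 0)"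
proof (cases "a = b")
  case True
  then have "(\<Sum>w\<in>phases n. cnj (w a) * w b) = (\<Sum>w\<in>phases n. 1)"
    using assms by (intro sum.cong refl) (simp add: phases_nth)
  then show ?thesis
    using True by simp
next
  case False
  then have "(\<Sum>w\<in>phases n. cnj (w a) * w b) = 0"
    using zeta3 assms by (intro sum_phases_eq_0[of a n zeta3 "cnj zeta3"]) auto
  then show ?thesis
    using False by simp
qed

text \<open>If \<open>a = a'\<close>, these two factors cancel and the relation for products of two
  coordinates remains. Otherwise the coordinate \<open>a\<close> is rotated; it enters through its
  conjugate, once in general and twice if \<open>a = b'\<close>.\<close>

lemma sum_phases_off_diagonal:
  assumes "a \<in> {1..n}" "b \<in> {1..n}" "a' \<in> {1..n}" "b' \<in> {1..n}" and "a \<noteq> b" "a' \<noteq> b'"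
  shows "(\<Sum>w\<in>phases n. cnj (w a) * w b * cnj (cnj (w a') * w b')) =
    (if a = a' \<and> b = b' then of_real (card (phases n)) else 0)"
proof (cases "a = a'")
  case True
  have "(\<Sum>w\<in>phases n. cnj (w a) * w b * cnj (cnj (w a') * w b')) = (\<Sum>w\<in>phases n. (cnj (w a) * w a) * (cnj (w b') * w b))"
    using True by (simp add: mult_ac)
  also have "\<dots> = (\<Sum>w\<in>phases n. cnj (w b') * w b)"
    using assms by (intro sum.cong refl) (simp add: phases_nth)
  finally show ?thesis
    using True assms by (auto simp: sum_phases_cnj_mult)
next
  case False
  have "(\<Sum>w\<in>phases n. cnj (w a) * w b * cnj (cnj (w a') * w b')) = 0"
    using zeta3 assms False
    by (intro sum_phases_eq_0[of a n zeta3 "cnj zeta3 * (if a = b' then cnj zeta3 else 1)"])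
      (auto simp: mult_ac)
  then show ?thesis
    using False by simp
qed

lemma norm_add_square_le: "(norm (x + y))\<^sup>2 \<le> 2 * (norm x)\<^sup>2 + 2 * (norm (y::'a::real_inner))\<^sup>2"
proof -
  have "0 \<le> (norm (x - y))\<^sup>2"
    by simp
  then show ?thesis
    by (simp add: power2_norm_eq_inner inner_add_left inner_add_right inner_diff_left inner_diff_right inner_commute)
qed

text \<open>For \<open>a = b\<close> the product of phases is 1, so the diagonal contributes a
  constant vector, while the off-diagonal products are orthogonal. Separating the two parts costs
  the factor 2. The diagonal squares are added to the last sum so that it runs over a full
  rectangle, as the iteration over positions requires.\<close>

lemma sum_phases_double:
  fixes Y :: "nat \<Rightarrow> nat \<Rightarrow> 'h::complex_hilbert_space"
  shows "(\<Sum>w\<in>phases n. (norm (\<Sum>a\<in>{1..n}. \<Sum>b\<in>{1..n}. (cnj (w a) * w b) *\<^sub>C Y a b))\<^sup>2)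
    \<le> 2 * real (card (phases n)) * ((norm (\<Sum>a\<in>{1..n}. Y a a))\<^sup>2 + (\<Sum>a\<in>{1..n}. \<Sum>b\<in>{1..n}. (norm (Y a b))\<^sup>2))"
proof -
  define I where "I = {1..n}"
  define X where "X = {(a, b). a \<in> I \<and> b \<in> I \<and> a \<noteq> b}"
  have X: "X \<subseteq> I \<times> I" "finite X"
    unfolding X_def I_def by (auto intro: finite_subset[of _ "{1..n} \<times> {1..n}"])
  have split: "(\<Sum>a\<in>I. \<Sum>b\<in>I. (cnj (w a) * w b) *\<^sub>C Y a b)
      = (\<Sum>a\<in>I. Y a a) + (\<Sum>(a, b)\<in>X. (cnj (w a) * w b) *\<^sub>C Y a b)" if w: "w \<in> phases n" for w
  proof -
    have "(\<Sum>a\<in>I. \<Sum>b\<in>I. (cnj (w a) * w b) *\<^sub>C Y a b) = (\<Sum>(a, b)\<in>I \<times> I. (cnj (w a) * w b) *\<^sub>C Y a b)"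
      by (rule sum.cartesian_product)
    also have "I \<times> I = (\<lambda>a. (a, a)) ` I \<union> X"
      by (auto simp: X_def)
    also have "(\<Sum>(a, b)\<in>\<dots>. (cnj (w a) * w b) *\<^sub>C Y a b)
        = (\<Sum>(a, b)\<in>(\<lambda>a. (a, a)) ` I. (cnj (w a) * w b) *\<^sub>C Y a b) + (\<Sum>(a, b)\<in>X. (cnj (w a) * w b) *\<^sub>C Y a b)"
      using X by (intro sum.union_disjoint) (auto simp: X_def I_def)
    also have "(\<Sum>(a, b)\<in>(\<lambda>a. (a, a)) ` I. (cnj (w a) * w b) *\<^sub>C Y a b) = (\<Sum>a\<in>I. Y a a)"
      using w by (subst sum.reindex) (auto simp: inj_on_def I_def phases_nth intro!: sum.cong)
    finally show ?thesis .
  qed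
  have "(\<Sum>w\<in>phases n. (norm (\<Sum>x\<in>X. (cnj (w (fst x)) * w (snd x)) *\<^sub>C Y (fst x) (snd x)))\<^sup>2)
      = card (phases n) * (\<Sum>x\<in>X. (norm (Y (fst x) (snd x)))\<^sup>2)"
    using X(2) by (intro sum_norm_orthogonal[where c = "\<lambda>x w. cnj (w (fst x)) * w (snd x)"])
      (auto simp: X_def I_def sum_phases_off_diagonal simp del: complex_cnj_mult split: if_splits)
  also have "\<dots> \<le> card (phases n) * (\<Sum>x\<in>I \<times> I. (norm (Y (fst x) (snd x)))\<^sup>2)"
    using X by (intro mult_left_mono sum_mono2) (auto simp: I_def)
  also have "\<dots> = card (phases n) * (\<Sum>a\<in>I. \<Sum>b\<in>I. (norm (Y a b))\<^sup>2)"
    by (simp add: sum.cartesian_product case_prod_unfold)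
  finally have off: "(\<Sum>w\<in>phases n. (norm (\<Sum>(a, b)\<in>X. (cnj (w a) * w b) *\<^sub>C Y a b))\<^sup>2)
      \<le> card (phases n) * (\<Sum>a\<in>I. \<Sum>b\<in>I. (norm (Y a b))\<^sup>2)"
    by (simp add: case_prod_unfold)
  have "(\<Sum>w\<in>phases n. (norm (\<Sum>a\<in>I. \<Sum>b\<in>I. (cnj (w a) * w b) *\<^sub>C Y a b))\<^sup>2)
      \<le> (\<Sum>w\<in>phases n. 2 * (norm (\<Sum>a\<in>I. Y a a))\<^sup>2 + 2 * (norm (\<Sum>(a, b)\<in>X. (cnj (w a) * w b) *\<^sub>C Y a b))\<^sup>2)"
    by (rule sum_mono) (simp add: split norm_add_square_le)
  also have "\<dots> \<le> 2 * real (card (phases n)) * ((norm (\<Sum>a\<in>I. Y a a))\<^sup>2 + (\<Sum>a\<in>I. \<Sum>b\<in>I. (norm (Y a b))\<^sup>2))"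
    using off by (simp add: sum.distrib sum_distrib_left[symmetric] algebra_simps)
  finally show ?thesis
    by (simp add: I_def)
qed

section \<open>Mean squares of sums of products of monomials\<close>

definition phase_sum ::
    "nat \<Rightarrow> nat set \<Rightarrow> nat set \<Rightarrow> ((nat \<Rightarrow> nat) \<Rightarrow> (nat \<Rightarrow> nat) \<Rightarrow> 'h::complex_hilbert_space) \<Rightarrow>
      (nat \<Rightarrow> nat \<Rightarrow> complex) \<Rightarrow> 'h" where
  "phase_sum n C D y u =
     (\<Sum>J\<in>multi_indices n C. \<Sum>r\<in>multi_indices n D. (cnj (monomial C J u) * monomial D r u) *\<^sub>C y J r)"

text \<open>The positions in \<gamma> are contracted: there both indices equal \<open>s\<close>, and
  the sum over \<open>s\<close> stands inside the norm. At the other positions the two indices run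
  freely, outside the norm.\<close>

definition block_norm ::
    "nat \<Rightarrow> nat set \<Rightarrow> nat set \<Rightarrow> nat set \<Rightarrow> ((nat \<Rightarrow> nat) \<Rightarrow> (nat \<Rightarrow> nat) \<Rightarrow> 'h::complex_hilbert_space) \<Rightarrow> real" where
  "block_norm n C D \<gamma> y =
     (\<Sum>m\<in>multi_indices n (C - \<gamma>). \<Sum>q\<in>multi_indices n (D - \<gamma>).
        (norm (\<Sum>s\<in>multi_indices n \<gamma>. y (override_on m s \<gamma>) (override_on q s \<gamma>)))\<^sup>2)"

lemma sum_multi_indices_insert:
  assumes "i \<notin> S" and "finite S"
  shows "(\<Sum>f\<in>multi_indices n (insert i S). F f) = (\<Sum>a\<in>{1..n}. \<Sum>f\<in>multi_indices n S. F (f(i := a)))"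
  unfolding multi_indices_def using assms by (intro sum_PiE_insert) auto

lemma sum_phase_arrays_insert:
  assumes "i \<notin> K" and "finite K"
  shows "(\<Sum>f\<in>phase_arrays n (insert i K). F f) = (\<Sum>u\<in>phase_arrays n K. \<Sum>w\<in>phases n. F (u(i := w)))"
  unfolding phase_arrays_def using assms by (subst sum_PiE_insert) (auto intro: sum.swap)

lemma card_phase_arrays_insert:
  "i \<notin> K \<Longrightarrow> finite K \<Longrightarrow> card (phase_arrays n (insert i K)) = card (phases n) * card (phase_arrays n K)"
  by (simp add: phase_arrays_def card_PiE)

lemma monomial_insert:
  assumes "i \<notin> C" and "finite C"
  shows "monomial (insert i C) (J(i := a)) (u(i := w)) = w a * monomial C J u"
proof -
  have "monomial C (J(i := a)) (u(i := w)) = monomial C J u"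
    unfolding monomial_def using assms by (intro prod.cong) auto
  then show ?thesis
    using assms by (simp add: monomial_def)
qed

lemma monomial_fun_upd_notin: "i \<notin> C \<Longrightarrow> monomial C J (u(i := w)) = monomial C J u"
  unfolding monomial_def by (intro prod.cong) auto

lemma override_on_fun_upd_notin: "i \<notin> \<gamma> \<Longrightarrow> override_on (m(i := a)) s \<gamma> = (override_on m s \<gamma>)(i := a)"
  by (auto simp: override_on_def)

lemma override_on_fun_upd_insert:
  "i \<notin> \<gamma> \<Longrightarrow> override_on m (s(i := a)) (insert i \<gamma>) = (override_on m s \<gamma>)(i := a)"
  by (auto simp: override_on_def)

lemma phase_sum_insert_left:
  assumes "i \<notin> C" "i \<notin> D" "finite C"
  shows "phase_sum n (insert i C) D y (u(i := w)) =
    (\<Sum>a\<in>{1..n}. cnj (w a) *\<^sub>C phase_sum n C D (\<lambda>J. y (J(i := a))) u)"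
  using assms by (simp add: phase_sum_def sum_multi_indices_insert monomial_insert monomial_fun_upd_notin
      scaleC_sum_right scaleC_scaleC mult.assoc)

lemma phase_sum_insert_both:
  assumes "i \<notin> C" "i \<notin> D" "finite C" "finite D"
  shows "phase_sum n (insert i C) (insert i D) y (u(i := w)) =
    (\<Sum>a\<in>{1..n}. \<Sum>b\<in>{1..n}. (cnj (w a) * w b) *\<^sub>C phase_sum n C D (\<lambda>J r. y (J(i := a)) (r(i := b))) u)"
  using assms by (simp add: phase_sum_def sum_multi_indices_insert monomial_insert
      scaleC_sum_right scaleC_scaleC mult_ac sum.swap[of _ "{Suc 0..n}" "multi_indices n C"])

lemma phase_sum_insert_neither:
  "i \<notin> C \<Longrightarrow> i \<notin> D \<Longrightarrow> phase_sum n C D y (u(i := w)) = phase_sum n C D y u"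
  by (simp add: phase_sum_def monomial_fun_upd_notin)

lemma phase_sum_sum:
  "phase_sum n C D (\<lambda>J r. \<Sum>a\<in>I. y a J r) u = (\<Sum>a\<in>I. phase_sum n C D (y a) u)"
  by (simp add: phase_sum_def scaleC_sum_right sum.swap[of _ I])

lemma block_norm_insert_left:
  assumes "i \<notin> C" "i \<notin> \<gamma>" "finite C"
  shows "block_norm n (insert i C) D \<gamma> y = (\<Sum>a\<in>{1..n}. block_norm n C D \<gamma> (\<lambda>J. y (J(i := a))))"
  using assms by (simp add: block_norm_def insert_Diff_if sum_multi_indices_insert override_on_fun_upd_notin)

lemma block_norm_insert_both:
  assumes "i \<notin> C" "i \<notin> D" "i \<notin> \<gamma>" "finite C" "finite D"
  shows "block_norm n (insert i C) (insert i D) \<gamma> y =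
    (\<Sum>a\<in>{1..n}. \<Sum>b\<in>{1..n}. block_norm n C D \<gamma> (\<lambda>J r. y (J(i := a)) (r(i := b))))"
  using assms by (simp add: block_norm_def insert_Diff_if sum_multi_indices_insert override_on_fun_upd_notin
      sum.swap[of _ "{Suc 0..n}" "multi_indices n (C - \<gamma>)"])

lemma block_norm_insert_all:
  assumes "i \<notin> C" "i \<notin> D" "i \<notin> \<gamma>" "finite \<gamma>"
  shows "block_norm n (insert i C) (insert i D) (insert i \<gamma>) y =
    block_norm n C D \<gamma> (\<lambda>J r. \<Sum>a\<in>{1..n}. y (J(i := a)) (r(i := a)))"
proof -
  have "insert i S - insert i \<gamma> = S - \<gamma>" if "i \<notin> S" for S
    using that by auto
  then show ?thesis
    using assms by (simp add: block_norm_def sum_multi_indices_insert override_on_fun_upd_insert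
        sum.swap[of _ "{Suc 0..n}"])
qed

text \<open>The coordinates in which the two indices of a monomial coincide, and hence cancel, form the
  set \<open>\<gamma>\<close>; the remaining products of coordinates are orthogonal.\<close>

theorem phase_sum_square_le:
  fixes y :: "(nat \<Rightarrow> nat) \<Rightarrow> (nat \<Rightarrow> nat) \<Rightarrow> 'h::complex_hilbert_space"
  assumes "finite K" and "D \<subseteq> C" and "C \<subseteq> K"
  shows "(\<Sum>u\<in>phase_arrays n K. (norm (phase_sum n C D y u))\<^sup>2)
    \<le> real (card (phase_arrays n K)) * 2 ^ card D * (\<Sum>\<gamma>\<in>Pow D. block_norm n C D \<gamma> y)"
  using assms
proof (induction K arbitrary: C D y rule: finite_induct)
  case empty
  then show ?case
    by (simp add: phase_arrays_def phase_sum_def block_norm_def monomial_def override_on_def)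
next
  case (insert i K)
  let ?N = "real (card (phases n))" and ?M = "real (card (phase_arrays n K))"
  have fin: "finite C" "finite D"
    using insert.prems insert.hyps(1) by (meson finite.insertI finite_subset)+
  have card: "real (card (phase_arrays n (insert i K))) = ?N * ?M"
    using insert.hyps by (simp add: card_phase_arrays_insert)
  have split: "(\<Sum>u\<in>phase_arrays n (insert i K). (norm (phase_sum n C D y u))\<^sup>2) =
      (\<Sum>u\<in>phase_arrays n K. \<Sum>w\<in>phases n. (norm (phase_sum n C D y (u(i := w))))\<^sup>2)"
    by (rule sum_phase_arrays_insert) fact+
  consider "i \<notin> C" | "i \<in> C" "i \<notin> D" | "i \<in> C" "i \<in> D"
    by blast
  then show ?case
  proof cases
    case 1
    have "(\<Sum>u\<in>phase_arrays n K. (norm (phase_sum n C D y u))\<^sup>2)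
        \<le> ?M * 2 ^ card D * (\<Sum>\<gamma>\<in>Pow D. block_norm n C D \<gamma> y)"
      by (rule insert.IH) (use 1 insert.prems in auto)
    moreover have "i \<notin> D"
      using 1 insert.prems by auto
    ultimately show ?thesis
      using 1 unfolding split card
      by (simp add: phase_sum_insert_neither sum_distrib_left[symmetric] mult_left_mono mult.assoc)
  next
    case 2
    define C0 where "C0 = C - {i}"
    have C0: "C = insert i C0" "i \<notin> C0" "finite C0" "D \<subseteq> C0" "C0 \<subseteq> K"
      using 2 fin insert.prems by (auto simp: C0_def)
    \<comment> \<open>Only the left index has the position i: orthogonality gives an equality, and
      no constant is lost.\<close>
    have orth: "(\<Sum>w\<in>phases n. (norm (\<Sum>a\<in>{1..n}. cnj (w a) *\<^sub>C Y a))\<^sup>2) = ?N * (\<Sum>a\<in>{1..n}. (norm (Y a))\<^sup>2)"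
      for Y :: "nat \<Rightarrow> 'h"
      by (rule sum_norm_orthogonal[where c = "\<lambda>a w. cnj (w a)"]) (auto simp: sum_phases_cnj_mult)
    have "(\<Sum>u\<in>phase_arrays n (insert i K). (norm (phase_sum n C D y u))\<^sup>2)
        = ?N * (\<Sum>a\<in>{1..n}. \<Sum>u\<in>phase_arrays n K. (norm (phase_sum n C0 D (\<lambda>J. y (J(i := a))) u))\<^sup>2)"
      unfolding split unfolding C0(1) phase_sum_insert_left[OF C0(2) 2(2) C0(3)] orth
      by (simp add: sum_distrib_left[symmetric] sum.swap[of _ "{Suc 0..n}"])
    also have "\<dots> \<le> ?N * (\<Sum>a\<in>{1..n}. ?M * 2 ^ card D * (\<Sum>\<gamma>\<in>Pow D. block_norm n C0 D \<gamma> (\<lambda>J. y (J(i := a)))))"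
      using C0 by (intro mult_left_mono sum_mono insert.IH) auto
    also have "\<dots> = ?N * ?M * 2 ^ card D * (\<Sum>\<gamma>\<in>Pow D. \<Sum>a\<in>{1..n}. block_norm n C0 D \<gamma> (\<lambda>J. y (J(i := a))))"
      by (simp add: sum_distrib_left[symmetric] sum.swap[of _ "{Suc 0..n}"])
    also have "(\<Sum>\<gamma>\<in>Pow D. \<Sum>a\<in>{1..n}. block_norm n C0 D \<gamma> (\<lambda>J. y (J(i := a)))) = (\<Sum>\<gamma>\<in>Pow D. block_norm n C D \<gamma> y)"
      unfolding C0(1) using C0 2 by (intro sum.cong refl block_norm_insert_left[symmetric]) auto
    finally show ?thesis
      unfolding card .
  next
    case 3
    define C0 D0 where "C0 = C - {i}" and "D0 = D - {i}"
    have C0: "C = insert i C0" "i \<notin> C0" "finite C0" "C0 \<subseteq> K"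
      and D0: "D = insert i D0" "i \<notin> D0" "finite D0" "D0 \<subseteq> C0"
      using 3 fin insert.prems by (auto simp: C0_def D0_def)
    \<comment> \<open>Both indices have the position i, which costs the factor 2. The diagonal part
      \<open>ya\<close> produces the sets \<gamma> that contain i, the family \<open>yab\<close>
      those that do not.\<close>
    define ya yab where "ya = (\<lambda>J r. \<Sum>a\<in>{1..n}. y (J(i := a)) (r(i := a)))"
      and "yab = (\<lambda>a b J r. y (J(i := a)) (r(i := b)))"
    let ?S = "\<lambda>z. \<Sum>u\<in>phase_arrays n K. (norm (phase_sum n C0 D0 z u))\<^sup>2"
    let ?B = "\<lambda>z. \<Sum>\<gamma>\<in>Pow D0. block_norm n C0 D0 \<gamma> z"
    have IH: "?S z \<le> ?M * 2 ^ card D0 * ?B z" for z :: "(nat \<Rightarrow> nat) \<Rightarrow> (nat \<Rightarrow> nat) \<Rightarrow> 'h"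
      by (rule insert.IH; fact)
    have "(\<Sum>u\<in>phase_arrays n (insert i K). (norm (phase_sum n C D y u))\<^sup>2)
        \<le> (\<Sum>u\<in>phase_arrays n K. 2 * ?N * ((norm (\<Sum>a\<in>{1..n}. phase_sum n C0 D0 (yab a a) u))\<^sup>2
            + (\<Sum>a\<in>{1..n}. \<Sum>b\<in>{1..n}. (norm (phase_sum n C0 D0 (yab a b) u))\<^sup>2)))"
      unfolding split unfolding C0(1) D0(1) phase_sum_insert_both[OF C0(2) D0(2) C0(3) D0(3)] yab_def
      by (intro sum_mono) (rule sum_phases_double)
    also have "\<dots> = 2 * ?N * (?S ya + (\<Sum>a\<in>{1..n}. \<Sum>b\<in>{1..n}. ?S (yab a b)))"
      by (simp add: phase_sum_sum[symmetric] ya_def yab_def sum_distrib_left[symmetric] sum.distrib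
          sum.swap[of _ "{Suc 0..n}" "phase_arrays n K"])
    also have "\<dots> \<le> 2 * ?N * (?M * 2 ^ card D0 * ?B ya + (\<Sum>a\<in>{1..n}. \<Sum>b\<in>{1..n}. ?M * 2 ^ card D0 * ?B (yab a b)))"
      by (intro mult_left_mono add_mono sum_mono IH) auto
    also have "\<dots> = ?N * ?M * 2 ^ card D * (?B ya + (\<Sum>a\<in>{1..n}. \<Sum>b\<in>{1..n}. ?B (yab a b)))"
      using D0 by (simp add: sum_distrib_left[symmetric] algebra_simps)
    also have "?B ya = (\<Sum>\<gamma>\<in>Pow D0. block_norm n C D (insert i \<gamma>) y)"
      unfolding C0(1) D0(1) ya_def
      using C0 D0 by (intro sum.cong refl block_norm_insert_all[symmetric]) (auto intro: finite_subset)
    also have "(\<Sum>a\<in>{1..n}. \<Sum>b\<in>{1..n}. ?B (yab a b)) = (\<Sum>\<gamma>\<in>Pow D0. \<Sum>a\<in>{1..n}. \<Sum>b\<in>{1..n}. block_norm n C0 D0 \<gamma> (yab a b))"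
      by (simp add: sum.swap[of _ "{Suc 0..n}" "Pow D0"])
    also have "\<dots> = (\<Sum>\<gamma>\<in>Pow D0. block_norm n C D \<gamma> y)"
      unfolding C0(1) D0(1) yab_def
      using C0 D0 by (intro sum.cong refl block_norm_insert_both[symmetric]) auto
    also have "(\<Sum>\<gamma>\<in>Pow D0. block_norm n C D (insert i \<gamma>) y) + (\<Sum>\<gamma>\<in>Pow D0. block_norm n C D \<gamma> y)
        = (\<Sum>\<gamma>\<in>Pow D. block_norm n C D \<gamma> y)"
    proof -
      have "inj_on (insert i) (Pow D0)"
        using D0(2) by (auto simp: inj_on_def)
      moreover have "Pow D0 \<inter> insert i ` Pow D0 = {}"
        using D0(2) by auto
      ultimately show ?thesis
        unfolding D0(1) Pow_insert using D0(3)
        by (simp add: sum.union_disjoint sum.reindex add.commute)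
    qed
    finally show ?thesis
      unfolding card .
  qed
qed

section \<open>Contractive families of operators\<close>

lemma multi_indices_extensional: "J \<in> multi_indices n C \<Longrightarrow> J \<in> extensional C"
  by (simp add: multi_indices_def PiE_iff)

lemma restrict_in_multi_indices: "J \<in> multi_indices n K \<Longrightarrow> \<gamma> \<subseteq> K \<Longrightarrow> restrict J \<gamma> \<in> multi_indices n \<gamma>"
  by (auto simp: multi_indices_def)

lemma override_on_in_multi_indices:
  assumes "s \<in> multi_indices n \<gamma>" and "m \<in> multi_indices n (K - \<gamma>)" and "\<gamma> \<subseteq> K"
  shows "override_on m s \<gamma> \<in> multi_indices n K"
  using assms by (auto simp: multi_indices_def override_on_def PiE_iff extensional_def)

lemma restrict_override_on:
  assumes "s \<in> multi_indices n \<gamma>" and "m \<in> multi_indices n (K - \<gamma>)"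
  shows "restrict (override_on m s \<gamma>) \<gamma> = s" and "restrict (override_on m s \<gamma>) (K - \<gamma>) = m"
  using assms by (auto simp: multi_indices_def override_on_def PiE_iff extensional_def fun_eq_iff)

lemma sum_multi_indices_split:
  assumes "\<gamma> \<subseteq> K" and "finite K"
  shows "(\<Sum>J\<in>multi_indices n K. F J) =
    (\<Sum>s\<in>multi_indices n \<gamma>. \<Sum>m\<in>multi_indices n (K - \<gamma>). F (override_on m s \<gamma>))"
proof -
  have "(\<Sum>x\<in>multi_indices n \<gamma> \<times> multi_indices n (K - \<gamma>). F (override_on (snd x) (fst x) \<gamma>)) = (\<Sum>J\<in>multi_indices n K. F J)"
  proof (rule sum.reindex_bij_witness[where i = "\<lambda>J. (restrict J \<gamma>, restrict J (K - \<gamma>))"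
        and j = "\<lambda>x. override_on (snd x) (fst x) \<gamma>"])
    fix J assume J: "J \<in> multi_indices n K"
    show "override_on (snd (restrict J \<gamma>, restrict J (K - \<gamma>))) (fst (restrict J \<gamma>, restrict J (K - \<gamma>))) \<gamma> = J"
      using multi_indices_extensional[OF J] assms(1)
      by (auto simp: override_on_def fun_eq_iff extensional_def)
    show "(restrict J \<gamma>, restrict J (K - \<gamma>)) \<in> multi_indices n \<gamma> \<times> multi_indices n (K - \<gamma>)"
      using J assms(1) by (auto intro: restrict_in_multi_indices)
  next
    fix x assume "x \<in> multi_indices n \<gamma> \<times> multi_indices n (K - \<gamma>)"
    then have x: "fst x \<in> multi_indices n \<gamma>" "snd x \<in> multi_indices n (K - \<gamma>)"
      by auto
    show "(restrict (override_on (snd x) (fst x) \<gamma>) \<gamma>, restrict (override_on (snd x) (fst x) \<gamma>) (K - \<gamma>)) = x"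
      by (simp add: restrict_override_on[OF x])
    show "override_on (snd x) (fst x) \<gamma> \<in> multi_indices n K"
      by (rule override_on_in_multi_indices[OF x assms(1)])
  qed (rule refl)
  then show ?thesis
    by (simp add: sum.cartesian_product case_prod_unfold)
qed

lemma sum_multi_indices_restrict:
  assumes "\<gamma> \<subseteq> K" and "finite K"
  shows "(\<Sum>J\<in>multi_indices n K. F (restrict J \<gamma>) (restrict J (K - \<gamma>))) =
    (\<Sum>s\<in>multi_indices n \<gamma>. \<Sum>m\<in>multi_indices n (K - \<gamma>). F s m)"
  unfolding sum_multi_indices_split[OF assms]
  by (intro sum.cong refl) (simp add: restrict_override_on)

lemma monomial_split:
  assumes "\<gamma> \<subseteq> K" and "finite K"
  shows "monomial K J u = monomial \<gamma> (restrict J \<gamma>) u * monomial (K - \<gamma>) (restrict J (K - \<gamma>)) u"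
proof -
  have "monomial K J u = monomial (\<gamma> \<union> (K - \<gamma>)) J u"
    using assms(1) by (simp add: Un_absorb1)
  also have "\<dots> = monomial \<gamma> J u * monomial (K - \<gamma>) J u"
    unfolding monomial_def using assms by (intro prod.union_disjoint) (auto intro: finite_subset)
  finally show ?thesis
    by (simp add: monomial_def)
qed

section \<open>Operator matrices attached to a set of positions\<close>

definition square_sum :: "nat \<Rightarrow> nat set \<Rightarrow> ((nat \<Rightarrow> nat) \<Rightarrow> 'h::complex_hilbert_space) \<Rightarrow> real" where
  "square_sum n C h = (\<Sum>i\<in>multi_indices n C. (norm (h i))\<^sup>2)"

lemma square_sum_nonneg: "0 \<le> square_sum n C h"
  by (simp add: square_sum_def sum_nonneg)

lemma square_sum_scaleR: "square_sum n C (\<lambda>i. r *\<^sub>R h i) = r\<^sup>2 * square_sum n C h"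
  by (simp add: square_sum_def power_mult_distrib sum_distrib_left)

definition index_pairing ::
    "nat \<Rightarrow> nat set \<Rightarrow> nat set \<Rightarrow> ((nat \<Rightarrow> nat) \<Rightarrow> 'h::complex_hilbert_space \<Rightarrow>\<^sub>L 'h) \<Rightarrow>
      ((nat \<Rightarrow> nat) \<Rightarrow> 'h) \<Rightarrow> ((nat \<Rightarrow> nat) \<Rightarrow> 'h) \<Rightarrow> complex" where
  "index_pairing n K \<gamma> a h g =
     (\<Sum>J\<in>multi_indices n K. cinner ((a J) (h (restrict J \<gamma>))) (g (restrict J (K - \<gamma>))))"

text \<open>This is the polar of the set of elementary families in the decomposition: for each \<open>\<gamma>\<close>, the family is a
  contraction when read as an operator matrix with columns in \<open>[n]\<^sup>\<gamma>\<close> and rows in \<open>[n]\<^bsup>K - \<gamma>\<^esup>\<close>.\<close>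

definition contractive_family ::
    "nat \<Rightarrow> nat set \<Rightarrow> ((nat \<Rightarrow> nat) \<Rightarrow> 'h::complex_hilbert_space \<Rightarrow>\<^sub>L 'h) \<Rightarrow> bool" where
  "contractive_family n K a \<longleftrightarrow> (\<forall>\<gamma>\<subseteq>K. \<forall>h g. square_sum n \<gamma> h \<le> 1 \<longrightarrow> square_sum n (K - \<gamma>) g \<le> 1 \<longrightarrow>
     cmod (index_pairing n K \<gamma> a h g) \<le> 1)"

lemma index_pairing_scaleR:
  "index_pairing n K \<gamma> a (\<lambda>i. r *\<^sub>R h i) (\<lambda>i. s *\<^sub>R g i) = of_real (r * s) * index_pairing n K \<gamma> a h g"
  by (simp add: index_pairing_def blinfun.scaleR_right cinner_scaleR_left cinner_scaleR_right sum_distrib_left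
      mult_ac)

lemma index_pairing_zero:
  assumes "finite K" and "\<gamma> \<subseteq> K" and "square_sum n \<gamma> h = 0 \<or> square_sum n (K - \<gamma>) g = 0"
  shows "index_pairing n K \<gamma> a h g = 0"
proof -
  have zero: "f i = 0" if "square_sum n C f = 0" "finite C" "i \<in> multi_indices n C" for f :: "_ \<Rightarrow> 'a" and C i
    using that by (simp add: square_sum_def sum_nonneg_eq_0_iff)
  have "finite \<gamma>" "finite (K - \<gamma>)"
    using assms finite_subset by auto
  then show ?thesis
    unfolding index_pairing_def using assms(2,3)
    by (intro sum.neutral ballI) (auto simp: zero restrict_in_multi_indices blinfun.zero_right)
qed

lemma contractive_family_bound:
  assumes a: "contractive_family n K a" and K: "finite K" "\<gamma> \<subseteq> K"
  shows "cmod (index_pairing n K \<gamma> a h g) \<le> sqrt (square_sum n \<gamma> h) * sqrt (square_sum n (K - \<gamma>) g)"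
proof (cases "square_sum n \<gamma> h = 0 \<or> square_sum n (K - \<gamma>) g = 0")
  case True
  then show ?thesis
    using index_pairing_zero[OF K True] by (simp add: square_sum_nonneg)
next
  case False
  define r s where "r = sqrt (square_sum n \<gamma> h)" and "s = sqrt (square_sum n (K - \<gamma>) g)"
  have pos: "0 < r" "0 < s"
    using False square_sum_nonneg[of n \<gamma> h] square_sum_nonneg[of n "K - \<gamma>" g] by (auto simp: r_def s_def)
  have "square_sum n \<gamma> (\<lambda>i. inverse r *\<^sub>R h i) \<le> 1" "square_sum n (K - \<gamma>) (\<lambda>i. inverse s *\<^sub>R g i) \<le> 1"
    using False by (auto simp: square_sum_scaleR r_def s_def power_inverse square_sum_nonneg)
  then have "cmod (index_pairing n K \<gamma> a (\<lambda>i. inverse r *\<^sub>R h i) (\<lambda>i. inverse s *\<^sub>R g i)) \<le> 1"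
    using a K(2) by (auto simp: contractive_family_def)
  then show ?thesis
    using pos by (simp add: index_pairing_scaleR norm_mult norm_divide field_simps r_def[symmetric] s_def[symmetric])
qed

text \<open>Adjoints exchange rows and columns, that is, \<gamma> with its complement; contractivity
  is asked for every \<gamma> and thus survives.\<close>

lemma contractive_family_adjoint:
  assumes a: "contractive_family n K a" and adj: "\<And>J. J \<in> multi_indices n K \<Longrightarrow> is_adjoint (b J) (a J)"
  shows "contractive_family n K b"
  unfolding contractive_family_def
proof (intro allI impI)
  fix \<gamma> and h g :: "(nat \<Rightarrow> nat) \<Rightarrow> 'a" assume \<gamma>: "\<gamma> \<subseteq> K" and h: "square_sum n \<gamma> h \<le> 1" and g: "square_sum n (K - \<gamma>) g \<le> 1"
  have eq: "K - (K - \<gamma>) = \<gamma>"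
    using \<gamma> by auto
  have "index_pairing n K \<gamma> b h g = cnj (index_pairing n K (K - \<gamma>) a g h)"
    unfolding index_pairing_def eq cnj_sum
    using adj by (intro sum.cong refl) (metis cinner_commute is_adjoint_def)
  moreover have "cmod (index_pairing n K (K - \<gamma>) a g h) \<le> 1"
    using a h g eq by (auto simp: contractive_family_def)
  ultimately show "cmod (index_pairing n K \<gamma> b h g) \<le> 1"
    by simp
qed

text \<open>For \<gamma> = K the row index set is a single point, and a family of vectors
  concentrated at \<open>J\<close> isolates the operator \<open>a J\<close>. The bound keeps the
  supremum over all contractive families finite.\<close>

lemma contractive_family_norm_le:
  assumes a: "contractive_family n K a" and K: "finite K" and J: "J \<in> multi_indices n K"
  shows "norm (a J) \<le> 1"
proof (rule norm_blinfun_bound)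
  fix v
  define w where "w = (a J) v"
  let ?h = "\<lambda>i. if i = J then v else 0" and ?g = "\<lambda>_::nat \<Rightarrow> nat. w"
  have "index_pairing n K K a ?h ?g = (\<Sum>I\<in>multi_indices n K. if I = J then cinner w w else 0)"
    unfolding index_pairing_def
    by (intro sum.cong refl) (auto simp: w_def blinfun.zero_right extensional_restrict multi_indices_extensional)
  then have pairing: "index_pairing n K K a ?h ?g = of_real ((norm w)\<^sup>2)"
    using K J by (simp add: cinner_self)
  have "square_sum n K ?h = (norm v)\<^sup>2"
  proof -
    have "square_sum n K ?h = (\<Sum>i\<in>multi_indices n K. if i = J then (norm v)\<^sup>2 else 0)"
      unfolding square_sum_def by (intro sum.cong) auto
    then show ?thesis
      using K J by simp
  qed
  moreover have "square_sum n (K - K) ?g = (norm w)\<^sup>2"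
    by (simp add: square_sum_def)
  ultimately have "norm w * norm w \<le> norm v * norm w"
    using contractive_family_bound[OF a K order_refl, of ?h ?g] unfolding pairing
    by (simp add: norm_mult power2_eq_square)
  then show "norm ((a J) v) \<le> 1 * norm v"
    by (cases "w = 0") (auto simp: w_def)
qed auto

text \<open>The sesquilinear bound becomes a bound for the image of \<open>h\<close> when the image
  itself is taken as second argument.\<close>

lemma contractive_family_rows:
  assumes a: "contractive_family n K a" and K: "finite K" "\<gamma> \<subseteq> K"
  shows "(\<Sum>m\<in>multi_indices n (K - \<gamma>). (norm (\<Sum>s\<in>multi_indices n \<gamma>. (a (override_on m s \<gamma>)) (h s)))\<^sup>2)
    \<le> square_sum n \<gamma> h"
proof -
  define V where "V m = (\<Sum>s\<in>multi_indices n \<gamma>. (a (override_on m s \<gamma>)) (h s))" for m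
  let ?X = "square_sum n (K - \<gamma>) V"
  have "index_pairing n K \<gamma> a h V
      = (\<Sum>s\<in>multi_indices n \<gamma>. \<Sum>m\<in>multi_indices n (K - \<gamma>). cinner ((a (override_on m s \<gamma>)) (h s)) (V m))"
    unfolding index_pairing_def sum_multi_indices_split[OF K(2,1)]
    by (intro sum.cong refl) (simp add: restrict_override_on)
  also have "\<dots> = (\<Sum>m\<in>multi_indices n (K - \<gamma>). cinner (V m) (V m))"
    by (subst sum.swap) (simp add: cinner_sum_left[symmetric] V_def[symmetric])
  also have "\<dots> = of_real ?X"
    by (simp add: cinner_self square_sum_def)
  finally have "?X \<le> sqrt (square_sum n \<gamma> h) * sqrt ?X"
    using contractive_family_bound[OF a K, of h V] by (simp add: square_sum_nonneg)
  moreover have "?X = sqrt ?X * sqrt ?X"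
    by (simp add: square_sum_nonneg)
  ultimately have "sqrt ?X * sqrt ?X \<le> sqrt (square_sum n \<gamma> h) * sqrt ?X"
    by linarith
  then have "sqrt ?X \<le> sqrt (square_sum n \<gamma> h) \<or> ?X = 0"
    using square_sum_nonneg[of n "K - \<gamma>" V] unfolding mult_le_cancel_right by (auto simp: not_less)
  then have "?X \<le> square_sum n \<gamma> h"
    by (auto simp: square_sum_nonneg)
  then show ?thesis
    by (simp add: square_sum_def V_def)
qed

text \<open>For fixed free indices q on D - \<gamma>, the sum over the left indices is the row
  estimate for the matrix with columns in [n]^\<gamma>, applied to the slice of \<open>h\<close> at
  q; summing over q reassembles \<open>h\<close>. Since \<gamma> ranges over all subsets of D, this
  is where contractivity for every \<gamma> enters.\<close>

lemma block_norm_contractive_family: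
  assumes a: "contractive_family n K a" and K: "finite K" and sub: "\<gamma> \<subseteq> D" "D \<subseteq> K"
  shows "block_norm n K D \<gamma> (\<lambda>J r. (a J) (h r)) \<le> square_sum n D h"
proof -
  have "block_norm n K D \<gamma> (\<lambda>J r. (a J) (h r)) =
     (\<Sum>q\<in>multi_indices n (D - \<gamma>). \<Sum>m\<in>multi_indices n (K - \<gamma>).
        (norm (\<Sum>s\<in>multi_indices n \<gamma>. (a (override_on m s \<gamma>)) (h (override_on q s \<gamma>))))\<^sup>2)"
    unfolding block_norm_def by (rule sum.swap)
  also have "\<dots> \<le> (\<Sum>q\<in>multi_indices n (D - \<gamma>). square_sum n \<gamma> (\<lambda>s. h (override_on q s \<gamma>)))"
    using sub by (intro sum_mono contractive_family_rows a K) auto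
  also have "\<dots> = square_sum n D h"
    unfolding square_sum_def using sub K 
    by (subst sum.swap, subst sum_multi_indices_split[of \<gamma> D]) (auto intro: finite_subset)
  finally show ?thesis .
qed

text \<open>The constant 4^|D| has two sources: 2^|D| from separating diagonals position by
  position, and 2^|D| from the number of sets \<gamma>.\<close>

lemma phase_sum_contractive_family:
  assumes a: "contractive_family n K a" and K: "finite K" and D: "D \<subseteq> K"
  shows "(\<Sum>u\<in>phase_arrays n K. (norm (phase_sum n K D (\<lambda>J r. (a J) (h r)) u))\<^sup>2)
    \<le> real (card (phase_arrays n K)) * 4 ^ card D * square_sum n D h"
proof -
  have "(\<Sum>\<gamma>\<in>Pow D. block_norm n K D \<gamma> (\<lambda>J r. (a J) (h r))) \<le> (\<Sum>\<gamma>\<in>Pow D. square_sum n D h)"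
    using D by (intro sum_mono block_norm_contractive_family a K) auto
  also have "\<dots> = 2 ^ card D * square_sum n D h"
    using finite_subset[OF D K] by (simp add: card_Pow)
  finally have "real (card (phase_arrays n K)) * 2 ^ card D * (\<Sum>\<gamma>\<in>Pow D. block_norm n K D \<gamma> (\<lambda>J r. (a J) (h r)))
      \<le> real (card (phase_arrays n K)) * 2 ^ card D * (2 ^ card D * square_sum n D h)"
    by (intro mult_left_mono) auto
  also have "\<dots> = real (card (phase_arrays n K)) * 4 ^ card D * square_sum n D h"
    using power_mult_distrib[of "2::real" 2 "card D"] by simp
  finally show ?thesis
    using phase_sum_square_le[OF K D order_refl] order_trans by blast
qed

text \<open>Restricted in both arguments so that conjugation maps the extensional functions in
  \<open>phase_arrays\<close> to each other.\<close>

definition cnj_array :: "nat \<Rightarrow> nat set \<Rightarrow> (nat \<Rightarrow> nat \<Rightarrow> complex) \<Rightarrow> nat \<Rightarrow> nat \<Rightarrow> complex" where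
  "cnj_array n K u = (\<lambda>i\<in>K. \<lambda>j\<in>{1..n}. cnj (u i j))"

lemma sum_phase_arrays_cnj: "(\<Sum>u\<in>phase_arrays n K. F (cnj_array n K u)) = (\<Sum>u\<in>phase_arrays n K. F u)"
proof -
  have inv: "cnj_array n K (cnj_array n K u) = u" if u: "u \<in> phase_arrays n K" for u
  proof (intro ext)
    fix i j
    show "cnj_array n K (cnj_array n K u) i j = u i j"
      using u by (cases "i \<in> K"; cases "j \<in> {1..n}")
        (auto simp: cnj_array_def phase_arrays_def phases_def PiE_iff extensional_def)
  qed
  have "cnj z \<in> cube_roots" if "z \<in> cube_roots" for z
    using that by (simp add: cube_roots_def complex_cnj_power[symmetric])
  then have mem: "cnj_array n K u \<in> phase_arrays n K" if "u \<in> phase_arrays n K" for u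
    using that by (auto simp: cnj_array_def phase_arrays_def phases_def PiE_iff)
  have "bij_betw (cnj_array n K) (phase_arrays n K) (phase_arrays n K)"
    by (rule bij_betw_byWitness[where f' = "cnj_array n K"]) (use inv mem in auto)
  then show ?thesis
    by (rule sum.reindex_bij_betw)
qed

lemma monomial_cnj_array:
  assumes "J \<in> multi_indices n C" and "C \<subseteq> K"
  shows "monomial C J (cnj_array n K u) = cnj (monomial C J u)"
  unfolding monomial_def cnj_prod using assms
  by (intro prod.cong refl) (auto simp: cnj_array_def multi_indices_def)

lemma sum_phase_arrays_monomial:
  assumes K: "finite K" and J: "J \<in> multi_indices n K" "I \<in> multi_indices n K"
  shows "(\<Sum>u\<in>phase_arrays n K. monomial K J u * cnj (monomial K I u)) =
    (if J = I then of_nat (card (phase_arrays n K)) else 0)"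
proof -
  have mem: "J i \<in> {1..n}" "I i \<in> {1..n}" if "i \<in> K" for i
    using J that by (auto simp: multi_indices_def)
  have "(\<Sum>u\<in>phase_arrays n K. monomial K J u * cnj (monomial K I u))
      = (\<Sum>u\<in>PiE K (\<lambda>_. phases n). \<Prod>i\<in>K. cnj (u i (I i)) * u i (J i))"
    by (simp add: phase_arrays_def monomial_def cnj_prod prod.distrib mult.commute)
  also have "\<dots> = (\<Prod>i\<in>K. \<Sum>w\<in>phases n. cnj (w (I i)) * w (J i))"
    using K by (intro prod_sum_PiE[symmetric]) auto
  also have "\<dots> = (\<Prod>i\<in>K. if I i = J i then of_nat (card (phases n)) else 0)"
    by (intro prod.cong refl) (use mem sum_phases_cnj_mult in auto)
  also have "\<dots> = (if J = I then of_nat (card (phase_arrays n K)) else 0)"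
  proof (cases "J = I")
    case True
    then show ?thesis
      using K by (simp add: phase_arrays_def card_PiE)
  next
    case False
    then obtain i where "i \<in> K" "J i \<noteq> I i"
      using PiE_ext[of J K "\<lambda>_. {1..n}" I] J unfolding multi_indices_def by blast
    then show ?thesis
      using False K by (auto simp: prod_zero_iff)
  qed
  finally show ?thesis .
qed

section \<open>The main inequality\<close>

text \<open>Complex scalars act through \<^const>\<open>scalar_operator\<close>, as the type of bounded operators has real scalars
  only.\<close>

definition operator_functional ::
    "('h::complex_hilbert_space \<Rightarrow>\<^sub>L 'h) set \<Rightarrow> (('h \<Rightarrow>\<^sub>L 'h) \<Rightarrow> complex) \<Rightarrow> bool" where
  "operator_functional A f \<longleftrightarrow> (\<forall>S\<in>A. \<forall>T\<in>A. f (S + T) = f S + f T) \<and>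
     (\<forall>c. \<forall>T\<in>A. f (scalar_operator c o\<^sub>L T) = c * f T) \<and> (\<exists>C\<ge>0. \<forall>T\<in>A. cmod (f T) \<le> C * norm T)"

lemma operator_functionalD:
  assumes "operator_functional A f"
  shows "S \<in> A \<Longrightarrow> T \<in> A \<Longrightarrow> f (S + T) = f S + f T"
    and "T \<in> A \<Longrightarrow> f (scalar_operator c o\<^sub>L T) = c * f T"
    and "\<exists>C\<ge>0. \<forall>T\<in>A. cmod (f T) \<le> C * norm T"
  using assms by (auto simp: operator_functional_def)

lemma scaleR_eq_scalar_operator: "r *\<^sub>R T = scalar_operator (of_real r) o\<^sub>L T"
  by (rule blinfun_eqI) (simp add: blinfun.scaleR_left scaleR_scaleC)

lemma operator_functional_scaleR:
  "operator_functional A f \<Longrightarrow> T \<in> A \<Longrightarrow> f (r *\<^sub>R T) = of_real r * f T"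
  unfolding scaleR_eq_scalar_operator by (rule operator_functionalD(2))

lemma operator_functional_sum:
  assumes vN: "von_neumann_algebra A" and f: "operator_functional A f" 
    and T: "\<And>i. i \<in> I \<Longrightarrow> T i \<in> A"
  shows "f (\<Sum>i\<in>I. T i) = (\<Sum>i\<in>I. f (T i))"
proof -
  have "f 0 = 0"
    using operator_functional_scaleR[OF f vN_zero[OF vN], of 0] by simp
  then show ?thesis
    using T by (induction I rule: infinite_finite_induct)
      (auto simp: operator_functionalD(1)[OF f] vN_sum[OF vN])
qed

lemma operator_functional_combination:
  assumes "finite I" and f: "\<And>i. i \<in> I \<Longrightarrow> operator_functional A (f i)"
  shows "operator_functional A (\<lambda>T. \<Sum>i\<in>I. c i * f i T)"
proof -
  have "\<forall>i\<in>I. \<exists>C\<ge>0. \<forall>T\<in>A. cmod (f i T) \<le> C * norm T"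
    using operator_functionalD(3)[OF f] by blast
  then obtain C where C: "\<And>i. i \<in> I \<Longrightarrow> 0 \<le> C i" "\<And>i T. i \<in> I \<Longrightarrow> T \<in> A \<Longrightarrow> cmod (f i T) \<le> C i * norm T"
    by metis
  have "cmod (\<Sum>i\<in>I. c i * f i T) \<le> (\<Sum>i\<in>I. cmod (c i) * C i) * norm T" if "T \<in> A" for T
    unfolding sum_distrib_right using that C
    by (intro sum_norm_le) (simp add: norm_mult mult.assoc mult_left_mono)
  moreover have "0 \<le> (\<Sum>i\<in>I. cmod (c i) * C i)"
    using C by (intro sum_nonneg) auto
  ultimately have "\<exists>C\<ge>0. \<forall>T\<in>A. cmod (\<Sum>i\<in>I. c i * f i T) \<le> C * norm T"
    by blast
  then show ?thesis
    unfolding operator_functional_def using operator_functionalD(1,2)[OF f]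
    by (auto simp: algebra_simps sum.distrib sum_distrib_left intro!: sum.cong)
qed

lemma predual_norm_bdd_above:
  assumes "operator_functional A f"
  shows "bdd_above ((\<lambda>T. cmod (f T)) ` {T \<in> A. norm T \<le> 1})"
proof -
  obtain C where C: "0 \<le> C" "\<And>T. T \<in> A \<Longrightarrow> cmod (f T) \<le> C * norm T"
    using operator_functionalD(3)[OF assms] by blast
  have "cmod (f T) \<le> C" if "T \<in> A" "norm T \<le> 1" for T
    using C(2)[OF that(1)] mult_left_mono[OF that(2) C(1)] by simp
  then show ?thesis
    by (intro bdd_aboveI2) auto
qed

lemma cmod_le_predual_norm:
  assumes vN: "von_neumann_algebra A" and f: "operator_functional A f"
    and T: "T \<in> A" "norm T \<le> r" and r: "0 < r"
  shows "cmod (f T) \<le> r * predual_norm A f"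
proof -
  have "inverse r *\<^sub>R T \<in> {T \<in> A. norm T \<le> 1}"
    using vN_scaleR[OF vN T(1)] T r by (simp add: field_simps)
  then have "cmod (f (inverse r *\<^sub>R T)) \<le> predual_norm A f"
    unfolding predual_norm_def by (intro cSUP_upper predual_norm_bdd_above[OF f])
  then show ?thesis
    using r by (simp add: operator_functional_scaleR[OF f T(1)] norm_mult norm_divide field_simps)
qed

lemma predual_norm_least:
  assumes vN: "von_neumann_algebra A" and "\<And>T. T \<in> A \<Longrightarrow> norm T \<le> 1 \<Longrightarrow> cmod (f T) \<le> r"
  shows "predual_norm A f \<le> r"
  unfolding predual_norm_def using assms(2) vN_zero[OF vN] by (intro cSUP_least) auto

lemma predual_norm_nonneg:
  assumes vN: "von_neumann_algebra A" and f: "operator_functional A f"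
  shows "0 \<le> predual_norm A f"
  using cmod_le_predual_norm[OF vN f vN_zero[OF vN], of 1] by (simp add: order_trans[OF norm_ge_zero])

text \<open>With z = S y the vector lost is u - y = e^2 S'z, and z + e^2 S S'z = S u. The resolvent
  bound with \<open>S\<close> and \<open>S'\<close> exchanged therefore gives 2 e |S'z| <= |S u|,
  and moving the outer \<open>S\<close> to the other argument produces the factor |S'v|.\<close>

lemma resolvent_remainder:
  assumes adj: "is_adjoint S' S" and e: "0 < e"
    and Y: "y + e\<^sup>2 *\<^sub>R blinfun_apply S' (blinfun_apply S y) = (u :: 'h::complex_hilbert_space)"
  shows "cmod (cinner (blinfun_apply S (u - y)) v) \<le> e / 2 * (norm (blinfun_apply S u) * norm (blinfun_apply S' v))"
proof -
  define z where "z = blinfun_apply S y"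
  have w: "u - y = e\<^sup>2 *\<^sub>R blinfun_apply S' z"
    using Y by (auto simp: z_def)
  have "blinfun_apply S u = z + e\<^sup>2 *\<^sub>R blinfun_apply S (blinfun_apply S' z)"
    by (simp add: Y[symmetric] z_def blinfun.add_right blinfun.scaleR_right)
  then have "2 * e * norm (blinfun_apply S' z) \<le> norm (blinfun_apply S u)"
    using resolvent_norm_bound[OF is_adjoint_sym[OF adj] e, of z] by simp
  then have "e / 2 * (2 * e * norm (blinfun_apply S' z)) \<le> e / 2 * norm (blinfun_apply S u)"
    using e by (intro mult_left_mono) auto
  then have norm_w: "norm (u - y) \<le> e / 2 * norm (blinfun_apply S u)"
    using e by (simp add: w power2_eq_square)
  have "cinner (blinfun_apply S (u - y)) v = cinner (u - y) (blinfun_apply S' v)"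
    using adj by (simp add: is_adjoint_def)
  then have "cmod (cinner (blinfun_apply S (u - y)) v) \<le> norm (u - y) * norm (blinfun_apply S' v)"
    by (simp add: cinner_cauchy_schwarz)
  also have "\<dots> \<le> e / 2 * norm (blinfun_apply S u) * norm (blinfun_apply S' v)"
    by (intro mult_right_mono norm_w) auto
  finally show ?thesis
    by (simp add: mult.assoc)
qed

section \<open>Modulated sums and their cut-off\<close>

definition modulated_sum ::
    "nat \<Rightarrow> nat set \<Rightarrow> ((nat \<Rightarrow> nat) \<Rightarrow> 'h::complex_hilbert_space \<Rightarrow>\<^sub>L 'h) \<Rightarrow> ((nat \<Rightarrow> nat) \<Rightarrow> complex) \<Rightarrow> 'h \<Rightarrow>\<^sub>L 'h" where
  "modulated_sum n K a c = (\<Sum>J\<in>multi_indices n K. scalar_operator (c J) o\<^sub>L a J)"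

lemma modulated_sum_apply:
  "blinfun_apply (modulated_sum n K a c) v = (\<Sum>J\<in>multi_indices n K. c J *\<^sub>C blinfun_apply (a J) v)"
  by (simp add: modulated_sum_def blinfun.sum_left)

lemma is_adjoint_modulated_sum:
  assumes "\<And>J. J \<in> multi_indices n K \<Longrightarrow> is_adjoint (b J) (a J)"
  shows "is_adjoint (modulated_sum n K b c) (modulated_sum n K a (\<lambda>J. cnj (c J)))"
  using assms by (simp add: is_adjoint_def modulated_sum_apply cinner_sum_left cinner_sum_right
      cinner_scaleC_left cinner_scaleC_right)

lemma blinfun_apply_scaleC_sum:
  "T \<in> bounded_operators \<Longrightarrow>
    blinfun_apply T (\<Sum>i\<in>I. c i *\<^sub>C h i) = (\<Sum>i\<in>I. c i *\<^sub>C blinfun_apply T (h i))"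
  by (simp add: blinfun.sum_right bounded_operatorsD)

text \<open>A monomial factors along \<alpha> and its complement, so the modulated sum of the
  tensors of an elementary family is again a single elementary tensor. Both the estimate of the
  remainder and the converse depend on this.\<close>

lemma sum_monomial_tensor:
  assumes T: "T \<in> bounded_operators" and \<alpha>: "\<alpha> \<subseteq> K" and K: "finite K"
  shows "(\<Sum>J\<in>multi_indices n K. monomial K J s *
      cinner (T (h (restrict J \<alpha>))) (g (restrict J (K - \<alpha>) :: nat \<Rightarrow> nat))) =
    cinner (T (\<Sum>r\<in>multi_indices n \<alpha>. monomial \<alpha> r s *\<^sub>C h r))
      (\<Sum>p\<in>multi_indices n (K - \<alpha>). cnj (monomial (K - \<alpha>) p s) *\<^sub>C g p)"
proof -
  let ?F = "\<lambda>r p. monomial \<alpha> r s * monomial (K - \<alpha>) p s * cinner (T (h r)) (g p)"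
  have "(\<Sum>J\<in>multi_indices n K. monomial K J s * cinner (T (h (restrict J \<alpha>))) (g (restrict J (K - \<alpha>))))
      = (\<Sum>J\<in>multi_indices n K. ?F (restrict J \<alpha>) (restrict J (K - \<alpha>)))"
    by (simp only: monomial_split[OF \<alpha> K])
  also have "\<dots> = (\<Sum>r\<in>multi_indices n \<alpha>. \<Sum>p\<in>multi_indices n (K - \<alpha>). ?F r p)"
    by (rule sum_multi_indices_restrict[OF \<alpha> K])
  also have "\<dots> = (\<Sum>p\<in>multi_indices n (K - \<alpha>). \<Sum>r\<in>multi_indices n \<alpha>. ?F r p)"
    by (rule sum.swap)
  also have "\<dots> = cinner (T (\<Sum>r\<in>multi_indices n \<alpha>. monomial \<alpha> r s *\<^sub>C h r))
      (\<Sum>p\<in>multi_indices n (K - \<alpha>). cnj (monomial (K - \<alpha>) p s) *\<^sub>C g p)"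
    by (simp add: blinfun_apply_scaleC_sum[OF T] cinner_sum_left cinner_sum_right
        cinner_scaleC_left cinner_scaleC_right sum_distrib_left mult_ac)
  finally show ?thesis .
qed

text \<open>The operators \<open>G\<close> are the resolvent cut-offs \<open>S (1 + e\<^sup>2 S\<^sup>* S)\<^sup>-\<^sup>1\<close> of \<open>S = \<Sum>\<^sub>J cnj (u\<^sub>J) a\<^sub>J\<close>, with
  \<open>e = 2\<^sup>-\<^sup>k\<close>, and \<open>b\<close> is the part of \<open>a\<close> lost by the cut-off.\<close>

lemma contractive_family_cutoff:
  fixes A :: "('h::complex_hilbert_space \<Rightarrow>\<^sub>L 'h) set"
  assumes vN: "von_neumann_algebra A" and K: "finite K"
    and aA: "\<And>J. J \<in> multi_indices n K \<Longrightarrow> a J \<in> A" and a: "contractive_family n K a"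
  shows "\<exists>G b. (\<forall>u\<in>phase_arrays n K. G u \<in> A \<and> norm (G u) \<le> 2 ^ card K / 2) \<and>
    (\<forall>J\<in>multi_indices n K. b J \<in> A) \<and> contractive_family n K (\<lambda>J. 2 *\<^sub>R b J) \<and>
    (\<forall>J\<in>multi_indices n K. a J = (1 / card (phase_arrays n K)) *\<^sub>R
      (\<Sum>u\<in>phase_arrays n K. scalar_operator (monomial K J u) o\<^sub>L G u) + b J)"
proof -
  let ?W = "phase_arrays n K" and ?I = "multi_indices n K"
  define N where "N = real (card ?W)"
  have N: "0 < N"
    using card_phase_arrays_pos[OF K] by (simp add: N_def)
  define e :: real where "e = 1 / 2 ^ card K"
  have e: "0 < e"
    by (simp add: e_def)
  obtain a' where a': "\<And>J. J \<in> ?I \<Longrightarrow> a' J \<in> A" "\<And>J. J \<in> ?I \<Longrightarrow> is_adjoint (a' J) (a J)"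
    using vN_adjoint[OF vN aA] by metis
  define S where "S u = modulated_sum n K a (\<lambda>J. cnj (monomial K J u))" for u
  define S' where "S' u = modulated_sum n K a' (\<lambda>J. monomial K J u)" for u
  have adj: "is_adjoint (S' u) (S u)" for u
    unfolding S_def S'_def by (rule is_adjoint_modulated_sum) (rule a'(2))
  have SA: "S u \<in> A" "S' u \<in> A" for u
    unfolding S_def S'_def modulated_sum_def
    by (auto intro!: vN_sum[OF vN] vN_compose[OF vN] vN_scalar_operator[OF vN] aA a')
  have "\<exists>Y\<in>A. \<forall>v. Y v + e\<^sup>2 *\<^sub>R (S' u) ((S u) (Y v)) = v" for u
    by (rule vN_resolvent[OF vN SA adj]) simp
  then obtain Y where YA: "\<And>u. Y u \<in> A"
    and Y: "\<And>u v. (Y u) v + e\<^sup>2 *\<^sub>R (S' u) ((S u) ((Y u) v)) = v"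
    by metis
  define G where "G u = S u o\<^sub>L Y u" for u
  define R where "R u = S u - G u" for u
  have GA: "G u \<in> A" for u
    unfolding G_def by (intro vN_compose[OF vN] SA YA)
  have RA: "R u \<in> A" for u
    unfolding R_def by (intro vN_diff[OF vN] SA GA)
  note RB = vN_bounded_operators[OF vN RA]
  define b where "b J = (1 / N) *\<^sub>R (\<Sum>u\<in>?W. scalar_operator (monomial K J u) o\<^sub>L R u)" for J
  have G_norm: "norm (G u) \<le> 2 ^ card K / 2" for u
  proof (rule norm_blinfun_bound)
    fix v
    have "2 * e * norm ((G u) v) \<le> norm v"
      using resolvent_norm_bound[OF adj e, of u "(Y u) v"] by (simp add: Y G_def)
    then show "norm ((G u) v) \<le> 2 ^ card K / 2 * norm v"
      by (simp add: e_def field_simps)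
  qed auto
  have bA: "b J \<in> A" for J
    unfolding b_def by (intro vN_scaleR[OF vN] vN_sum[OF vN] vN_compose[OF vN] vN_scalar_operator[OF vN] RA)
  have decomposition: "a J = (1 / N) *\<^sub>R (\<Sum>u\<in>?W. scalar_operator (monomial K J u) o\<^sub>L G u) + b J" if J: "J \<in> ?I" for J
  proof (rule blinfun_eqI)
    fix v
    \<comment> \<open>Averaging against a monomial extracts the corresponding coefficient of
      \<open>S\<close>, since distinct monomials are orthogonal.\<close>
    have "(\<Sum>u\<in>?W. monomial K J u *\<^sub>C (S u) v)
        = (\<Sum>u\<in>?W. \<Sum>I\<in>?I. (monomial K J u * cnj (monomial K I u)) *\<^sub>C (a I) v)"
      by (simp add: S_def modulated_sum_apply scaleC_sum_right scaleC_scaleC)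
    also have "\<dots> = (\<Sum>I\<in>?I. (\<Sum>u\<in>?W. monomial K J u * cnj (monomial K I u)) *\<^sub>C (a I) v)"
      by (simp add: scaleC_sum_left sum.swap[of _ ?W])
    also have "\<dots> = (\<Sum>I\<in>?I. if J = I then N *\<^sub>R (a I) v else 0)"
      using J K by (intro sum.cong refl) (simp add: sum_phase_arrays_monomial scaleR_scaleC N_def)
    also have "\<dots> = N *\<^sub>R (a J) v"
      using J K by simp
    finally have avg: "(\<Sum>u\<in>?W. monomial K J u *\<^sub>C (S u) v) = N *\<^sub>R (a J) v" .
    have "((1 / N) *\<^sub>R (\<Sum>u\<in>?W. scalar_operator (monomial K J u) o\<^sub>L G u) + b J) v
        = (1 / N) *\<^sub>R (\<Sum>u\<in>?W. monomial K J u *\<^sub>C (S u) v)"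
      by (simp add: b_def R_def blinfun.add_left blinfun.scaleR_left blinfun.sum_left blinfun.diff_left
          scaleR_add_right[symmetric] sum.distrib[symmetric] scaleC_add_right[symmetric])
    then show "(a J) v = ((1 / N) *\<^sub>R (\<Sum>u\<in>?W. scalar_operator (monomial K J u) o\<^sub>L G u) + b J) v"
      using N by (simp add: avg)
  qed
  have "contractive_family n K (\<lambda>J. 2 *\<^sub>R b J)"
    unfolding contractive_family_def
  proof (intro allI impI)
    fix \<gamma> and h g :: "(nat \<Rightarrow> nat) \<Rightarrow> 'h"
    assume \<gamma>: "\<gamma> \<subseteq> K" and h: "square_sum n \<gamma> h \<le> 1" and g: "square_sum n (K - \<gamma>) g \<le> 1"
    define U where "U u = (\<Sum>r\<in>multi_indices n \<gamma>. monomial \<gamma> r u *\<^sub>C h r)" for u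
    define V where "V u = (\<Sum>p\<in>multi_indices n (K - \<gamma>). cnj (monomial (K - \<gamma>) p u) *\<^sub>C g p)" for u
    \<comment> \<open>The pairing with \<open>b\<close> is a mean of forms of the remainders,
      evaluated at the modulated vectors \<open>U u\<close> and \<open>V u\<close>.\<close>
    have "index_pairing n K \<gamma> b h g = (\<Sum>J\<in>?I. \<Sum>u\<in>?W. of_real (1 / N) *
        (monomial K J u * cinner ((R u) (h (restrict J \<gamma>))) (g (restrict J (K - \<gamma>)))))"
      by (simp add: index_pairing_def b_def blinfun.scaleR_left blinfun.sum_left cinner_scaleR_left
          cinner_sum_left cinner_scaleC_left sum_distrib_left)
    also have "\<dots> = of_real (1 / N) * (\<Sum>u\<in>?W. \<Sum>J\<in>?I. monomial K J u *
        cinner ((R u) (h (restrict J \<gamma>))) (g (restrict J (K - \<gamma>))))"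
      by (subst sum.swap) (simp add: sum_distrib_left)
    also have "\<dots> = of_real (1 / N) * (\<Sum>u\<in>?W. cinner ((R u) (U u)) (V u))"
      unfolding U_def V_def by (simp only: sum_monomial_tensor[OF RB \<gamma> K])
    finally have pairing: "index_pairing n K \<gamma> b h g = of_real (1 / N) * (\<Sum>u\<in>?W. cinner ((R u) (U u)) (V u))" .
    define s s' where "s u = norm ((S u) (U u))" and "s' u = norm ((S' u) (V u))" for u
    have "(S u) (U u) = phase_sum n K \<gamma> (\<lambda>J r. (a J) (h r)) u" for u
      using vN_bounded_operators[OF vN aA]
      by (simp add: S_def U_def modulated_sum_apply phase_sum_def blinfun_apply_scaleC_sum scaleC_sum_right scaleC_scaleC)
    then have "(\<Sum>u\<in>?W. (s u)\<^sup>2) \<le> N * 4 ^ card \<gamma> * square_sum n \<gamma> h"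
      using phase_sum_contractive_family[OF a K \<gamma>, of h] by (simp add: s_def N_def)
    also have "\<dots> \<le> N * 4 ^ card \<gamma>"
      using h N by (simp add: mult_left_le)
    finally have s_le: "(\<Sum>u\<in>?W. (s u)\<^sup>2) \<le> N * 4 ^ card \<gamma>" .
    \<comment> \<open>Here the operators carry the monomials and the vectors their conjugates, the
      reverse of the convention in \<open>phase_sum\<close>. Conjugating the array restores it, and
      the sum over all arrays does not change.\<close>
    have "(S' u) (V u) = phase_sum n K (K - \<gamma>) (\<lambda>J r. (a' J) (g r)) (cnj_array n K u)" for u
      using vN_bounded_operators[OF vN a'(1)]
      by (simp add: S'_def V_def modulated_sum_apply phase_sum_def blinfun_apply_scaleC_sum scaleC_sum_right
          scaleC_scaleC monomial_cnj_array)
    then have "(\<Sum>u\<in>?W. (s' u)\<^sup>2) = (\<Sum>u\<in>?W. (norm (phase_sum n K (K - \<gamma>) (\<lambda>J r. (a' J) (g r)) u))\<^sup>2)"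
      unfolding s'_def by (simp add: sum_phase_arrays_cnj[of "\<lambda>u. (norm (phase_sum n K (K - \<gamma>) _ u))\<^sup>2"])
    also have "\<dots> \<le> N * 4 ^ card (K - \<gamma>) * square_sum n (K - \<gamma>) g"
      unfolding N_def by (intro phase_sum_contractive_family contractive_family_adjoint[OF a] a'(2) K) auto
    also have "\<dots> \<le> N * 4 ^ card (K - \<gamma>)"
      using g N by (simp add: mult_left_le)
    finally have s'_le: "(\<Sum>u\<in>?W. (s' u)\<^sup>2) \<le> N * 4 ^ card (K - \<gamma>)" .
    \<comment> \<open>The two exponents add up to \<open>card K\<close>, which makes the bound the
      same for every \<gamma>.\<close>
    have "(\<Sum>u\<in>?W. s u * s' u)\<^sup>2 \<le> (\<Sum>u\<in>?W. (s u)\<^sup>2) * (\<Sum>u\<in>?W. (s' u)\<^sup>2)"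
      by (rule Cauchy_Schwarz_ineq_sum)
    also have "\<dots> \<le> (N * 4 ^ card \<gamma>) * (N * 4 ^ card (K - \<gamma>))"
      using N by (intro mult_mono s_le s'_le sum_nonneg) auto
    also have "\<dots> = N\<^sup>2 * 4 ^ (card \<gamma> + card (K - \<gamma>))"
      by (simp add: power_add power2_eq_square)
    also have "card \<gamma> + card (K - \<gamma>) = card K"
      using \<gamma> K by (simp add: card_Diff_subset finite_subset card_mono)
    also have "N\<^sup>2 * 4 ^ card K = (N * 2 ^ card K)\<^sup>2"
      using power_mult_distrib[of "2::real" 2 "card K"] by (simp add: power_mult_distrib power2_eq_square)
    finally have ss'_le: "(\<Sum>u\<in>?W. s u * s' u) \<le> N * 2 ^ card K"
      by (rule power2_le_imp_le) (use N in auto)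
    have "cmod (\<Sum>u\<in>?W. cinner ((R u) (U u)) (V u)) \<le> (\<Sum>u\<in>?W. e / 2 * (s u * s' u))"
    proof (rule sum_norm_le)
      fix u
      have "(R u) (U u) = (S u) (U u - (Y u) (U u))"
        by (simp add: R_def G_def blinfun.diff_left blinfun.diff_right)
      then show "cmod (cinner ((R u) (U u)) (V u)) \<le> e / 2 * (s u * s' u)"
        unfolding s_def s'_def using resolvent_remainder[OF adj e Y] by simp
    qed
    also have "\<dots> \<le> e / 2 * (N * 2 ^ card K)"
      unfolding sum_distrib_left[symmetric] using e by (intro mult_left_mono ss'_le) auto
    also have "\<dots> = N / 2"
      by (simp add: e_def)
    finally have "cmod (index_pairing n K \<gamma> b h g) \<le> 1 / 2"
      unfolding pairing using N by (simp add: norm_mult norm_divide field_simps)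
    moreover have "index_pairing n K \<gamma> (\<lambda>J. 2 *\<^sub>R b J) h g = 2 * index_pairing n K \<gamma> b h g"
      by (simp add: index_pairing_def blinfun.scaleR_left cinner_scaleR_left sum_distrib_left)
    ultimately show "cmod (index_pairing n K \<gamma> (\<lambda>J. 2 *\<^sub>R b J) h g) \<le> 1"
      by (simp add: norm_mult)
  qed
  then show ?thesis
    using GA G_norm bA decomposition unfolding N_def by (intro exI[of _ G] exI[of _ b]) simp
qed

text \<open>A self-improving estimate: twice the part lost by the cut-off is again an admissible
  family, so the supremum \<open>M\<close> satisfies
  \<open>M \<le> 2 ^ card K / 2 * L + M / 2\<close>. The mean \<open>L\<close> is taken over the
  finite group, and no integral occurs yet.\<close>

theorem contractive_family_pairing_le:
  fixes A :: "('h::complex_hilbert_space \<Rightarrow>\<^sub>L 'h) set"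
  assumes vN: "von_neumann_algebra A" and K: "finite K"
    and x: "\<And>J. J \<in> multi_indices n K \<Longrightarrow> operator_functional A (x J)"
    and aA: "\<And>J. J \<in> multi_indices n K \<Longrightarrow> a J \<in> A" and a: "contractive_family n K a"
  shows "cmod (\<Sum>J\<in>multi_indices n K. x J (a J)) \<le> 2 ^ card K / card (phase_arrays n K) *
    (\<Sum>u\<in>phase_arrays n K. predual_norm A (\<lambda>T. \<Sum>J\<in>multi_indices n K. monomial K J u * x J T))"
proof -
  let ?W = "phase_arrays n K" and ?I = "multi_indices n K"
  define N where "N = real (card ?W)"
  have N: "0 < N"
    using card_phase_arrays_pos[OF K] by (simp add: N_def)
  define \<phi> where "\<phi> u = (\<lambda>T. \<Sum>J\<in>?I. monomial K J u * x J T)" for u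
  have \<phi>: "operator_functional A (\<phi> u)" for u
    unfolding \<phi>_def using K x by (intro operator_functional_combination) auto
  define L where "L = (\<Sum>u\<in>?W. predual_norm A (\<phi> u)) / N"
  define C where "C = {a. (\<forall>J\<in>?I. a J \<in> A) \<and> contractive_family n K a}"
  define P where "P a = cmod (\<Sum>J\<in>?I. x J (a J))" for a
  have "\<forall>J\<in>?I. \<exists>B\<ge>0. \<forall>T\<in>A. cmod (x J T) \<le> B * norm T"
    using operator_functionalD(3)[OF x] by blast
  then obtain B where B: "\<And>J. J \<in> ?I \<Longrightarrow> 0 \<le> B J" "\<And>J T. J \<in> ?I \<Longrightarrow> T \<in> A \<Longrightarrow> cmod (x J T) \<le> B J * norm T"
    by metis
  have "cmod (x J (a J)) \<le> B J" if "a \<in> C" and J: "J \<in> ?I" for a J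
  proof -
    have "a J \<in> A" "norm (a J) \<le> 1"
      using that K by (auto simp: C_def contractive_family_norm_le)
    then show ?thesis
      using B(2)[OF J, of "a J"] mult_left_mono[of "norm (a J)" 1 "B J"] B(1)[OF J] by auto
  qed
  then have "P a \<le> (\<Sum>J\<in>?I. B J)" if "a \<in> C" for a
    unfolding P_def using that by (simp add: sum_norm_le)
  then have bdd: "bdd_above (P ` C)"
    by (rule bdd_aboveI2)
  define M where "M = (SUP a\<in>C. P a)"
  have P_le_M: "P a \<le> M" if "a \<in> C" for a
    unfolding M_def by (intro cSUP_upper bdd that)
  have step: "P a \<le> 2 ^ card K / 2 * L + M / 2" if aC: "a \<in> C" for a
  proof -
    have aA: "\<And>J. J \<in> ?I \<Longrightarrow> a J \<in> A" and a: "contractive_family n K a"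
      using aC by (auto simp: C_def)
    obtain G b where G: "\<And>u. u \<in> ?W \<Longrightarrow> G u \<in> A" "\<And>u. u \<in> ?W \<Longrightarrow> norm (G u) \<le> 2 ^ card K / 2"
      and b: "\<And>J. J \<in> ?I \<Longrightarrow> b J \<in> A" "contractive_family n K (\<lambda>J. 2 *\<^sub>R b J)"
      and ab: "\<And>J. J \<in> ?I \<Longrightarrow> a J = (1 / N) *\<^sub>R (\<Sum>u\<in>?W. scalar_operator (monomial K J u) o\<^sub>L G u) + b J"
      using contractive_family_cutoff[OF vN K aA a] unfolding N_def by blast
    have scG: "scalar_operator c o\<^sub>L G u \<in> A" if "u \<in> ?W" for c u
      using that by (intro vN_compose[OF vN] vN_scalar_operator[OF vN] G)
    have "x J (a J) = (1 / N) * (\<Sum>u\<in>?W. monomial K J u * x J (G u)) + x J (b J)" if J: "J \<in> ?I" for J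
    proof -
      have "x J (a J) = x J ((1 / N) *\<^sub>R (\<Sum>u\<in>?W. scalar_operator (monomial K J u) o\<^sub>L G u)) + x J (b J)"
        unfolding ab[OF J] using J scG
        by (intro operator_functionalD(1)[OF x] vN_scaleR[OF vN] vN_sum[OF vN] b) auto
      also have "x J ((1 / N) *\<^sub>R (\<Sum>u\<in>?W. scalar_operator (monomial K J u) o\<^sub>L G u))
          = of_real (1 / N) * (\<Sum>u\<in>?W. x J (scalar_operator (monomial K J u) o\<^sub>L G u))"
        using J scG by (simp add: operator_functional_scaleR[OF x] vN_sum[OF vN] operator_functional_sum[OF vN x])
      also have "(\<Sum>u\<in>?W. x J (scalar_operator (monomial K J u) o\<^sub>L G u)) = (\<Sum>u\<in>?W. monomial K J u * x J (G u))"
        using J G by (intro sum.cong refl operator_functionalD(2)[OF x]) auto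
      finally show ?thesis
        by simp
    qed
    then have "(\<Sum>J\<in>?I. x J (a J)) = (\<Sum>J\<in>?I. (1 / N) * (\<Sum>u\<in>?W. monomial K J u * x J (G u))) + (\<Sum>J\<in>?I. x J (b J))"
      by (simp add: sum.distrib)
    \<comment> \<open>Exchanging the sums moves the monomials from the operators to the functionals,
      so that for each u the one operator \<open>G u\<close> is paired with the modulated
      functional.\<close>
    also have "(\<Sum>J\<in>?I. (1 / N) * (\<Sum>u\<in>?W. monomial K J u * x J (G u))) = (1 / N) * (\<Sum>u\<in>?W. \<phi> u (G u))"
      unfolding \<phi>_def by (subst sum.swap) (simp add: sum_distrib_left)
    finally have "P a \<le> cmod ((1 / N) * (\<Sum>u\<in>?W. \<phi> u (G u))) + P b"
      unfolding P_def by (simp add: norm_triangle_ineq)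
    moreover have "cmod ((1 / N) * (\<Sum>u\<in>?W. \<phi> u (G u))) \<le> 2 ^ card K / 2 * L"
    proof -
      have "cmod (\<Sum>u\<in>?W. \<phi> u (G u)) \<le> (\<Sum>u\<in>?W. 2 ^ card K / 2 * predual_norm A (\<phi> u))"
        by (intro sum_norm_le cmod_le_predual_norm[OF vN \<phi>] G) auto
      also have "\<dots> = N * (2 ^ card K / 2 * L)"
        unfolding sum_distrib_left[symmetric] using N by (simp add: L_def)
      finally show ?thesis
        using N by (simp add: norm_mult norm_divide divide_le_eq mult.commute)
    qed
    moreover have "P b = P (\<lambda>J. 2 *\<^sub>R b J) / 2"
    proof -
      have "(\<Sum>J\<in>?I. x J (2 *\<^sub>R b J)) = 2 * (\<Sum>J\<in>?I. x J (b J))"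
        by (simp add: operator_functional_scaleR[OF x] b(1) sum_distrib_left)
      then show ?thesis
        by (simp add: P_def norm_mult)
    qed
    moreover have "P (\<lambda>J. 2 *\<^sub>R b J) \<le> M"
      using b vN_scaleR[OF vN] by (intro P_le_M) (simp add: C_def)
    ultimately show ?thesis
      by linarith
  qed
  have "a \<in> C"
    using aA a by (simp add: C_def)
  then have "M \<le> 2 ^ card K / 2 * L + M / 2"
    unfolding M_def[of] by (intro cSUP_least step[unfolded M_def]) auto
  then have "P a \<le> 2 ^ card K * L"
    using P_le_M[OF \<open>a \<in> C\<close>] by simp
  then show ?thesis
    by (simp add: P_def L_def N_def \<phi>_def)
qed

section \<open>Haar measure on the circle\<close>

text \<open>The preimage of a cylinder under a componentwise map is a cylinder, and cylinders
  determine a product measure. This is used at two levels: for the circles that make up \<Omega>,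
  and for the k copies of \<Omega>.\<close>

lemma distr_PiM_componentwise:
  assumes M: "\<And>i. prob_space (M i)" and f: "\<And>i. i \<in> I \<Longrightarrow> f i \<in> measurable (M i) (M i)"
    and inv: "\<And>i. i \<in> I \<Longrightarrow> distr (M i) (M i) (f i) = M i"
  shows "(\<lambda>x. \<lambda>i\<in>I. f i (x i)) \<in> measurable (PiM I M) (PiM I M)"
    and "distr (PiM I M) (PiM I M) (\<lambda>x. \<lambda>i\<in>I. f i (x i)) = PiM I M"
proof -
  interpret product_prob_space M I
    by (rule product_prob_spaceI) (rule M)
  show meas: "(\<lambda>x. \<lambda>i\<in>I. f i (x i)) \<in> measurable (PiM I M) (PiM I M)"
    by (intro measurable_restrict measurable_compose[OF measurable_component_singleton]) (auto intro: f)
  show "distr (PiM I M) (PiM I M) (\<lambda>x. \<lambda>i\<in>I. f i (x i)) = PiM I M"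
  proof (rule PiM_eq)
    fix J F assume J: "finite J" "J \<subseteq> I" and F: "\<And>j. j \<in> J \<Longrightarrow> F j \<in> sets (M j)"
    have F': "f j -` F j \<inter> space (M j) \<in> sets (M j)" if "j \<in> J" for j
      using that J F f by (intro measurable_sets) auto
    have "(\<lambda>x. \<lambda>i\<in>I. f i (x i)) -` prod_emb I M J (\<Pi>\<^sub>E j\<in>J. F j) \<inter> space (PiM I M)
        = prod_emb I M J (\<Pi>\<^sub>E j\<in>J. f j -` F j \<inter> space (M j))"
      using J measurable_space[OF f] by (fastforce simp: prod_emb_def space_PiM PiE_iff)
    then have "emeasure (distr (PiM I M) (PiM I M) (\<lambda>x. \<lambda>i\<in>I. f i (x i))) (prod_emb I M J (\<Pi>\<^sub>E j\<in>J. F j))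
        = emeasure (PiM I M) (prod_emb I M J (\<Pi>\<^sub>E j\<in>J. f j -` F j \<inter> space (M j)))"
      using J F by (subst emeasure_distr[OF meas]) (auto intro!: sets_PiM_I)
    also have "\<dots> = (\<Prod>j\<in>J. emeasure (M j) (f j -` F j \<inter> space (M j)))"
      using J F' by (intro emeasure_PiM_emb) auto
    also have "\<dots> = (\<Prod>j\<in>J. emeasure (distr (M j) (M j) (f j)) (F j))"
      using J F f by (intro prod.cong refl) (auto simp: emeasure_distr)
    also have "\<dots> = (\<Prod>j\<in>J. emeasure (M j) (F j))"
      using J inv by (intro prod.cong refl) auto
    finally show "emeasure (distr (PiM I M) (PiM I M) (\<lambda>x. \<lambda>i\<in>I. f i (x i))) (prod_emb I M J (\<Pi>\<^sub>E j\<in>J. F j))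
        = (\<Prod>j\<in>J. emeasure (M j) (F j))" .
  qed simp
qed

lemma cis_measurable_circle: "cis \<in> measurable lborel (restrict_space borel (sphere 0 1))"
proof (rule measurable_restrict_space2)
  have "continuous_on UNIV cis"
    by (intro continuous_intros)
  then show "cis \<in> borel_measurable lborel"
    by (simp add: borel_measurable_continuous_onI)
qed auto

lemma cis_measurable_circle_uniform:
  "cis \<in> measurable (uniform_measure lborel {0..2 * pi}) (restrict_space borel (sphere 0 1))"
  using cis_measurable_circle by (simp cong: measurable_cong_sets)

lemma sets_circle_measure [simp]: "sets circle_measure = sets (restrict_space borel (sphere 0 1))"
  by (simp add: circle_measure_def)

lemma space_circle_measure [simp]: "space circle_measure = sphere 0 1"
  by (simp add: circle_measure_def space_restrict_space)

lemma prob_space_circle_measure: "prob_space circle_measure"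
proof -
  have "prob_space (uniform_measure lborel {0..2 * pi})"
    by (intro prob_space_uniform_measure) auto
  then show ?thesis
    unfolding circle_measure_def using cis_measurable_circle_uniform by (rule prob_space.prob_space_distr)
qed

text \<open>The shifted interval is cut at \<open>p\<close>, and the piece beyond \<open>p\<close>
  is moved back by one period.\<close>

lemma nn_integral_periodic_shift:
  assumes f: "f \<in> borel_measurable borel" and per: "\<And>\<theta>. f (\<theta> + p) = f \<theta>" and a: "0 \<le> a" "a \<le> p"
  shows "(\<integral>\<^sup>+\<theta>. f (\<theta> + a) * indicator {0..p} \<theta> \<partial>lborel) = (\<integral>\<^sup>+\<theta>. f \<theta> * indicator {0..p::real} \<theta> \<partial>lborel)"
proof -
  have shift: "(\<integral>\<^sup>+\<theta>. g (\<theta> + t) \<partial>lborel) = (\<integral>\<^sup>+\<theta>. g \<theta> \<partial>lborel)" if "g \<in> borel_measurable borel"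
    for g :: "real \<Rightarrow> ennreal" and t
    using nn_integral_real_affine[OF that, of 1 t] by (simp add: add.commute)
  note [measurable] = f
  have "(\<integral>\<^sup>+\<theta>. f (\<theta> + a) * indicator {0..p} \<theta> \<partial>lborel) = (\<integral>\<^sup>+\<theta>. f (\<theta> + a) * indicator {a..p + a} (\<theta> + a) \<partial>lborel)"
    by (intro nn_integral_cong) (auto simp: indicator_def)
  also have "\<dots> = (\<integral>\<^sup>+\<theta>. f \<theta> * indicator {a..p + a} \<theta> \<partial>lborel)"
    by (rule shift[of "\<lambda>\<theta>. f \<theta> * indicator {a..p + a} \<theta>"]) measurable
  also have "\<dots> = (\<integral>\<^sup>+\<theta>. f \<theta> * indicator {a..p} \<theta> + f \<theta> * indicator {p<..p + a} \<theta> \<partial>lborel)"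
    using a by (intro nn_integral_cong) (auto simp: indicator_def)
  also have "\<dots> = (\<integral>\<^sup>+\<theta>. f \<theta> * indicator {a..p} \<theta> \<partial>lborel) + (\<integral>\<^sup>+\<theta>. f \<theta> * indicator {p<..p + a} \<theta> \<partial>lborel)"
    by (intro nn_integral_add) measurable
  also have "(\<integral>\<^sup>+\<theta>. f \<theta> * indicator {p<..p + a} \<theta> \<partial>lborel) = (\<integral>\<^sup>+\<theta>. f (\<theta> + p) * indicator {p<..p + a} (\<theta> + p) \<partial>lborel)"
    by (rule shift[of "\<lambda>\<theta>. f \<theta> * indicator {p<..p + a} \<theta>", symmetric]) measurable
  also have "\<dots> = (\<integral>\<^sup>+\<theta>. f \<theta> * indicator {0<..a} \<theta> \<partial>lborel)"
    by (intro nn_integral_cong) (auto simp: indicator_def per)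
  also have "(\<integral>\<^sup>+\<theta>. f \<theta> * indicator {a..p} \<theta> \<partial>lborel) + \<dots> = (\<integral>\<^sup>+\<theta>. f \<theta> * indicator {a..p} \<theta> + f \<theta> * indicator {0<..a} \<theta> \<partial>lborel)"
    by (intro nn_integral_add[symmetric]) measurable
  \<comment> \<open>The two pieces may overlap at \<open>a\<close> and miss 0, which are null
    sets.\<close>
  also have "\<dots> = (\<integral>\<^sup>+\<theta>. f \<theta> * indicator {0..p} \<theta> \<partial>lborel)"
    using a by (intro nn_integral_cong_AE eventually_mono[OF eventually_conj[OF AE_lborel_singleton[of a] AE_lborel_singleton[of 0]]])
      (auto simp: indicator_def)
  finally show ?thesis .
qed

lemma rotation_measurable:
  assumes "cmod c = 1"
  shows "(\<lambda>z. c * z) \<in> measurable circle_measure circle_measure"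
proof -
  have "(\<lambda>z. c * z) \<in> measurable (restrict_space borel (sphere 0 1)) (restrict_space borel (sphere 0 1))"
    using assms by (intro measurable_restrict_space3) (auto simp: norm_mult)
  then show ?thesis
    by (simp cong: measurable_cong_sets)
qed

text \<open>In terms of the angle, a rotation is a translation, and the indicator of a set of points
  on the circle is a function of period 2 pi.\<close>

lemma circle_measure_rotation:
  assumes c: "cmod c = 1"
  shows "distr circle_measure circle_measure (\<lambda>z. c * z) = circle_measure"
proof (rule measure_eqI)
  let ?U = "uniform_measure lborel {0..2 * pi}" and ?S = "restrict_space borel (sphere 0 (1::real)) :: complex measure"
  have "c \<noteq> 0"
    using c by auto
  then obtain a where a: "0 \<le> a" "a \<le> 2 * pi" "c = cis a"
    using complex_unimodular_polar[OF c] by (metis cis.ctr less_imp_le)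
  fix B assume "B \<in> sets (distr circle_measure circle_measure (\<lambda>z. c * z))"
  then have B: "B \<in> sets ?S"
    by simp
  have emeasure_circle: "emeasure circle_measure C = (\<integral>\<^sup>+\<theta>. indicator C (cis \<theta>) * indicator {0..2 * pi} \<theta> \<partial>lborel) / ennreal (2 * pi)"
    if C: "C \<in> sets ?S" for C
  proof -
    have "emeasure circle_measure C = emeasure ?U (cis -` C)"
      using C cis_measurable_circle_uniform by (simp add: circle_measure_def emeasure_distr)
    also have "\<dots> = emeasure lborel ({0..2 * pi} \<inter> cis -` C) / ennreal (2 * pi)"
      using measurable_sets[OF cis_measurable_circle C] by (subst emeasure_uniform_measure) auto
    also have "emeasure lborel ({0..2 * pi} \<inter> cis -` C) = (\<integral>\<^sup>+\<theta>. indicator ({0..2 * pi} \<inter> cis -` C) \<theta> \<partial>lborel)"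
      using measurable_sets[OF cis_measurable_circle C] by (intro nn_integral_indicator[symmetric]) auto
    also have "\<dots> = (\<integral>\<^sup>+\<theta>. indicator C (cis \<theta>) * indicator {0..2 * pi} \<theta> \<partial>lborel)"
      by (intro nn_integral_cong) (auto simp: indicator_def)
    finally show ?thesis .
  qed
  let ?B = "(\<lambda>z. c * z) -` B \<inter> sphere 0 1"
  have B': "?B \<in> sets ?S"
    using measurable_sets[OF rotation_measurable[OF c], of B] B by simp
  have ind: "(\<lambda>\<theta>. indicator B (cis \<theta>) :: ennreal) \<in> borel_measurable borel"
    using measurable_compose[OF cis_measurable_circle, of "indicator B" borel] B by simp
  have "emeasure (distr circle_measure circle_measure (\<lambda>z. c * z)) B = emeasure circle_measure ?B"
    using B by (simp add: emeasure_distr[OF rotation_measurable[OF c]])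
  also have "\<dots> = (\<integral>\<^sup>+\<theta>. indicator ?B (cis \<theta>) * indicator {0..2 * pi} \<theta> \<partial>lborel) / ennreal (2 * pi)"
    by (rule emeasure_circle[OF B'])
  also have "(\<integral>\<^sup>+\<theta>. indicator ?B (cis \<theta>) * indicator {0..2 * pi} \<theta> \<partial>lborel)
      = (\<integral>\<^sup>+\<theta>. indicator B (cis (\<theta> + a)) * indicator {0..2 * pi} \<theta> \<partial>lborel)"
    by (intro nn_integral_cong) (auto simp: indicator_def a(3) cis_mult add.commute)
  also have "\<dots> = (\<integral>\<^sup>+\<theta>. indicator B (cis \<theta>) * indicator {0..2 * pi} \<theta> \<partial>lborel)"
    by (rule nn_integral_periodic_shift[OF ind _ a(1,2)]) (simp add: cis_mult[symmetric])
  also have "\<dots> / ennreal (2 * pi) = emeasure circle_measure B"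
    by (rule emeasure_circle[OF B, symmetric])
  finally show "emeasure (distr circle_measure circle_measure (\<lambda>z. c * z)) B = emeasure circle_measure B" .
qed simp

section \<open>Elementary tensors and duality\<close>

lemma cmod_tensor_le:
  "cmod (cinner (blinfun_apply T h) (g :: 'h::complex_hilbert_space)) \<le> norm T * (norm h * norm g)"
proof -
  have "cmod (cinner (blinfun_apply T h) g) \<le> norm (blinfun_apply T h) * norm g"
    by (rule cinner_cauchy_schwarz)
  also have "\<dots> \<le> (norm T * norm h) * norm g"
    by (intro mult_right_mono norm_blinfun) auto
  finally show ?thesis
    by (simp add: mult.assoc)
qed

lemma predualE:
  assumes vN: "von_neumann_algebra A" and f: "f \<in> predual A"
  obtains h g where "summable (\<lambda>m. norm (h m) * norm (g m))"
    and "\<And>T. T \<in> A \<Longrightarrow> (\<lambda>m. cinner (T (h m)) (g m)) sums f T"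
    and "\<And>T. T \<notin> A \<Longrightarrow> f T = 0"
proof -
  obtain h g where hg: "summable (\<lambda>m. norm (h m) * norm (g m))"
    and f_eq: "f = predual_quotient_map A (\<lambda>T. \<Sum>m. tensor_functional (h m) (g m) T)"
    using f by (auto simp: predual_def predual_BH_def)
  have "(\<lambda>m. cinner (T (h m)) (g m)) sums f T" if T: "T \<in> A" for T
  proof -
    have "summable (\<lambda>m. cinner (T (h m)) (g m))"
      by (rule summable_comparison_test'[OF summable_mult[OF hg, of "norm T"]]) (rule cmod_tensor_le)
    then show ?thesis
      using T vN_bounded_operators[OF vN T]
      by (simp add: f_eq predual_quotient_map_def tensor_functional_def summable_sums)
  qed
  then show thesis
    using that[of h g] hg by (simp add: f_eq predual_quotient_map_def)
qed

lemma predual_operator_functional: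
  assumes vN: "von_neumann_algebra A" and f: "f \<in> predual A"
  shows "operator_functional A f"
proof -
  obtain h g where hg: "summable (\<lambda>m. norm (h m) * norm (g m))"
    and sums: "\<And>T. T \<in> A \<Longrightarrow> (\<lambda>m. cinner (T (h m)) (g m)) sums f T"
    using predualE[OF vN f] by metis
  have "f (S + T) = f S + f T" if "S \<in> A" "T \<in> A" for S T
  proof (rule sums_unique2)
    show "(\<lambda>m. cinner ((S + T) (h m)) (g m)) sums f (S + T)"
      using that by (intro sums vN_add[OF vN])
    show "(\<lambda>m. cinner ((S + T) (h m)) (g m)) sums (f S + f T)"
      using sums_add[OF sums[OF that(1)] sums[OF that(2)]] by (simp add: blinfun.add_left cinner_add_left)
  qed
  moreover have "f (scalar_operator c o\<^sub>L T) = c * f T" if "T \<in> A" for c T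
  proof (rule sums_unique2)
    show "(\<lambda>m. cinner ((scalar_operator c o\<^sub>L T) (h m)) (g m)) sums f (scalar_operator c o\<^sub>L T)"
      using that by (intro sums vN_compose[OF vN] vN_scalar_operator[OF vN])
    show "(\<lambda>m. cinner ((scalar_operator c o\<^sub>L T) (h m)) (g m)) sums (c * f T)"
      using sums_mult[OF sums[OF that], of c] by (simp add: cinner_scaleC_left)
  qed
  moreover have "cmod (f T) \<le> (\<Sum>m. norm (h m) * norm (g m)) * norm T" if T: "T \<in> A" for T
  proof -
    have "cmod (f T) \<le> (\<Sum>m. norm T * (norm (h m) * norm (g m)))"
      unfolding sums_unique[OF sums[OF T]]
      by (rule norm_suminf_le[OF _ summable_mult[OF hg]]) (rule cmod_tensor_le)
    also have "\<dots> = (\<Sum>m. norm (h m) * norm (g m)) * norm T"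
      by (simp only: suminf_mult[OF hg] mult.commute[of _ "norm T"])
    finally show ?thesis .
  qed
  moreover have "0 \<le> (\<Sum>m. norm (h m) * norm (g m))"
    using hg by (intro suminf_nonneg) auto
  ultimately show ?thesis
    unfolding operator_functional_def by blast
qed

lemma sum_fun_apply: "(\<Sum>j\<in>J. F j) p = (\<Sum>j\<in>J. F j p)"
  by (induction J rule: infinite_finite_induct) auto

text \<open>A family of functionals is encoded as one scalar function on pairs (J, T), zero unless J
  is an index of the family and T lies in \<open>A\<close>. In this form the theory of atomic norms,
  with its pointwise convergence, applies to whole families at once.\<close>

definition elementary_family ::
    "('h::complex_hilbert_space \<Rightarrow>\<^sub>L 'h) set \<Rightarrow> nat \<Rightarrow> nat set \<Rightarrow> nat set \<Rightarrow> ((nat \<Rightarrow> nat) \<Rightarrow> 'h) \<Rightarrow>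
      ((nat \<Rightarrow> nat) \<Rightarrow> 'h) \<Rightarrow> (nat \<Rightarrow> nat) \<times> ('h \<Rightarrow>\<^sub>L 'h) \<Rightarrow> complex" where
  "elementary_family A n K \<gamma> h g = (\<lambda>(J, T). if J \<in> multi_indices n K \<and> T \<in> A
     then cinner (T (h (restrict J \<gamma>))) (g (restrict J (K - \<gamma>))) else 0)"

definition elementary_atoms ::
    "('h::complex_hilbert_space \<Rightarrow>\<^sub>L 'h) set \<Rightarrow> nat \<Rightarrow> nat set \<Rightarrow> ((nat \<Rightarrow> nat) \<times> ('h \<Rightarrow>\<^sub>L 'h) \<Rightarrow> complex) set" where
  "elementary_atoms A n K = {elementary_family A n K \<gamma> h g | \<gamma> h g.
     \<gamma> \<subseteq> K \<and> square_sum n \<gamma> h \<le> 1 \<and> square_sum n (K - \<gamma>) g \<le> 1}"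

definition family_function ::
    "('h::complex_hilbert_space \<Rightarrow>\<^sub>L 'h) set \<Rightarrow> nat \<Rightarrow> nat set \<Rightarrow> ((nat \<Rightarrow> nat) \<Rightarrow> ('h \<Rightarrow>\<^sub>L 'h) \<Rightarrow> complex) \<Rightarrow>
      (nat \<Rightarrow> nat) \<times> ('h \<Rightarrow>\<^sub>L 'h) \<Rightarrow> complex" where
  "family_function A n K x = (\<lambda>(J, T). if J \<in> multi_indices n K \<and> T \<in> A then x J T else 0)"

definition single_tensor ::
    "('h::complex_hilbert_space \<Rightarrow>\<^sub>L 'h) set \<Rightarrow> (nat \<Rightarrow> nat) \<Rightarrow> 'h \<Rightarrow> 'h \<Rightarrow> (nat \<Rightarrow> nat) \<times> ('h \<Rightarrow>\<^sub>L 'h) \<Rightarrow> complex" where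
  "single_tensor A J h g = (\<lambda>(I, T). if I = J \<and> T \<in> A then cinner (T h) g else 0)"

lemma norm_le_1_of_square_sum:
  assumes "square_sum n C h \<le> 1" and "finite C" and "i \<in> multi_indices n C"
  shows "norm (h i) \<le> 1"
proof -
  have "(norm (h i))\<^sup>2 \<le> square_sum n C h"
    unfolding square_sum_def using assms by (intro member_le_sum) auto
  then have "(norm (h i))\<^sup>2 \<le> 1\<^sup>2"
    using assms(1) by simp
  then show ?thesis
    by (rule power2_le_imp_le) simp
qed

lemma elementary_atoms_bound:
  assumes K: "finite K" and a: "a \<in> elementary_atoms A n K"
  shows "cmod (a p) \<le> norm (snd p)"
proof -
  obtain \<gamma> h g where a_eq: "a = elementary_family A n K \<gamma> h g" and \<gamma>: "\<gamma> \<subseteq> K"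
    and hg: "square_sum n \<gamma> h \<le> 1" "square_sum n (K - \<gamma>) g \<le> 1"
    using a by (auto simp: elementary_atoms_def)
  obtain J T where p: "p = (J, T)"
    by (cases p)
  show ?thesis
  proof (cases "J \<in> multi_indices n K \<and> T \<in> A")
    case True
    have "norm (h (restrict J \<gamma>)) \<le> 1" "norm (g (restrict J (K - \<gamma>))) \<le> 1"
      using True K \<gamma> by (auto intro!: norm_le_1_of_square_sum[OF hg(1)] norm_le_1_of_square_sum[OF hg(2)]
          restrict_in_multi_indices finite_subset[OF \<gamma>])
    then have "norm (h (restrict J \<gamma>)) * norm (g (restrict J (K - \<gamma>))) \<le> 1"
      by (simp add: mult_le_one)
    then have "norm T * (norm (h (restrict J \<gamma>)) * norm (g (restrict J (K - \<gamma>)))) \<le> norm T"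
      by (simp add: mult_left_le)
    then show ?thesis
      using True order_trans[OF cmod_tensor_le] by (simp add: a_eq p elementary_family_def)
  next
    case False
    then show ?thesis
      by (auto simp: a_eq p elementary_family_def)
  qed
qed

text \<open>For \<gamma> = K the second index set is a single point, so a tensor at one index
  \<open>J\<close> is an elementary family. Normalising by \<open>sgn\<close> also covers zero
  vectors, for which the coefficient vanishes.\<close>

lemma single_tensor_eq_atom:
  assumes K: "finite K" and J: "J \<in> multi_indices n K"
  obtains a where "a \<in> elementary_atoms A n K"
    and "single_tensor A J h g = (\<lambda>p. complex_of_real (norm h * norm g) * a p)"
proof
  let ?h = "\<lambda>i. if i = J then sgn h else 0" and ?g = "\<lambda>_::nat \<Rightarrow> nat. sgn g"
  let ?a = "elementary_family A n K K ?h ?g"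
  have sgn: "(norm (sgn v))\<^sup>2 \<le> 1" for v :: 'a
    by (simp add: norm_sgn)
  have "square_sum n K ?h = (\<Sum>i\<in>multi_indices n K. if i = J then (norm (sgn h))\<^sup>2 else 0)"
    unfolding square_sum_def by (intro sum.cong) auto
  then have "square_sum n K ?h \<le> 1"
    using sgn[of h] K J by simp
  moreover have "square_sum n (K - K) ?g \<le> 1"
    using sgn[of g] by (simp add: square_sum_def)
  ultimately show "?a \<in> elementary_atoms A n K"
    unfolding elementary_atoms_def by blast
  have v: "norm v *\<^sub>R sgn v = v" for v :: 'a
    by (cases "v = 0") (simp_all add: sgn_div_norm)
  have "cinner (blinfun_apply T h) g = complex_of_real (norm h * norm g) * cinner (blinfun_apply T (sgn h)) (sgn g)" for T
    by (subst (1) v[of h, symmetric], subst (1) v[of g, symmetric])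
      (simp only: blinfun.scaleR_right cinner_scaleR_left cinner_scaleR_right of_real_mult mult_ac)
  moreover have "restrict I K = I" if "I \<in> multi_indices n K" for I
    using that by (simp add: extensional_restrict multi_indices_extensional)
  ultimately have "single_tensor A J h g (I, T) = complex_of_real (norm h * norm g) * ?a (I, T)" for I T
    using J by (cases "I \<in> multi_indices n K") (auto simp: single_tensor_def elementary_family_def blinfun.zero_right)
  then show "single_tensor A J h g = (\<lambda>p. complex_of_real (norm h * norm g) * ?a p)"
    by auto
qed

context
  fixes A :: "('h::complex_hilbert_space \<Rightarrow>\<^sub>L 'h) set" and n :: nat and K :: "nat set"
  assumes vN: "von_neumann_algebra A" and K: "finite K"
begin

private lemma atoms_nonempty: "elementary_atoms A n K \<noteq> {}"
proof -
  have "elementary_family A n K K (\<lambda>_. 0) (\<lambda>_. 0) \<in> elementary_atoms A n K"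
    unfolding elementary_atoms_def by (fastforce simp: square_sum_def)
  then show ?thesis
    by blast
qed

private lemma atoms_bounded: "bounded ((\<lambda>a. a p) ` elementary_atoms A n K)"
  by (rule boundedI[of _ "norm (snd p)"]) (auto intro: elementary_atoms_bound[OF K])

lemmas atomic_context = atoms_bounded atoms_nonempty

lemma single_tensor_in_atomic_space:
  assumes "J \<in> multi_indices n K"
  shows "single_tensor A J h g \<in> atomic_space (elementary_atoms A n K)"
proof (rule single_tensor_eq_atom[OF K assms])
  fix a
  assume "a \<in> elementary_atoms A n K" and "single_tensor A J h g = (\<lambda>p. complex_of_real (norm h * norm g) * a p)"
  then show ?thesis
    by (simp only: atomic_space_scale[OF atomic_context] atomic_space_atom[OF atomic_context])
qed

lemma elementary_family_eq_sum:
  "elementary_family A n K \<gamma> h g =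
     (\<Sum>J\<in>multi_indices n K. single_tensor A J (h (restrict J \<gamma>)) (g (restrict J (K - \<gamma>))))"
proof
  fix p :: "(nat \<Rightarrow> nat) \<times> ('h \<Rightarrow>\<^sub>L 'h)"
  obtain I T where p: "p = (I, T)"
    by (cases p)
  have "(\<Sum>J\<in>multi_indices n K. single_tensor A J (h (restrict J \<gamma>)) (g (restrict J (K - \<gamma>))) p)
      = (\<Sum>J\<in>multi_indices n K. if J = I then single_tensor A I (h (restrict I \<gamma>)) (g (restrict I (K - \<gamma>))) p else 0)"
    by (intro sum.cong refl) (auto simp: single_tensor_def p)
  also have "\<dots> = elementary_family A n K \<gamma> h g p"
    using K by (auto simp: p elementary_family_def single_tensor_def sum.delta)
  finally show "elementary_family A n K \<gamma> h g p
      = (\<Sum>J\<in>multi_indices n K. single_tensor A J (h (restrict J \<gamma>)) (g (restrict J (K - \<gamma>)))) p"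
    by (simp add: sum_fun_apply)
qed

text \<open>An element of the predual is a series of tensors with summable norm products, and each
  tensor is this product times an atom. The finitely many indices \<open>J\<close> are then added
  up.\<close>

lemma family_function_in_atomic_space:
  assumes x: "\<And>J. J \<in> multi_indices n K \<Longrightarrow> x J \<in> predual A"
  shows "family_function A n K x \<in> atomic_space (elementary_atoms A n K)"
proof -
  let ?V = "atomic_space (elementary_atoms A n K)"
  define X where "X J = (\<lambda>(I, T). if I = J \<and> T \<in> A then x J T else 0)" for J :: "nat \<Rightarrow> nat"
  have "X J \<in> ?V" if J: "J \<in> multi_indices n K" for J
  proof -
    obtain h g where hg: "summable (\<lambda>m. norm (h m) * norm (g m))"
      and sums: "\<And>T. T \<in> A \<Longrightarrow> (\<lambda>m. cinner (T (h m)) (g m)) sums x J T"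
      using predualE[OF vN x[OF J]] by metis
    have "\<exists>a. a \<in> elementary_atoms A n K \<and>
        single_tensor A J (h m) (g m) = (\<lambda>p. complex_of_real (norm (h m) * norm (g m)) * a p)" for m
      using single_tensor_eq_atom[OF K J] by metis
    then obtain a where a: "\<And>m. a m \<in> elementary_atoms A n K"
      "\<And>m. single_tensor A J (h m) (g m) = (\<lambda>p. complex_of_real (norm (h m) * norm (g m)) * a m p)"
      by metis
    have "atomic_series (elementary_atoms A n K) (\<lambda>m. complex_of_real (norm (h m) * norm (g m))) a (X J)"
    proof (rule atomic_seriesI[OF atomic_context])
      show "range a \<subseteq> elementary_atoms A n K"
        using a by auto
      show "summable (\<lambda>m. cmod (complex_of_real (norm (h m) * norm (g m))))"
        using hg by (simp add: norm_mult)
      fix p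
      have "(\<lambda>m. single_tensor A J (h m) (g m) p) sums X J p"
        using sums by (cases p) (auto simp: single_tensor_def X_def)
      then show "(\<lambda>m. complex_of_real (norm (h m) * norm (g m)) * a m p) sums X J p"
        by (simp only: a)
    qed
    then show ?thesis
      by (auto simp: atomic_space_def)
  qed
  then have "(\<Sum>J\<in>multi_indices n K. X J) \<in> ?V"
    by (intro subspace_sum subspace_atomic_space[OF atomic_context])
  also have "(\<Sum>J\<in>multi_indices n K. X J) = family_function A n K x"
  proof
    fix p :: "(nat \<Rightarrow> nat) \<times> ('h \<Rightarrow>\<^sub>L 'h)"
    have "(\<Sum>J\<in>multi_indices n K. X J p) = (\<Sum>J\<in>multi_indices n K. if J = fst p then X (fst p) p else 0)"
      by (intro sum.cong refl) (auto simp: X_def split: prod.split)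
    also have "\<dots> = family_function A n K x p"
      using K by (cases p) (auto simp: X_def family_function_def)
    finally show "(\<Sum>J\<in>multi_indices n K. X J) p = family_function A n K x p"
      by (simp add: sum_fun_apply)
  qed
  finally show ?thesis .
qed

text \<open>A functional on the atomic space is the pairing with a family of operators \<open>a\<^sub>J\<close>. Moving an operator \<open>U\<close> of
  the commutant across the tensor sign does not change the functional on \<open>A\<close>, so \<open>a\<^sub>J\<close> commutes with \<open>U\<close>.\<close>

lemma dual_contractive_family:
  assumes x: "\<And>J. J \<in> multi_indices n K \<Longrightarrow> x J \<in> predual A"
    and C: "\<And>c a. atomic_series (elementary_atoms A n K) c a (family_function A n K x) \<Longrightarrow> C \<le> (\<Sum>m. cmod (c m))"
  shows "\<exists>a. (\<forall>J\<in>multi_indices n K. a J \<in> A) \<and> contractive_family n K a \<and>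
    C \<le> cmod (\<Sum>J\<in>multi_indices n K. x J (a J))"
proof -
  let ?S = "elementary_atoms A n K" and ?I = "multi_indices n K"
  let ?X = "family_function A n K x"
  have X: "?X \<in> atomic_space ?S"
    by (rule family_function_in_atomic_space[OF x])
  show ?thesis
  proof (rule atomic_norm_dual[OF atomic_context X C])
    fix f
  assume f_add: "\<And>y z. y \<in> atomic_space ?S \<Longrightarrow> z \<in> atomic_space ?S \<Longrightarrow> f (y + z) = f y + f z"
    and f_scale: "\<And>c y. y \<in> atomic_space ?S \<Longrightarrow> f (\<lambda>i. c * y i) = c * f y"
    and f_atom: "\<And>a. a \<in> ?S \<Longrightarrow> cmod (f a) \<le> 1"
    and f_series: "\<And>c a y. atomic_series ?S c a y \<Longrightarrow> (\<lambda>m. c m * f (a m)) sums f y"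
    and f_X: "C \<le> cmod (f ?X)"
  note V = single_tensor_in_atomic_space
  have "\<exists>T\<in>bounded_operators. \<forall>h g. cinner (T h) g = f (single_tensor A J h g)" if J: "J \<in> ?I" for J
  proof (rule bounded_operator_of_form[where C = 1])
    fix h h' g g' c
    have "single_tensor A J (h + h') g = single_tensor A J h g + single_tensor A J h' g"
      by (auto simp: single_tensor_def fun_eq_iff blinfun.add_right cinner_add_left)
    then show "f (single_tensor A J (h + h') g) = f (single_tensor A J h g) + f (single_tensor A J h' g)"
      by (simp add: f_add V[OF J])
    have "single_tensor A J h (g + g') = single_tensor A J h g + single_tensor A J h g'"
      by (auto simp: single_tensor_def fun_eq_iff cinner_add_right)
    then show "f (single_tensor A J h (g + g')) = f (single_tensor A J h g) + f (single_tensor A J h g')"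
      by (simp add: f_add V[OF J])
    have "single_tensor A J (c *\<^sub>C h) g = (\<lambda>p. c * single_tensor A J h g p)"
      by (auto simp: single_tensor_def fun_eq_iff cinner_scaleC_left bounded_operatorsD[OF vN_bounded_operators[OF vN]])
    then show "f (single_tensor A J (c *\<^sub>C h) g) = c * f (single_tensor A J h g)"
      by (simp add: f_scale V[OF J])
    have "single_tensor A J h (c *\<^sub>C g) = (\<lambda>p. cnj c * single_tensor A J h g p)"
      by (auto simp: single_tensor_def fun_eq_iff cinner_scaleC_right)
    then show "f (single_tensor A J h (c *\<^sub>C g)) = cnj c * f (single_tensor A J h g)"
      by (simp add: f_scale V[OF J])
    obtain a where a: "a \<in> ?S" "single_tensor A J h g = (\<lambda>p. complex_of_real (norm h * norm g) * a p)"
      using single_tensor_eq_atom[OF K J] by metis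
    then have "f (single_tensor A J h g) = complex_of_real (norm h * norm g) * f a"
      by (simp only: f_scale[OF atomic_space_atom[OF atomic_context]])
    then have "cmod (f (single_tensor A J h g)) = norm h * norm g * cmod (f a)"
      by (simp add: norm_mult)
    also have "\<dots> \<le> norm h * norm g"
      using f_atom[OF a(1)] by (simp add: mult_left_le)
    finally show "cmod (f (single_tensor A J h g)) \<le> 1 * norm h * norm g"
      by simp
  qed
  then obtain a where aB: "\<And>J. J \<in> ?I \<Longrightarrow> a J \<in> bounded_operators"
    and a: "\<And>J h g. J \<in> ?I \<Longrightarrow> cinner ((a J) h) g = f (single_tensor A J h g)"
    by metis
  have aA: "a J \<in> A" if J: "J \<in> ?I" for J
  proof (rule von_neumann_algebra_memI[OF vN aB[OF J]])
    fix U v assume U: "U \<in> commutant A"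
    obtain U' where U': "is_adjoint U' U"
      using ex_adjoint[OF commutant_bounded_operators[OF vN U]] by blast
    show "(a J) (U v) = U ((a J) v)"
    proof (rule cinner_left_eqI)
      fix w
      have "single_tensor A J (U v) w = single_tensor A J v (U' w)"
        using U' by (auto simp: single_tensor_def fun_eq_iff vN_commute[OF vN _ U] is_adjoint_def)
      then show "cinner ((a J) (U v)) w = cinner (U ((a J) v)) w"
        using U' by (simp add: a[OF J] is_adjoint_def)
    qed
  qed
  have f_sum: "f (\<Sum>J\<in>S. F J) = (\<Sum>J\<in>S. f (F J))" if "\<And>J. J \<in> S \<Longrightarrow> F J \<in> atomic_space ?S" for S and F :: "(nat \<Rightarrow> nat) \<Rightarrow> _"
  proof -
    have "f 0 = 0"
      using f_add[of 0 0] subspace_0[OF subspace_atomic_space[OF atomic_context]] by simp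
    then show ?thesis
      using that by (induction S rule: infinite_finite_induct)
        (auto simp: f_add subspace_sum[OF subspace_atomic_space[OF atomic_context]])
  qed
  have f_elementary: "f (elementary_family A n K \<gamma> h g) = index_pairing n K \<gamma> a h g" for \<gamma> h g
    unfolding elementary_family_eq_sum index_pairing_def by (subst f_sum) (auto simp: V a)
  have "contractive_family n K a"
    unfolding contractive_family_def f_elementary[symmetric]
    by (intro allI impI f_atom) (auto simp: elementary_atoms_def)
  \<comment> \<open>On atoms \<open>f\<close> is the pairing with \<open>a\<close> by construction;
    a series representation of \<open>?X\<close> carries this over, since \<open>f\<close> can be
    applied term by term.\<close>
  moreover have "f ?X = (\<Sum>J\<in>?I. x J (a J))"
  proof -
    obtain c \<alpha> where ser: "atomic_series ?S c \<alpha> ?X"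
      using X by (auto simp: atomic_space_def)
    have f_\<alpha>: "f (\<alpha> m) = (\<Sum>J\<in>?I. \<alpha> m (J, a J))" for m
    proof -
      have "\<alpha> m \<in> ?S"
        using ser by (auto simp: atomic_series_def)
      then obtain \<gamma> h g where \<alpha>: "\<alpha> m = elementary_family A n K \<gamma> h g"
        by (auto simp: elementary_atoms_def)
      show ?thesis
        unfolding \<alpha> f_elementary index_pairing_def
        using aA by (intro sum.cong refl) (simp add: elementary_family_def)
    qed
    have "(\<lambda>m. \<Sum>J\<in>?I. c m * \<alpha> m (J, a J)) sums f ?X"
      using f_series[OF ser] unfolding f_\<alpha> sum_distrib_left .
    moreover have "(\<lambda>m. \<Sum>J\<in>?I. c m * \<alpha> m (J, a J)) sums (\<Sum>J\<in>?I. ?X (J, a J))"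
      by (intro sums_sum atomic_series_sums[OF atomic_context ser])
    ultimately have "f ?X = (\<Sum>J\<in>?I. ?X (J, a J))"
      by (rule sums_unique2)
    then show ?thesis
      using aA by (simp add: family_function_def)
  qed
  ultimately show ?thesis
    using aA f_X by auto
  qed
qed

end

text \<open>Each atom of the series comes with its own set \<open>\<gamma> m\<close>. The terms are
  sorted by this set: for given \<alpha> the others get scalar and vectors zero, so every index
  \<open>m\<close> is charged for exactly one \<alpha> and the total cost is unchanged.\<close>

lemma admits_decomposition_of_atomic_series:
  fixes A :: "('h::complex_hilbert_space \<Rightarrow>\<^sub>L 'h) set"
  assumes vN: "von_neumann_algebra A" and x: "\<And>J. J \<in> multi_indices n {1..k} \<Longrightarrow> x J \<in> predual A"
    and ser: "atomic_series (elementary_atoms A n {1..k}) c a (family_function A n {1..k} x)"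
    and less: "(\<Sum>m. cmod (c m)) < 2 ^ (2 * k)"
  shows "admits_decomposition A n k x"
proof -
  let ?K = "{1..k}"
  have "\<exists>\<gamma> h g. a m = elementary_family A n ?K \<gamma> h g \<and> \<gamma> \<subseteq> ?K \<and> square_sum n \<gamma> h \<le> 1 \<and> square_sum n (?K - \<gamma>) g \<le> 1" for m
  proof -
    have "a m \<in> elementary_atoms A n ?K"
      using ser by (auto simp: atomic_series_def)
    then show ?thesis
      unfolding elementary_atoms_def by blast
  qed
  then obtain \<gamma> h g where a: "\<And>m. a m = elementary_family A n ?K (\<gamma> m) (h m) (g m)" and \<gamma>: "\<And>m. \<gamma> m \<subseteq> ?K"
    and hg: "\<And>m. square_sum n (\<gamma> m) (h m) \<le> 1" "\<And>m. square_sum n (?K - \<gamma> m) (g m) \<le> 1"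
    by metis
  have c: "summable (\<lambda>m. cmod (c m))"
    using ser by (simp add: atomic_series_def)
  define lam where "lam \<alpha> m = (if \<gamma> m = \<alpha> then c m else 0)" for \<alpha> m
  define H where "H \<alpha> m = (if \<gamma> m = \<alpha> then h m else (\<lambda>_. 0))" for \<alpha> m
  define G where "G \<alpha> m = (if \<gamma> m = \<alpha> then g m else (\<lambda>_. 0))" for \<alpha> m
  define F where "F \<alpha> J T m = lam \<alpha> m * tensor_functional (H \<alpha> m (restrict J \<alpha>)) (G \<alpha> m (restrict J (?K - \<alpha>))) T" for \<alpha> J T m
  define y where "y \<alpha> J = predual_quotient_map A (\<lambda>T. \<Sum>m. F \<alpha> J T m)" for \<alpha> J
  have lam: "summable (\<lambda>m. cmod (lam \<alpha> m))" for \<alpha>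
    by (rule summable_comparison_test'[OF c]) (simp add: lam_def)
  have F_term: "F \<alpha> J T m = (if \<gamma> m = \<alpha> then c m * a m (J, T) else 0)" if "J \<in> multi_indices n ?K" "T \<in> A" for \<alpha> J T m
    using that vN_bounded_operators[OF vN] by (simp add: F_def lam_def H_def G_def a elementary_family_def tensor_functional_def)
  have sum_y: "x J = (\<lambda>T. \<Sum>\<alpha>\<in>Pow ?K. y \<alpha> J T)" if J: "J \<in> multi_indices n ?K" for J
  proof
    fix T
    show "x J T = (\<Sum>\<alpha>\<in>Pow ?K. y \<alpha> J T)"
    proof (cases "T \<in> A")
      case True
      have F_summable: "summable (F \<alpha> J T)" for \<alpha>
      proof (rule summable_comparison_test')
        show "summable (\<lambda>m. cmod (c m) * norm T)"
          by (rule summable_mult2[OF c])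
        show "norm (F \<alpha> J T m) \<le> cmod (c m) * norm T" for m
          using elementary_atoms_bound[of ?K "a m" A n "(J, T)"] ser
          by (auto simp: F_term[OF J True] norm_mult atomic_series_def intro!: mult_left_mono)
      qed
      have "(\<Sum>\<alpha>\<in>Pow ?K. y \<alpha> J T) = (\<Sum>\<alpha>\<in>Pow ?K. \<Sum>m. F \<alpha> J T m)"
        using True by (simp add: y_def predual_quotient_map_def)
      also have "\<dots> = (\<Sum>m. \<Sum>\<alpha>\<in>Pow ?K. F \<alpha> J T m)"
        by (rule suminf_sum[symmetric]) (rule F_summable)
      also have "\<dots> = (\<Sum>m. c m * a m (J, T))"
        using \<gamma> by (intro suminf_cong) (simp add: F_term[OF J True] sum.delta')
      also have "\<dots> = x J T"
      proof -
        have "family_function A n ?K x (J, T) = (\<Sum>m. c m * a m (J, T))"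
          using ser by (simp only: atomic_series_def)
        then show ?thesis
          using J True by (simp add: family_function_def)
      qed
      finally show ?thesis
        by simp
    next
      case False
      then show ?thesis
        using predualE[OF vN x[OF J]] by (simp add: y_def predual_quotient_map_def) metis
    qed
  qed
  have norms: "(\<Sum>i\<in>multi_indices n \<alpha>. (norm (H \<alpha> m i))\<^sup>2) \<le> 1"
    "(\<Sum>j\<in>multi_indices n (?K - \<alpha>). (norm (G \<alpha> m j))\<^sup>2) \<le> 1" for \<alpha> m
    using hg[of m] by (auto simp: H_def G_def square_sum_def)
  have "(\<Sum>\<alpha>\<in>Pow ?K. \<Sum>m. cmod (lam \<alpha> m)) = (\<Sum>m. \<Sum>\<alpha>\<in>Pow ?K. cmod (lam \<alpha> m))"
    by (rule suminf_sum[symmetric]) (rule lam)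
  also have "\<dots> = (\<Sum>m. cmod (c m))"
    using \<gamma> by (intro suminf_cong) (simp add: lam_def if_distrib[of cmod] sum.delta' cong: if_cong)
  finally have "(\<Sum>\<alpha>\<in>Pow ?K. \<Sum>m. cmod (lam \<alpha> m)) < 2 ^ (2 * k)"
    using less by simp
  then show ?thesis
    unfolding admits_decomposition_def
    using sum_y norms lam
    by (intro exI[of _ y] exI[of _ lam] exI[of _ H] exI[of _ G]) (simp add: y_def F_def)
qed

section \<open>Averages over the polytorus\<close>

lemma prob_space_Omega_measure: "prob_space Omega_measure"
  unfolding Omega_measure_def by (rule prob_space_PiM) (rule prob_space_circle_measure)

lemma prob_space_Omega_power_measure: "prob_space (Omega_power_measure k)"
  unfolding Omega_power_measure_def by (rule prob_space_PiM) (rule prob_space_Omega_measure)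

lemma Omega_power_measure_unimodular:
  assumes "t \<in> space (Omega_power_measure k)" and "i \<in> {1..k}"
  shows "cmod (t i j) = 1"
proof -
  have "t i \<in> space Omega_measure"
    using assms by (auto simp: Omega_power_measure_def space_PiM)
  then have "t i j \<in> sphere 0 1"
    by (auto simp: Omega_measure_def space_PiM)
  then show ?thesis
    by simp
qed

text \<open>This compares the product sigma-algebra with the Borel sets of the product topology, so
  that continuous functions on arrays become measurable. Rows outside {1..k} are constant on the
  space.\<close>

lemma measurable_Omega_power_id: "(\<lambda>t. t) \<in> borel_measurable (Omega_power_measure k)"
proof (intro measurable_coordinatewise_then_product)
  fix i j
  show "(\<lambda>t. t i j) \<in> borel_measurable (Omega_power_measure k)"
  proof (cases "i \<in> {1..k}")
    case True
    have "(\<lambda>s. s j) \<in> measurable Omega_measure circle_measure"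
      unfolding Omega_measure_def by (rule measurable_component_singleton) simp
    moreover have "(\<lambda>z. z) \<in> measurable circle_measure borel"
      by (simp cong: measurable_cong_sets) (simp add: measurable_restrict_space1)
    ultimately have "(\<lambda>s. s j) \<in> borel_measurable Omega_measure"
      by (rule measurable_compose)
    moreover have "(\<lambda>t. t i) \<in> measurable (Omega_power_measure k) Omega_measure"
      unfolding Omega_power_measure_def using True by (rule measurable_component_singleton)
    ultimately show ?thesis
      by (rule measurable_compose[rotated])
  next
    case False
    have "t i j = undefined j" if "t \<in> space (Omega_power_measure k)" for t
      using that False by (auto simp: Omega_power_measure_def space_PiM PiE_iff extensional_def)
    then show ?thesis
      by (subst measurable_cong[where g = "\<lambda>_. undefined j"]) auto
  qed
qed

lemma eps_eq_monomial: "eps k J t = monomial {1..k} J t"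
  by (simp add: eps_def monomial_def)

lemma cmod_monomial:
  assumes "\<And>i j. i \<in> C \<Longrightarrow> cmod (t i j) = 1"
  shows "cmod (monomial C J t) = 1"
  unfolding monomial_def prod_norm[symmetric] using assms by simp

text \<open>The arrays in \<open>phase_arrays\<close> are specified for columns in {1..n} only; the
  remaining coordinates of \<Omega>, which occur in no monomial considered, are multiplied by
  1.\<close>

definition rotate_array :: "nat \<Rightarrow> nat \<Rightarrow> (nat \<Rightarrow> nat \<Rightarrow> complex) \<Rightarrow> (nat \<Rightarrow> nat \<Rightarrow> complex) \<Rightarrow> nat \<Rightarrow> nat \<Rightarrow> complex" where
  "rotate_array n k u t = (\<lambda>i\<in>{1..k}. \<lambda>j. (if j \<in> {1..n} then u i j else 1) * t i j)"

lemma monomial_rotate_array: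
  assumes "J \<in> multi_indices n C" and "C \<subseteq> {1..k}"
  shows "monomial C J (rotate_array n k u t) = monomial C J u * monomial C J t"
  unfolding monomial_def prod.distrib[symmetric]
proof (rule prod.cong[OF refl])
  fix i assume i: "i \<in> C"
  then have "J i \<in> {1..n}" "i \<in> {1..k}"
    using assms by (auto simp: multi_indices_def)
  then show "rotate_array n k u t i (J i) = u i (J i) * t i (J i)"
    by (simp add: rotate_array_def)
qed

lemma
  assumes u: "u \<in> phase_arrays n {1..k}"
  shows measurable_rotate_array: "rotate_array n k u \<in> measurable (Omega_power_measure k) (Omega_power_measure k)"
    and distr_rotate_array: "distr (Omega_power_measure k) (Omega_power_measure k) (rotate_array n k u) = Omega_power_measure k"
proof -
  define c where "c i j = (if j \<in> {1..n} then u i j else 1)" for i j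
  have c: "cmod (c i j) = 1" if "i \<in> {1..k}" for i j
    using u that by (auto simp: c_def phase_arrays_def phases_def PiE_iff intro!: cmod_cube_root)
  have inner: "(\<lambda>s j. c i j * s j) \<in> measurable Omega_measure Omega_measure"
    "distr Omega_measure Omega_measure (\<lambda>s j. c i j * s j) = Omega_measure" if i: "i \<in> {1..k}" for i
  proof -
    have eq: "(\<lambda>s j. c i j * s j) = (\<lambda>s. \<lambda>j\<in>UNIV. c i j * s j)"
      by (simp add: restrict_UNIV)
    show "(\<lambda>s j. c i j * s j) \<in> measurable Omega_measure Omega_measure"
      "distr Omega_measure Omega_measure (\<lambda>s j. c i j * s j) = Omega_measure"
      unfolding Omega_measure_def eq
      by (rule distr_PiM_componentwise[OF prob_space_circle_measure rotation_measurable[OF c[OF i]]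
            circle_measure_rotation[OF c[OF i]]])+
  qed
  have rotate: "rotate_array n k u = (\<lambda>t. \<lambda>i\<in>{1..k}. (\<lambda>j. c i j * t i j))"
    by (simp add: rotate_array_def c_def fun_eq_iff)
  note componentwise = distr_PiM_componentwise[where M = "\<lambda>_. Omega_measure" and I = "{1..k}"
      and f = "\<lambda>i s j. c i j * s j", OF prob_space_Omega_measure inner]
  show "rotate_array n k u \<in> measurable (Omega_power_measure k) (Omega_power_measure k)"
    unfolding Omega_power_measure_def rotate by (rule componentwise(1))
  show "distr (Omega_power_measure k) (Omega_power_measure k) (rotate_array n k u) = Omega_power_measure k"
    unfolding Omega_power_measure_def rotate by (rule componentwise(2))
qed

section \<open>The L1 norm as an integral of averages over the finite group\<close>

definition L1_integrand ::
    "('h::complex_hilbert_space \<Rightarrow>\<^sub>L 'h) set \<Rightarrow> nat \<Rightarrow> nat \<Rightarrow>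
      ((nat \<Rightarrow> nat) \<Rightarrow> ('h \<Rightarrow>\<^sub>L 'h) \<Rightarrow> complex) \<Rightarrow> (nat \<Rightarrow> nat \<Rightarrow> complex) \<Rightarrow> real" where
  "L1_integrand A n k x t = predual_norm A (\<lambda>T. \<Sum>J\<in>multi_indices n {1..k}. eps k J t * x J T)"

definition L1_average ::
    "('h::complex_hilbert_space \<Rightarrow>\<^sub>L 'h) set \<Rightarrow> nat \<Rightarrow> nat \<Rightarrow>
      ((nat \<Rightarrow> nat) \<Rightarrow> ('h \<Rightarrow>\<^sub>L 'h) \<Rightarrow> complex) \<Rightarrow> (nat \<Rightarrow> nat \<Rightarrow> complex) \<Rightarrow> real" where
  "L1_average A n k x t =
     (\<Sum>u\<in>phase_arrays n {1..k}. L1_integrand A n k x (rotate_array n k u t)) / card (phase_arrays n {1..k})"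

context
  fixes A :: "('h::complex_hilbert_space \<Rightarrow>\<^sub>L 'h) set" and n k :: nat
    and x :: "(nat \<Rightarrow> nat) \<Rightarrow> ('h \<Rightarrow>\<^sub>L 'h) \<Rightarrow> complex"
  assumes vN: "von_neumann_algebra A"
    and x: "\<And>J. J \<in> multi_indices n {1..k} \<Longrightarrow> operator_functional A (x J)"
begin

lemma L1_functional: "operator_functional A (\<lambda>T. \<Sum>J\<in>multi_indices n {1..k}. c J * x J T)"
  by (rule operator_functional_combination) (auto intro: x)

lemma L1_integrand_diff_le:
  "L1_integrand A n k x s \<le> L1_integrand A n k x t + (\<Sum>J\<in>multi_indices n {1..k}. cmod (eps k J s - eps k J t) * predual_norm A (x J))"
  unfolding L1_integrand_def[of _ _ _ _ s]
proof (rule predual_norm_least[OF vN])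
  fix T assume T: "T \<in> A" "norm T \<le> 1"
  have "(\<Sum>J\<in>multi_indices n {1..k}. eps k J s * x J T) = (\<Sum>J\<in>multi_indices n {1..k}. eps k J t * x J T) + (\<Sum>J\<in>multi_indices n {1..k}. (eps k J s - eps k J t) * x J T)"
    by (simp add: sum.distrib[symmetric] algebra_simps)
  then have "cmod (\<Sum>J\<in>multi_indices n {1..k}. eps k J s * x J T)
      \<le> cmod (\<Sum>J\<in>multi_indices n {1..k}. eps k J t * x J T) + (\<Sum>J\<in>multi_indices n {1..k}. cmod ((eps k J s - eps k J t) * x J T))"
    by (simp only:) (intro norm_triangle_le add_left_mono norm_sum)
  also have "\<dots> \<le> L1_integrand A n k x t + (\<Sum>J\<in>multi_indices n {1..k}. cmod (eps k J s - eps k J t) * predual_norm A (x J))"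
  proof (intro add_mono sum_mono)
    show "cmod (\<Sum>J\<in>multi_indices n {1..k}. eps k J t * x J T) \<le> L1_integrand A n k x t"
      using cmod_le_predual_norm[OF vN L1_functional T] by (simp add: L1_integrand_def)
    fix J assume "J \<in> multi_indices n {1..k}"
    then show "cmod ((eps k J s - eps k J t) * x J T) \<le> cmod (eps k J s - eps k J t) * predual_norm A (x J)"
      using cmod_le_predual_norm[OF vN x T] by (simp add: norm_mult mult_left_mono)
  qed
  finally show "cmod (\<Sum>J\<in>multi_indices n {1..k}. eps k J s * x J T)
      \<le> L1_integrand A n k x t + (\<Sum>J\<in>multi_indices n {1..k}. cmod (eps k J s - eps k J t) * predual_norm A (x J))" .
qed

text \<open>The predual norm is a supremum over a possibly uncountable set of operators, so
  measurability of the integrand is derived from its continuity in finitely many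
  coordinates.\<close>

lemma continuous_L1_integrand: "continuous_on UNIV (L1_integrand A n k x)"
proof -
  have coordinate: "continuous_on UNIV (\<lambda>t::nat \<Rightarrow> nat \<Rightarrow> complex. t i j)" for i j
    using continuous_on_product_then_coordinatewise[OF continuous_on_product_coordinates[of i]] .
  have eps: "continuous_on UNIV (eps k J)" for J
    unfolding eps_def[abs_def] by (intro continuous_on_prod coordinate)
  have "(L1_integrand A n k x \<longlongrightarrow> L1_integrand A n k x t) (at t)" for t
  proof -
    let ?d = "\<lambda>s. \<Sum>J\<in>multi_indices n {1..k}. cmod (eps k J s - eps k J t) * predual_norm A (x J)"
    have "continuous_on UNIV ?d"
      by (intro continuous_intros eps)
    then have "(?d \<longlongrightarrow> ?d t) (at t)"
      unfolding continuous_on_def by blast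
    then have d: "(?d \<longlongrightarrow> 0) (at t)"
      by simp
    have "norm (L1_integrand A n k x s - L1_integrand A n k x t) \<le> ?d s" for s
      using L1_integrand_diff_le[of s t] L1_integrand_diff_le[of t s] by (simp add: abs_le_iff norm_minus_commute)
    then have "((\<lambda>s. L1_integrand A n k x s - L1_integrand A n k x t) \<longlongrightarrow> 0) (at t)"
      by (intro Lim_null_comparison[OF _ d]) simp
    then show ?thesis
      by (rule LIM_zero_cancel)
  qed
  then show ?thesis
    by (simp add: continuous_on_def)
qed

lemma L1_integrand_nonneg: "0 \<le> L1_integrand A n k x t"
  unfolding L1_integrand_def by (rule predual_norm_nonneg[OF vN L1_functional])

lemma integrable_L1_integrand: "integrable (Omega_power_measure k) (L1_integrand A n k x)"
proof -
  interpret prob_space "Omega_power_measure k"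
    by (rule prob_space_Omega_power_measure)
  have "L1_integrand A n k x \<in> borel_measurable (Omega_power_measure k)"
    using measurable_compose[OF measurable_Omega_power_id borel_measurable_continuous_onI[OF continuous_L1_integrand]] .
  moreover have "norm (L1_integrand A n k x t) \<le> (\<Sum>J\<in>multi_indices n {1..k}. predual_norm A (x J))" if "t \<in> space (Omega_power_measure k)" for t
  proof -
    have "L1_integrand A n k x t \<le> (\<Sum>J\<in>multi_indices n {1..k}. predual_norm A (x J))"
      unfolding L1_integrand_def
    proof (rule predual_norm_least[OF vN], rule sum_norm_le)
      fix T J assume T: "T \<in> A" "norm T \<le> 1" and J: "J \<in> multi_indices n {1..k}"
      show "cmod (eps k J t * x J T) \<le> predual_norm A (x J)"
        using cmod_le_predual_norm[OF vN x[OF J] T] cmod_monomial[of "{1..k}" t J] Omega_power_measure_unimodular[OF that]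
        by (simp add: norm_mult eps_eq_monomial)
    qed
    then show ?thesis
      using L1_integrand_nonneg by simp
  qed
  ultimately show ?thesis
    by (intro integrable_const_bound) auto
qed

text \<open>Each rotation preserves the measure, so all summands of the average integrate to the L1
  norm. Bounds for the average that hold at every point therefore become bounds for the L1
  norm.\<close>

lemma
  shows integrable_L1_average: "integrable (Omega_power_measure k) (L1_average A n k x)"
    and integral_L1_average: "(LINT t|Omega_power_measure k. L1_average A n k x t) = L1_norm A n k x"
proof -
  let ?W = "phase_arrays n {1..k}"
  have rot: "integrable (Omega_power_measure k) (\<lambda>t. L1_integrand A n k x (rotate_array n k u t))"
    "(LINT t|Omega_power_measure k. L1_integrand A n k x (rotate_array n k u t)) = L1_norm A n k x" if "u \<in> ?W" for u
  proof -
    note meas = measurable_rotate_array[OF that]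
    have "integrable (distr (Omega_power_measure k) (Omega_power_measure k) (rotate_array n k u)) (L1_integrand A n k x)"
      using integrable_L1_integrand by (simp add: distr_rotate_array[OF that])
    then show "integrable (Omega_power_measure k) (\<lambda>t. L1_integrand A n k x (rotate_array n k u t))"
      using meas by (simp add: integrable_distr)
    have "(LINT t|Omega_power_measure k. L1_integrand A n k x (rotate_array n k u t))
        = (LINT t|distr (Omega_power_measure k) (Omega_power_measure k) (rotate_array n k u). L1_integrand A n k x t)"
      using meas integrable_L1_integrand by (intro integral_distr[symmetric]) auto
    then show "(LINT t|Omega_power_measure k. L1_integrand A n k x (rotate_array n k u t)) = L1_norm A n k x"
      by (simp add: distr_rotate_array[OF that] L1_norm_def L1_integrand_def)
  qed
  show "integrable (Omega_power_measure k) (L1_average A n k x)"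
    unfolding L1_average_def using rot by (intro integrable_divide integrable_sum) auto
  have "(LINT t|Omega_power_measure k. L1_average A n k x t) = (\<Sum>u\<in>?W. L1_norm A n k x) / card ?W"
    unfolding L1_average_def using rot by (simp add: integral_sum)
  then show "(LINT t|Omega_power_measure k. L1_average A n k x t) = L1_norm A n k x"
    using card_phase_arrays_pos[of "{1..k}" n] by auto
qed

lemma L1_norm_geI:
  assumes "\<And>t. t \<in> space (Omega_power_measure k) \<Longrightarrow> r \<le> L1_average A n k x t"
  shows "r \<le> L1_norm A n k x"
proof -
  interpret prob_space "Omega_power_measure k"
    by (rule prob_space_Omega_power_measure)
  have "(LINT t|Omega_power_measure k. r) \<le> (LINT t|Omega_power_measure k. L1_average A n k x t)"
    by (intro integral_mono integrable_L1_average assms) auto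
  then show ?thesis
    by (simp add: integral_L1_average prob_space)
qed

lemma L1_norm_leI:
  assumes "\<And>t. t \<in> space (Omega_power_measure k) \<Longrightarrow> L1_average A n k x t \<le> r"
  shows "L1_norm A n k x \<le> r"
proof -
  interpret prob_space "Omega_power_measure k"
    by (rule prob_space_Omega_power_measure)
  have "(LINT t|Omega_power_measure k. L1_average A n k x t) \<le> (LINT t|Omega_power_measure k. r)"
    by (intro integral_mono integrable_L1_average assms) auto
  then show ?thesis
    by (simp add: integral_L1_average prob_space)
qed

text \<open>At a fixed point t the monomials are absorbed into \<open>x\<close> and compensated by
  their conjugates in \<open>a\<close>. The modified family remains contractive, because its
  unimodular factors split along \<gamma> and the complement and can be moved to the vectors, whose
  norms they preserve.\<close>

lemma contractive_family_L1_norm_bound: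
  assumes aA: "\<And>J. J \<in> multi_indices n {1..k} \<Longrightarrow> a J \<in> A" and a: "contractive_family n {1..k} a"
  shows "cmod (\<Sum>J\<in>multi_indices n {1..k}. x J (a J)) \<le> 2 ^ k * L1_norm A n k x"
proof -
  let ?K = "{1..k}"
  have "cmod (\<Sum>J\<in>multi_indices n {1..k}. x J (a J)) / 2 ^ k \<le> L1_norm A n k x"
  proof (rule L1_norm_geI)
    fix t assume t: "t \<in> space (Omega_power_measure k)"
    have unimodular: "cmod (monomial C J t) = 1" if "C \<subseteq> ?K" for C J
      using that by (intro cmod_monomial Omega_power_measure_unimodular[OF t]) auto
    define x' where "x' J = (\<lambda>T. monomial ?K J t * x J T)" for J
    define a' where "a' J = scalar_operator (cnj (monomial ?K J t)) o\<^sub>L a J" for J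
    have x': "operator_functional A (x' J)" if "J \<in> multi_indices n {1..k}" for J
      using operator_functional_combination[of "{J}" A x "\<lambda>J. monomial ?K J t"] x[OF that] by (simp add: x'_def)
    have a'A: "a' J \<in> A" if "J \<in> multi_indices n {1..k}" for J
      unfolding a'_def using that by (intro vN_compose[OF vN] vN_scalar_operator[OF vN] aA)
    have "contractive_family n ?K a'"
      unfolding contractive_family_def
    proof (intro allI impI)
      fix \<gamma> and h g :: "(nat \<Rightarrow> nat) \<Rightarrow> 'h"
      assume \<gamma>: "\<gamma> \<subseteq> ?K" and h: "square_sum n \<gamma> h \<le> 1" and g: "square_sum n (?K - \<gamma>) g \<le> 1"
      let ?h = "\<lambda>r. cnj (monomial \<gamma> r t) *\<^sub>C h r" and ?g = "\<lambda>p. monomial (?K - \<gamma>) p t *\<^sub>C g p"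
      have "index_pairing n ?K \<gamma> a' h g = index_pairing n ?K \<gamma> a ?h ?g"
        unfolding index_pairing_def a'_def using aA
        by (intro sum.cong refl) (simp add: monomial_split[OF \<gamma>] cinner_scaleC_left cinner_scaleC_right
            bounded_operatorsD[OF vN_bounded_operators[OF vN]] del: One_nat_def)
      moreover have "square_sum n \<gamma> ?h \<le> 1" "square_sum n (?K - \<gamma>) ?g \<le> 1"
        using h g \<gamma> by (simp_all add: square_sum_def unimodular)
      ultimately show "cmod (index_pairing n ?K \<gamma> a' h g) \<le> 1"
        using a \<gamma> by (auto simp: contractive_family_def)
    qed
    from contractive_family_pairing_le[OF vN finite_atLeastAtMost x' a'A this]
    have "cmod (\<Sum>J\<in>multi_indices n {1..k}. x' J (a' J)) \<le> 2 ^ k / card (phase_arrays n ?K) *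
        (\<Sum>u\<in>phase_arrays n ?K. predual_norm A (\<lambda>T. \<Sum>J\<in>multi_indices n {1..k}. monomial ?K J u * x' J T))"
      by simp
    also have "\<dots> = 2 ^ k * L1_average A n k x t"
      by (simp add: L1_average_def L1_integrand_def eps_eq_monomial monomial_rotate_array x'_def mult.assoc cong: sum.cong)
    also have "(\<Sum>J\<in>multi_indices n {1..k}. x' J (a' J)) = (\<Sum>J\<in>multi_indices n {1..k}. x J (a J))"
    proof (rule sum.cong[OF refl])
      fix J assume J: "J \<in> multi_indices n {1..k}"
      have "monomial ?K J t * cnj (monomial ?K J t) = 1"
        using unimodular[of ?K J] complex_norm_square[of "monomial ?K J t"] by simp
      then show "x' J (a' J) = x J (a J)"
        unfolding x'_def a'_def operator_functionalD(2)[OF x[OF J] aA[OF J]] by (simp add: mult.assoc[symmetric])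
    qed
    finally show "cmod (\<Sum>J\<in>multi_indices n {1..k}. x J (a J)) / 2 ^ k \<le> L1_average A n k x t"
      by (simp add: field_simps)
  qed
  then show ?thesis
    by (simp add: field_simps)
qed

end

section \<open>The converse inequality\<close>

lemma sum_phase_arrays_square_le:
  fixes v :: "(nat \<Rightarrow> nat) \<Rightarrow> 'h::complex_hilbert_space"
  assumes K: "finite K" and C: "C \<subseteq> K"
  shows "(\<Sum>u\<in>phase_arrays n K. (norm (\<Sum>r\<in>multi_indices n C. cnj (monomial C r u) *\<^sub>C v r))\<^sup>2)
      \<le> card (phase_arrays n K) * square_sum n C v" (is ?cnj)
    and "(\<Sum>u\<in>phase_arrays n K. (norm (\<Sum>r\<in>multi_indices n C. monomial C r u *\<^sub>C v r))\<^sup>2)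
      \<le> card (phase_arrays n K) * square_sum n C v"
proof -
  show cnj: ?cnj
    \<comment> \<open>With an empty right index set nothing can cancel, and the constant is
      1.\<close>
    using phase_sum_square_le[OF K _ C, of "{}" n "\<lambda>r _. v r"]
    by (simp add: phase_sum_def block_norm_def square_sum_def monomial_def override_on_def)
  have "(\<Sum>u\<in>phase_arrays n K. (norm (\<Sum>r\<in>multi_indices n C. monomial C r u *\<^sub>C v r))\<^sup>2)
      = (\<Sum>u\<in>phase_arrays n K. (norm (\<Sum>r\<in>multi_indices n C. cnj (monomial C r (cnj_array n K u)) *\<^sub>C v r))\<^sup>2)"
    using C by (intro sum.cong refl arg_cong[where f = "\<lambda>z. (norm z)\<^sup>2"]) (simp add: monomial_cnj_array)
  also have "\<dots> = (\<Sum>u\<in>phase_arrays n K. (norm (\<Sum>r\<in>multi_indices n C. cnj (monomial C r u) *\<^sub>C v r))\<^sup>2)"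
    by (rule sum_phase_arrays_cnj)
  finally show "(\<Sum>u\<in>phase_arrays n K. (norm (\<Sum>r\<in>multi_indices n C. monomial C r u *\<^sub>C v r))\<^sup>2)
      \<le> card (phase_arrays n K) * square_sum n C v"
    using cnj by simp
qed

text \<open>The values of the monomials at t are unimodular and go into the vectors. Both factors
  then have mean square at most 1, and the arithmetic-geometric mean inequality bounds the mean of
  their product.\<close>

lemma sum_phase_arrays_norm_product_le:
  fixes h g :: "(nat \<Rightarrow> nat) \<Rightarrow> 'h::complex_hilbert_space"
  assumes \<alpha>: "\<alpha> \<subseteq> {1..k}" and h: "square_sum n \<alpha> h \<le> 1" and g: "square_sum n ({1..k} - \<alpha>) g \<le> 1"
    and t: "\<And>i j. i \<in> {1..k} \<Longrightarrow> cmod (t i j) = 1"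
  shows "(\<Sum>u\<in>phase_arrays n {1..k}.
      norm (\<Sum>r\<in>multi_indices n \<alpha>. monomial \<alpha> r (rotate_array n k u t) *\<^sub>C h r) *
      norm (\<Sum>p\<in>multi_indices n ({1..k} - \<alpha>). cnj (monomial ({1..k} - \<alpha>) p (rotate_array n k u t)) *\<^sub>C g p))
    \<le> card (phase_arrays n {1..k})"
proof -
  let ?K = "{1..k}" and ?W = "phase_arrays n {1..k}"
  let ?h = "\<lambda>r. monomial \<alpha> r t *\<^sub>C h r" and ?g = "\<lambda>p. cnj (monomial (?K - \<alpha>) p t) *\<^sub>C g p"
  define U where "U u = (\<Sum>r\<in>multi_indices n \<alpha>. monomial \<alpha> r u *\<^sub>C ?h r)" for u
  define V where "V u = (\<Sum>p\<in>multi_indices n (?K - \<alpha>). cnj (monomial (?K - \<alpha>) p u) *\<^sub>C ?g p)" for u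
  have unimodular: "cmod (monomial C J t) = 1" if "C \<subseteq> ?K" for C J
    using that t by (intro cmod_monomial) auto
  have "(\<Sum>u\<in>?W. (norm (U u))\<^sup>2) \<le> card ?W * square_sum n \<alpha> ?h"
    unfolding U_def by (rule sum_phase_arrays_square_le(2)) (use \<alpha> in auto)
  also have "\<dots> \<le> card ?W"
    using h \<alpha> by (simp add: square_sum_def unimodular mult_left_le)
  finally have U: "(\<Sum>u\<in>?W. (norm (U u))\<^sup>2) \<le> card ?W" .
  have "(\<Sum>u\<in>?W. (norm (V u))\<^sup>2) \<le> card ?W * square_sum n (?K - \<alpha>) ?g"
    unfolding V_def by (rule sum_phase_arrays_square_le(1)) auto
  also have "\<dots> \<le> card ?W"
    using g by (simp add: square_sum_def unimodular mult_left_le)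
  finally have V: "(\<Sum>u\<in>?W. (norm (V u))\<^sup>2) \<le> card ?W" .
  have "(\<Sum>u\<in>?W. norm (U u) * norm (V u)) \<le> (\<Sum>u\<in>?W. ((norm (U u))\<^sup>2 + (norm (V u))\<^sup>2) / 2)"
  proof (rule sum_mono)
    show "norm (U u) * norm (V u) \<le> ((norm (U u))\<^sup>2 + (norm (V u))\<^sup>2) / 2" for u
      using sum_squares_bound[of "norm (U u)" "norm (V u)"] by simp
  qed
  also have "\<dots> = ((\<Sum>u\<in>?W. (norm (U u))\<^sup>2) + (\<Sum>u\<in>?W. (norm (V u))\<^sup>2)) / 2"
    by (simp add: sum_divide_distrib[symmetric] sum.distrib)
  also have "\<dots> \<le> card ?W"
    using U V by simp
  also have "(\<Sum>u\<in>?W. norm (U u) * norm (V u)) = (\<Sum>u\<in>?W.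
      norm (\<Sum>r\<in>multi_indices n \<alpha>. monomial \<alpha> r (rotate_array n k u t) *\<^sub>C h r) *
      norm (\<Sum>p\<in>multi_indices n (?K - \<alpha>). cnj (monomial (?K - \<alpha>) p (rotate_array n k u t)) *\<^sub>C g p))"
    using \<alpha> by (simp add: U_def V_def scaleC_scaleC monomial_rotate_array del: One_nat_def)
  finally show ?thesis .
qed

text \<open>Every modulated term is a single elementary tensor whose mean norm over the finite group
  is at most 1, so the L1 norm is at most the sum of the |lam|. The strict inequality is that of the
  decomposition.\<close>

lemma L1_norm_less_of_decomposition:
  fixes A :: "('h::complex_hilbert_space \<Rightarrow>\<^sub>L 'h) set"
  assumes vN: "von_neumann_algebra A" and x: "\<And>J. J \<in> multi_indices n {1..k} \<Longrightarrow> operator_functional A (x J)"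
    and dec: "admits_decomposition A n k x"
  shows "L1_norm A n k x < 2 ^ (2 * k)"
proof -
  let ?K = "{1..k}" and ?W = "phase_arrays n {1..k}"
  obtain y lam h g where D:
    "\<forall>J\<in>multi_indices n ?K. x J = (\<lambda>T. \<Sum>\<alpha>\<in>Pow ?K. y \<alpha> J T)"
    "\<forall>\<alpha>\<in>Pow ?K. \<forall>J\<in>multi_indices n ?K. y \<alpha> J = predual_quotient_map A
      (\<lambda>T. \<Sum>m. lam \<alpha> m * tensor_functional (h \<alpha> m (restrict J \<alpha>)) (g \<alpha> m (restrict J (?K - \<alpha>))) T)"
    "\<forall>\<alpha>\<in>Pow ?K. \<forall>m. (\<Sum>i\<in>multi_indices n \<alpha>. (norm (h \<alpha> m i))\<^sup>2) \<le> 1 \<and>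
      (\<Sum>j\<in>multi_indices n (?K - \<alpha>). (norm (g \<alpha> m j))\<^sup>2) \<le> 1"
    "\<forall>\<alpha>\<in>Pow ?K. summable (\<lambda>m. cmod (lam \<alpha> m))"
    and less: "(\<Sum>\<alpha>\<in>Pow ?K. \<Sum>m. cmod (lam \<alpha> m)) < 2 ^ (2 * k)"
    using dec unfolding admits_decomposition_def by (elim exE conjE)
  note xy = bspec[OF D(1)] and y = bspec[OF bspec[OF D(2)]] and lam = bspec[OF D(4)]
  have h: "square_sum n \<alpha> (h \<alpha> m) \<le> 1" and g: "square_sum n (?K - \<alpha>) (g \<alpha> m) \<le> 1" if "\<alpha> \<in> Pow ?K" for \<alpha> m
    using D(3) that by (simp_all add: square_sum_def)
  define U where "U \<alpha> m s = (\<Sum>r\<in>multi_indices n \<alpha>. monomial \<alpha> r s *\<^sub>C h \<alpha> m r)" for \<alpha> m s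
  define V where "V \<alpha> m s = (\<Sum>p\<in>multi_indices n (?K - \<alpha>). cnj (monomial (?K - \<alpha>) p s) *\<^sub>C g \<alpha> m p)" for \<alpha> m s
  define w where "w \<alpha> m s = cmod (lam \<alpha> m) * (norm (U \<alpha> m s) * norm (V \<alpha> m s))" for \<alpha> m s
  have fin: "finite \<alpha>" if "\<alpha> \<in> Pow ?K" for \<alpha>
    using that finite_subset by blast
  have norm_le: "norm (\<Sum>r\<in>multi_indices n C. c r *\<^sub>C f r) \<le> card (multi_indices n C)"
    if "square_sum n C f \<le> 1" "finite C" "\<And>r. cmod (c r) = 1" for C c and f :: "(nat \<Rightarrow> nat) \<Rightarrow> 'h"
  proof -
    have "norm (\<Sum>r\<in>multi_indices n C. c r *\<^sub>C f r) \<le> (\<Sum>r\<in>multi_indices n C. 1)"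
      using that by (intro sum_norm_le) (simp add: norm_le_1_of_square_sum)
    then show ?thesis
      by simp
  qed
  \<comment> \<open>This crude bound by the number of indices serves only to interchange the series
    with finite sums.\<close>
  have w_summable: "summable (\<lambda>m. w \<alpha> m s)" if \<alpha>: "\<alpha> \<in> Pow ?K" and s: "\<And>i j. i \<in> ?K \<Longrightarrow> cmod (s i j) = 1" for \<alpha> s
  proof (rule summable_comparison_test')
    let ?B = "real (card (multi_indices n \<alpha>)) * real (card (multi_indices n (?K - \<alpha>)))"
    show "summable (\<lambda>m. cmod (lam \<alpha> m) * ?B)"
      by (rule summable_mult2[OF lam[OF \<alpha>]])
    fix m
    have "norm (U \<alpha> m s) \<le> card (multi_indices n \<alpha>)"
      unfolding U_def using \<alpha> s fin[OF \<alpha>] by (intro norm_le h cmod_monomial) auto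
    moreover have "norm (V \<alpha> m s) \<le> card (multi_indices n (?K - \<alpha>))"
      unfolding V_def using \<alpha> s by (intro norm_le g) (auto intro: cmod_monomial)
    ultimately show "norm (w \<alpha> m s) \<le> cmod (lam \<alpha> m) * ?B"
      by (simp add: w_def abs_mult mult_left_mono mult_mono)
  qed
  have integrand_le: "L1_integrand A n k x s \<le> (\<Sum>\<alpha>\<in>Pow ?K. \<Sum>m. w \<alpha> m s)"
    if s: "\<And>i j. i \<in> ?K \<Longrightarrow> cmod (s i j) = 1" for s
    unfolding L1_integrand_def
  proof (rule predual_norm_least[OF vN])
    fix T assume T: "T \<in> A" "norm T \<le> 1"
    note TB = vN_bounded_operators[OF vN T(1)]
    have part: "(\<lambda>m. lam \<alpha> m * cinner (T (U \<alpha> m s)) (V \<alpha> m s)) sums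
        (\<Sum>J\<in>multi_indices n ?K. eps k J s * y \<alpha> J T)" if \<alpha>: "\<alpha> \<in> Pow ?K" for \<alpha>
    proof -
      let ?f = "\<lambda>J m. cinner (T (h \<alpha> m (restrict J \<alpha>))) (g \<alpha> m (restrict J (?K - \<alpha>)))"
      have "(\<lambda>m. lam \<alpha> m * ?f J m) sums y \<alpha> J T" if J: "J \<in> multi_indices n ?K" for J
      proof -
        have "summable (\<lambda>m. lam \<alpha> m * ?f J m)"
        proof (rule summable_comparison_test'[OF lam[OF \<alpha>]])
          fix m
          have "norm (h \<alpha> m (restrict J \<alpha>)) \<le> 1" "norm (g \<alpha> m (restrict J (?K - \<alpha>))) \<le> 1"
            using J \<alpha> fin[OF \<alpha>] by (auto intro!: norm_le_1_of_square_sum[OF h] norm_le_1_of_square_sum[OF g]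
                restrict_in_multi_indices)
          then have "norm T * (norm (h \<alpha> m (restrict J \<alpha>)) * norm (g \<alpha> m (restrict J (?K - \<alpha>)))) \<le> 1"
            using T(2) by (intro mult_le_one) auto
          then have "cmod (?f J m) \<le> 1"
            using cmod_tensor_le order_trans by blast
          then show "norm (lam \<alpha> m * ?f J m) \<le> cmod (lam \<alpha> m)"
            by (simp add: norm_mult mult_left_le)
        qed
        then show ?thesis
          using T(1) TB by (simp add: y[OF \<alpha> J] predual_quotient_map_def tensor_functional_def summable_sums)
      qed
      then have "(\<lambda>m. \<Sum>J\<in>multi_indices n ?K. eps k J s * (lam \<alpha> m * ?f J m)) sums
          (\<Sum>J\<in>multi_indices n ?K. eps k J s * y \<alpha> J T)"
        by (intro sums_sum sums_mult)
      moreover have "(\<Sum>J\<in>multi_indices n ?K. eps k J s * (lam \<alpha> m * ?f J m))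
          = lam \<alpha> m * cinner (T (U \<alpha> m s)) (V \<alpha> m s)" for m
      proof -
        have "(\<Sum>J\<in>multi_indices n ?K. eps k J s * (lam \<alpha> m * ?f J m)) = lam \<alpha> m * (\<Sum>J\<in>multi_indices n ?K. monomial ?K J s * ?f J m)"
          by (simp add: eps_eq_monomial sum_distrib_left mult_ac)
        also have "(\<Sum>J\<in>multi_indices n ?K. monomial ?K J s * ?f J m) = cinner (T (U \<alpha> m s)) (V \<alpha> m s)"
          unfolding U_def V_def using \<alpha> by (intro sum_monomial_tensor TB) auto
        finally show ?thesis .
      qed
      ultimately show ?thesis
        by simp
    qed
    have "(\<Sum>J\<in>multi_indices n ?K. eps k J s * x J T) = (\<Sum>J\<in>multi_indices n ?K. \<Sum>\<alpha>\<in>Pow ?K. eps k J s * y \<alpha> J T)"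
      by (intro sum.cong refl) (simp add: xy sum_distrib_left)
    also have "\<dots> = (\<Sum>\<alpha>\<in>Pow ?K. \<Sum>J\<in>multi_indices n ?K. eps k J s * y \<alpha> J T)"
      by (rule sum.swap)
    also have "cmod \<dots> \<le> (\<Sum>\<alpha>\<in>Pow ?K. \<Sum>m. w \<alpha> m s)"
    proof (rule sum_norm_le)
      fix \<alpha> assume \<alpha>: "\<alpha> \<in> Pow ?K"
      show "cmod (\<Sum>J\<in>multi_indices n ?K. eps k J s * y \<alpha> J T) \<le> (\<Sum>m. w \<alpha> m s)"
        unfolding sums_unique[OF part[OF \<alpha>]]
      proof (rule norm_suminf_le[OF _ w_summable[OF \<alpha> s]])
        fix m
        have "cmod (cinner (T (U \<alpha> m s)) (V \<alpha> m s)) \<le> norm T * (norm (U \<alpha> m s) * norm (V \<alpha> m s))"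
          by (rule cmod_tensor_le)
        also have "\<dots> \<le> norm (U \<alpha> m s) * norm (V \<alpha> m s)"
          using T(2) by (simp add: mult_left_le_one_le)
        finally show "cmod (lam \<alpha> m * cinner (T (U \<alpha> m s)) (V \<alpha> m s)) \<le> w \<alpha> m s"
          by (simp add: w_def norm_mult mult_left_mono)
      qed
    qed
    finally show "cmod (\<Sum>J\<in>multi_indices n ?K. eps k J s * x J T) \<le> (\<Sum>\<alpha>\<in>Pow ?K. \<Sum>m. w \<alpha> m s)" .
  qed
  have "L1_norm A n k x \<le> (\<Sum>\<alpha>\<in>Pow ?K. \<Sum>m. cmod (lam \<alpha> m))"
  proof (rule L1_norm_leI[OF vN x])
    fix t assume t: "t \<in> space (Omega_power_measure k)"
    have rot: "cmod (rotate_array n k u t i j) = 1" if "u \<in> ?W" "i \<in> ?K" for u i j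
      by (rule Omega_power_measure_unimodular[OF measurable_space[OF measurable_rotate_array[OF that(1)] t] that(2)])
    have "(\<Sum>u\<in>?W. L1_integrand A n k x (rotate_array n k u t))
        \<le> (\<Sum>u\<in>?W. \<Sum>\<alpha>\<in>Pow ?K. \<Sum>m. w \<alpha> m (rotate_array n k u t))"
      by (intro sum_mono integrand_le rot)
    also have "\<dots> = (\<Sum>\<alpha>\<in>Pow ?K. \<Sum>u\<in>?W. \<Sum>m. w \<alpha> m (rotate_array n k u t))"
      by (rule sum.swap)
    also have "\<dots> = (\<Sum>\<alpha>\<in>Pow ?K. \<Sum>m. \<Sum>u\<in>?W. w \<alpha> m (rotate_array n k u t))"
      by (intro sum.cong refl suminf_sum[symmetric] w_summable rot)
    also have "\<dots> \<le> (\<Sum>\<alpha>\<in>Pow ?K. \<Sum>m. cmod (lam \<alpha> m) * card ?W)"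
    proof (intro sum_mono suminf_le)
      fix \<alpha> m assume \<alpha>: "\<alpha> \<in> Pow ?K"
      have "(\<Sum>u\<in>?W. norm (U \<alpha> m (rotate_array n k u t)) * norm (V \<alpha> m (rotate_array n k u t))) \<le> card ?W"
        unfolding U_def V_def
        by (rule sum_phase_arrays_norm_product_le) (use \<alpha> h g Omega_power_measure_unimodular[OF t] in auto)
      then show "(\<Sum>u\<in>?W. w \<alpha> m (rotate_array n k u t)) \<le> cmod (lam \<alpha> m) * card ?W"
        unfolding w_def sum_distrib_left[symmetric] by (rule mult_left_mono) simp
    next
      fix \<alpha> assume \<alpha>: "\<alpha> \<in> Pow ?K"
      show "summable (\<lambda>m. \<Sum>u\<in>?W. w \<alpha> m (rotate_array n k u t))"
        by (intro summable_sum w_summable \<alpha> rot)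
      show "summable (\<lambda>m. cmod (lam \<alpha> m) * card ?W)"
        by (rule summable_mult2[OF lam[OF \<alpha>]])
    qed
    also have "\<dots> = (\<Sum>\<alpha>\<in>Pow ?K. \<Sum>m. cmod (lam \<alpha> m)) * card ?W"
      unfolding sum_distrib_right by (intro sum.cong refl suminf_mult2[symmetric] lam)
    finally show "L1_average A n k x t \<le> (\<Sum>\<alpha>\<in>Pow ?K. \<Sum>m. cmod (lam \<alpha> m))"
      using card_phase_arrays_pos[of ?K n] by (simp add: L1_average_def divide_le_eq)
  qed
  also note less
  finally show ?thesis .
qed

theorem theorem3p6:
  fixes A :: "('h::complex_hilbert_space \<Rightarrow>\<^sub>L 'h) set"
    and n k :: nat
    and x :: "(nat \<Rightarrow> nat) \<Rightarrow> ('h \<Rightarrow>\<^sub>L 'h) \<Rightarrow> complex"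
  assumes "von_neumann_algebra A"
    and "n \<ge> 1" and "k \<ge> 1"
    and "\<forall>J \<in> multi_indices n {1..k}. x J \<in> predual A"
  shows "(L1_norm A n k x < 1 \<longrightarrow> admits_decomposition A n k x) \<and>
         (admits_decomposition A n k x \<longrightarrow> L1_norm A n k x < 2 ^ (2 * k))"
proof -
  note vN = assms(1)
  have x: "x J \<in> predual A" "operator_functional A (x J)" if "J \<in> multi_indices n {1..k}" for J
    using assms(4) that predual_operator_functional[OF vN] by auto
  have "admits_decomposition A n k x" if L1: "L1_norm A n k x < 1"
  proof (rule ccontr)
    assume "\<not> admits_decomposition A n k x"
    then have C: "2 ^ (2 * k) \<le> (\<Sum>m. cmod (c m))"
      if "atomic_series (elementary_atoms A n {1..k}) c a (family_function A n {1..k} x)" for c a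
      using admits_decomposition_of_atomic_series[OF vN x(1) that] by force
    have "\<exists>a. (\<forall>J\<in>multi_indices n {1..k}. a J \<in> A) \<and> contractive_family n {1..k} a \<and>
      2 ^ (2 * k) \<le> cmod (\<Sum>J\<in>multi_indices n {1..k}. x J (a J))"
      by (rule dual_contractive_family[OF vN finite_atLeastAtMost]) (fact x(1), fact C)
    then obtain a where aA: "\<And>J. J \<in> multi_indices n {1..k} \<Longrightarrow> a J \<in> A" and a: "contractive_family n {1..k} a"
      and ge: "2 ^ (2 * k) \<le> cmod (\<Sum>J\<in>multi_indices n {1..k}. x J (a J))"
      by blast
    note ge
    also have "cmod (\<Sum>J\<in>multi_indices n {1..k}. x J (a J)) \<le> 2 ^ k * L1_norm A n k x"
      by (rule contractive_family_L1_norm_bound[OF vN x(2) aA a])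
    also have "\<dots> < 2 ^ k * 1"
      using L1 by (intro mult_strict_left_mono) auto
    \<comment> \<open>The duality argument has the smaller constant \<open>2 ^ k\<close>, so there
      is room to spare.\<close>
    also have "\<dots> \<le> 2 ^ (2 * k)"
      by (simp add: power_increasing)
    finally show False
      by simp
  qed
  moreover have "L1_norm A n k x < 2 ^ (2 * k)" if "admits_decomposition A n k x"
    by (rule L1_norm_less_of_decomposition[OF vN x(2) that])
  ultimately show ?thesis
    by blast
qed

end
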